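(* Let $\Gamma$ and $\Gamma'$ be compact metric graphs and let $\widetilde\Gamma$ be formed by inserting $\Gamma'$ into $\Gamma$ at a given vertex $v_0$ of $\Gamma$. Let $H$ be a Schrödinger operator on $\Gamma$ with real potential $q\in L^\infty(\Gamma)$, arbitrary local self-adjoint vertex conditions at all vertices except $v_0$, and a $\delta'$ vertex condition with strength $\beta<0$ at $v_0$. Let $\widehat{\mathcal V}$ be the set of vertices of $\Gamma'$ (regarded as vertices of $\widetilde\Gamma$) to which at least one edge end of $\Gamma$ formerly attached to $v_0$ is attached in $\widetilde\Gamma$. Consider a Schrödinger operator $\widetilde H$ on $\widetilde\Gamma$ such that: (i) at all vertices of $\Gamma$ other than $v_0$ it has the same vertex conditions as $H$, and on all edges of $\Gamma$ it has the same potential as $H$; (ii) on the edges of $\Gamma'$ it has arbitrary real potentials $q_e\in L^\infty(0,L(e))$; (iii) at each $v\in\widehat{\mathcal V}$ a $\delta'$ vertex condition with strength $\beta_v<0$ is imposed, where $$\sum_{v\in\widehat{\mathcal V}}\beta_v=\beta;$$ (iv) at all remaining vertices of $\Gamma'$ (those not in $\widehat{\mathcal V}$) arbitrary local self-adjoint vertex conditions are imposed. Then $$\lambda_k(\widetilde H)\le\lambda_k(H)\qquad\text{for all }k\in\mathbb N.$$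
   Context: A compact metric graph $\Gamma$ consists of a finite vertex set $\mathcal V$, a finite edge set $\mathcal E$ and a length function $L:\mathcal E\to(0,\infty)$; each edge $e$ is identified with $[0,L(e)]$ and its two ends $0$ and $L(e)$ are attached to vertices (loops and multiple edges allowed). $\deg(v)$ is the number of edge ends attached to $v$. $L^2(\Gamma)=\bigoplus_e L^2(0,L(e))$, $\widetilde H^k(\Gamma)=\bigoplus_e H^k(0,L(e))$. For a function $f$ on $\Gamma$ and a vertex $v$, $F(v)\in\mathbb C^{\deg(v)}$ is the vector of boundary values of $f$ at the edge ends attached to $v$, and $F'(v)\in\mathbb C^{\deg(v)}$ is the vector of derivatives at these ends, taken in the direction pointing out of $v$ into the edges. Local self-adjoint vertex conditions at $v$: given orthogonal projections $P_{v,D},P_{v,N},P_{v,R}$ in $\mathbb C^{\deg(v)}$ with mutually orthogonal ranges and sum $I$, and a self-adjoint invertible operator $\Lambda_v$ on $\operatorname{ran}P_{v,R}$, one requires $P_{v,D}F(v)=0$, $P_{v,N}F'(v)=0$, $P_{v,R}F'(v)=\Lambda_vP_{v,R}F(v)$. The Schrödinger operator $H$ with real potential $q=(q_e)_e\in L^\infty(\Gamma)$ and given such conditions at each vertex acts as $(Hf)_e=-f_e''+q_ef_e$ on all $f\in\widetilde H^2(\Gamma)$ satisfying the vertex conditions; it is self-adjoint in $L^2(\Gamma)$, bounded below with purely discrete spectrum, and $\lambda_1(H)\le\lambda_2(H)\le\dots$ are its eigenvalues counted with multiplicities. $\delta'$ condition of strength $\beta_v\in\mathbb R\setminus\{0\}$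 at $v$: $F'(v)$ is a constant vector with common value $f'(v)$, and $\sum_{j=1}^{\deg(v)}F_j(v)=\beta_vf'(v)$. Inserting: $\widetilde\Gamma$ is obtained by inserting $\Gamma'$ into $\Gamma$ at $v_0$ if it is formed by removing $v_0$ from $\Gamma$ and attaching each of the edges (edge ends) incident to $v_0$ to one of the vertices of $\Gamma'$; edge lengths are kept. *)

theory Defs
  imports "HOL-Analysis.Analysis" "HOL-Library.Function_Algebras"
begin

section \<open>Compact metric graphs\<close>

text \<open>
  An edge end is a pair \<open>(e, b)\<close>: \<open>b = False\<close> is the end \<open>0\<close> and \<open>b = True\<close> the end \<open>len e\<close> of
  the interval \<open>[0, len e]\<close>. The map \<open>att\<close> attaches the ends to vertices; loops and
  multiple edges are allowed, and connectedness is not required.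
\<close>

record ('v, 'e) mgraph =
  verts :: "'v set"
  edges :: "'e set"
  len :: "'e \<Rightarrow> real"
  att :: "'e \<times> bool \<Rightarrow> 'v"

definition compact_metric_graph :: "('v, 'e) mgraph \<Rightarrow> bool" where
  "compact_metric_graph G \<longleftrightarrow>
     finite (verts G) \<and> finite (edges G) \<and>
     (\<forall>e\<in>edges G. 0 < len G e \<and> (\<forall>b. att G (e, b) \<in> verts G))"

definition ends_at :: "('v, 'e) mgraph \<Rightarrow> 'v \<Rightarrow> ('e \<times> bool) set" where
  "ends_at G v = {(e, b). e \<in> edges G \<and> att G (e, b) = v}"

text \<open>
  The two graphs live in common vertex and edge types; the disjointness clauses make the
  union of the remaining vertices and edges a disjoint one.
\<close>

definition inserting ::
  "('v, 'e) mgraph \<Rightarrow> 'v \<Rightarrow> ('v, 'e) mgraph \<Rightarrow> ('v, 'e) mgraph \<Rightarrow> bool" where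
  "inserting G v0 G' Gt \<longleftrightarrow>
     v0 \<in> verts G \<and>
     (verts G - {v0}) \<inter> verts G' = {} \<and> edges G \<inter> edges G' = {} \<and>
     verts Gt = (verts G - {v0}) \<union> verts G' \<and>
     edges Gt = edges G \<union> edges G' \<and>
     (\<forall>e\<in>edges G. len Gt e = len G e) \<and>
     (\<forall>e\<in>edges G'. len Gt e = len G' e \<and> (\<forall>b. att Gt (e, b) = att G' (e, b))) \<and>
     (\<forall>e\<in>edges G. \<forall>b. if att G (e, b) = v0 then att Gt (e, b) \<in> verts G'
                       else att Gt (e, b) = att G (e, b))"

definition receiving_verts ::
  "('v, 'e) mgraph \<Rightarrow> 'v \<Rightarrow> ('v, 'e) mgraph \<Rightarrow> ('v, 'e) mgraph \<Rightarrow> 'v set" where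
  "receiving_verts G v0 G' Gt = {v \<in> verts G'. \<exists>i\<in>ends_at G v0. att Gt i = v}"


section \<open>Vertex conditions\<close>

text \<open>
  The space \<open>\<complex>\<^sup>d\<close> with \<open>d = deg v\<close> is indexed by the finite set \<open>S\<close> of edge ends at \<open>v\<close>:
  its vectors are functions on edge ends of which only the entries in \<open>S\<close> matter, and
  its operators are given by matrices. A vertex condition is a relation between the vectors
  \<open>F v\<close> and \<open>F' v\<close>.
\<close>

type_synonym 'i matr = "'i \<Rightarrow> 'i \<Rightarrow> complex"
type_synonym 'i vcond = "('i \<Rightarrow> complex) \<Rightarrow> ('i \<Rightarrow> complex) \<Rightarrow> bool"

definition app :: "'i set \<Rightarrow> 'i matr \<Rightarrow> ('i \<Rightarrow> complex) \<Rightarrow> ('i \<Rightarrow> complex)" where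
  "app S M x = (\<lambda>i. if i \<in> S then \<Sum>j\<in>S. M i j * x j else 0)"

definition inner_on :: "'i set \<Rightarrow> ('i \<Rightarrow> complex) \<Rightarrow> ('i \<Rightarrow> complex) \<Rightarrow> complex" where
  "inner_on S x y = (\<Sum>i\<in>S. cnj (x i) * y i)"

definition range_on :: "'i set \<Rightarrow> 'i matr \<Rightarrow> ('i \<Rightarrow> complex) set" where
  "range_on S M = range (app S M)"

definition orth_proj :: "'i set \<Rightarrow> 'i matr \<Rightarrow> bool" where
  "orth_proj S P \<longleftrightarrow>
     (\<forall>x. app S P (app S P x) = app S P x) \<and>
     (\<forall>x y. inner_on S (app S P x) y = inner_on S x (app S P y))"

definition orth_ran :: "'i set \<Rightarrow> 'i matr \<Rightarrow> 'i matr \<Rightarrow> bool" where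
  "orth_ran S P Q \<longleftrightarrow> (\<forall>x\<in>range_on S P. \<forall>y\<in>range_on S Q. inner_on S x y = 0)"

definition local_self_adjoint :: "'i set \<Rightarrow> 'i vcond \<Rightarrow> bool" where
  "local_self_adjoint S C \<longleftrightarrow> (\<exists>PD PN PR \<Lambda>.
     orth_proj S PD \<and> orth_proj S PN \<and> orth_proj S PR \<and>
     orth_ran S PD PN \<and> orth_ran S PD PR \<and> orth_ran S PN PR \<and>
     (\<forall>x. \<forall>i\<in>S. app S PD x i + app S PN x i + app S PR x i = x i) \<and>
     bij_betw (app S \<Lambda>) (range_on S PR) (range_on S PR) \<and>
     (\<forall>x\<in>range_on S PR. \<forall>y\<in>range_on S PR. inner_on S (app S \<Lambda> x) y = inner_on S x (app S \<Lambda> y)) \<and>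
     (\<forall>F F'. C F F' \<longleftrightarrow>
        app S PD F = (\<lambda>_. 0) \<and> app S PN F' = (\<lambda>_. 0) \<and>
        app S PR F' = app S \<Lambda> (app S PR F)))"

definition delta_prime :: "'i set \<Rightarrow> real \<Rightarrow> 'i vcond" where
  "delta_prime S \<beta> F F' \<longleftrightarrow>
     (\<exists>c. (\<forall>i\<in>S. F' i = c) \<and> (\<Sum>i\<in>S. F i) = complex_of_real \<beta> * c)"


section \<open>Function spaces on an edge\<close>

definition L2 :: "real \<Rightarrow> (real \<Rightarrow> complex) \<Rightarrow> bool" where
  "L2 l g \<longleftrightarrow> g \<in> borel_measurable (lebesgue_on {0..l}) \<and>
     integrable (lebesgue_on {0..l}) (\<lambda>x. (cmod (g x))\<^sup>2)"

definition Linf :: "real \<Rightarrow> (real \<Rightarrow> real) \<Rightarrow> bool" where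
  "Linf l q \<longleftrightarrow> q \<in> borel_measurable (lebesgue_on {0..l}) \<and>
     (\<exists>K. AE x in lebesgue_on {0..l}. \<bar>q x\<bar> \<le> K)"

text \<open>
  \<open>f\<close> is (the continuous representative of) an element of \<open>H\<^sup>1(0, l)\<close> with derivative \<open>g\<close>;
  \<open>g\<close> is determined almost everywhere.
\<close>

definition has_L2_deriv :: "real \<Rightarrow> (real \<Rightarrow> complex) \<Rightarrow> (real \<Rightarrow> complex) \<Rightarrow> bool" where
  "has_L2_deriv l f g \<longleftrightarrow>
     L2 l g \<and> (\<forall>x\<in>{0..l}. f x = f 0 + (LINT t|lebesgue_on {0..x}. g t))"

definition deriv_on :: "real \<Rightarrow> (real \<Rightarrow> complex) \<Rightarrow> real \<Rightarrow> complex" where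
  "deriv_on l f x = vector_derivative f (at x within {0..l})"

text \<open>
  \<open>f\<close> is (the \<open>C\<^sup>1\<close> representative of) an element of \<open>H\<^sup>2(0, l)\<close> with second derivative \<open>g\<close>:
  the classical derivative \<open>f'\<close> is absolutely continuous on \<open>[0, l]\<close>, with \<open>f'' = g\<close> in
  \<open>L\<^sup>2(0, l)\<close>.
\<close>

definition has_L2_deriv2 :: "real \<Rightarrow> (real \<Rightarrow> complex) \<Rightarrow> (real \<Rightarrow> complex) \<Rightarrow> bool" where
  "has_L2_deriv2 l f g \<longleftrightarrow> f differentiable_on {0..l} \<and> has_L2_deriv l (deriv_on l f) g"


section \<open>Schroedinger operators\<close>

text \<open>
  Functions on \<open>G\<close> are families \<open>f e x\<close>. Derivatives at edge ends are taken in the direction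
  pointing into the edge.
\<close>

type_synonym 'e gfun = "'e \<Rightarrow> real \<Rightarrow> complex"

definition bval :: "('v, 'e) mgraph \<Rightarrow> 'e gfun \<Rightarrow> 'e \<times> bool \<Rightarrow> complex" where
  "bval G f = (\<lambda>(e, b). if b then f e (len G e) else f e 0)"

definition bderiv :: "('v, 'e) mgraph \<Rightarrow> 'e gfun \<Rightarrow> 'e \<times> bool \<Rightarrow> complex" where
  "bderiv G f = (\<lambda>(e, b). if b then - deriv_on (len G e) (f e) (len G e)
                          else deriv_on (len G e) (f e) 0)"

text \<open>
  Elements of the domain are represented by their unique \<open>C\<^sup>1\<close> representatives on the closed
  edges, extended by \<open>0\<close>; hence distinct functions in it are distinct elements
  of \<open>L\<^sup>2(G)\<close>.
\<close>

definition op_domain ::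
  "('v, 'e) mgraph \<Rightarrow> ('v \<Rightarrow> ('e \<times> bool) vcond) \<Rightarrow> 'e gfun set" where
  "op_domain G C = {f.
     (\<forall>e\<in>edges G. \<exists>g. has_L2_deriv2 (len G e) (f e) g) \<and>
     (\<forall>e x. e \<notin> edges G \<or> x \<notin> {0..len G e} \<longrightarrow> f e x = 0) \<and>
     (\<forall>v\<in>verts G. C v (bval G f) (bderiv G f))}"

text \<open>
  The operator is given by its graph, the set of pairs \<open>(f, H f)\<close>, where the
  values \<open>H f\<close> matter only almost everywhere on the edges.
\<close>

definition schroedinger ::
  "('v, 'e) mgraph \<Rightarrow> ('e \<Rightarrow> real \<Rightarrow> real) \<Rightarrow> ('v \<Rightarrow> ('e \<times> bool) vcond)
     \<Rightarrow> ('e gfun \<times> 'e gfun) set" where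
  "schroedinger G q C = {(f, h). f \<in> op_domain G C \<and>
     (\<forall>e\<in>edges G. \<exists>g. has_L2_deriv2 (len G e) (f e) g \<and>
        (AE x in lebesgue_on {0..len G e}.
           h e x = - g x + complex_of_real (q e x) * f e x))}"


section \<open>Eigenvalues\<close>

definition gscale :: "complex \<Rightarrow> 'e gfun \<Rightarrow> 'e gfun" where
  "gscale c f = (\<lambda>e x. c * f e x)"

interpretation gfun: vector_space gscale
  by unfold_locales (auto simp: gscale_def fun_eq_iff algebra_simps)

definition eigenspace :: "('e gfun \<times> 'e gfun) set \<Rightarrow> real \<Rightarrow> 'e gfun set" where
  "eigenspace H \<mu> = {f. (f, gscale (complex_of_real \<mu>) f) \<in> H}"

definition eigenvalue :: "('e gfun \<times> 'e gfun) set \<Rightarrow> real \<Rightarrow> bool" where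
  "eigenvalue H \<mu> \<longleftrightarrow> (\<exists>f\<in>eigenspace H \<mu>. f \<noteq> 0)"

definition multiplicity :: "('e gfun \<times> 'e gfun) set \<Rightarrow> real \<Rightarrow> nat" where
  "multiplicity H \<mu> = gfun.dim (eigenspace H \<mu>)"

text \<open>
  \<open>nth_eigenvalue H k\<close>, for \<open>k \<ge> 1\<close>, is the \<open>k\<close>-th entry of the nondecreasing list of the
  eigenvalues of \<open>H\<close> repeated according to multiplicity: the least \<open>t\<close> such that \<open>H\<close> has
  at least \<open>k\<close> eigenvalues \<open>\<le> t\<close>, counted with multiplicities. For an operator that is bounded
  below with purely discrete spectrum the infimum is attained.
\<close>

definition nth_eigenvalue :: "('e gfun \<times> 'e gfun) set \<Rightarrow> nat \<Rightarrow> real" where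
  "nth_eigenvalue H k = Inf {t. \<exists>M. finite M \<and> (\<forall>\<mu>\<in>M. eigenvalue H \<mu> \<and> \<mu> \<le> t) \<and>
     k \<le> (\<Sum>\<mu>\<in>M. multiplicity H \<mu>)}"

end

theory Submission
  imports Defs "HOL-Complex_Analysis.Great_Picard" "HOL-Computational_Algebra.Polynomial"
begin

text \<open>
  The comparison is an instance of the min-max principle. A Schroedinger operator on a metric graph
  is described by its quadratic form
  \<open>a(f) = \<Sum>\<^sub>e (\<integral> |f'|\<^sup>2 + q |f|\<^sup>2) + \<Sum>\<^sub>v b\<^sub>v(F(v))\<close>, and \<open>\<lambda>\<^sub>k\<close> is the least \<open>t\<close> for which \<open>a \<le> t \<parallel>\<cdot>\<parallel>\<^sup>2\<close>
  on some \<open>k\<close>-dimensional subspace of the form domain. A \<open>\<delta>'\<close> condition of strength \<open>\<beta>\<close> puts no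
  constraint on the boundary values and contributes \<open>b\<^sub>v(F) = |\<Sum>\<^sub>j F\<^sub>j|\<^sup>2 / \<beta>\<close>. Hence a function in the
  form domain on the original graph, extended by zero to the inserted edges, lies in the form domain on
  the enlarged graph: the boundary values at \<open>v\<^sub>0\<close> are distributed over the receiving vertices, which
  constrain nothing, and at the other inserted vertices all boundary values vanish. With \<open>s\<^sub>v\<close> the
  sum of the values received by \<open>v\<close>, the form of the extension differs from the original one by
  \<open>\<Sum>\<^sub>v |s\<^sub>v|\<^sup>2 / \<beta>\<^sub>v - |\<Sum>\<^sub>v s\<^sub>v|\<^sup>2 / \<beta>\<close>, and since all strengths are negative and add up to \<open>\<beta>\<close>, this is
  nonpositive by the Cauchy-Schwarz inequality (\<open>sum_inverse_strength_le\<close>). The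
  trial space spanned by the first \<open>k\<close> eigenfunctions of the original operator then gives the claim
  (\<open>nth_eigenvalue_insertion_le\<close>).

  Most of the work goes into the min-max principle, since \<open>\<lambda>\<^sub>k\<close> is defined by counting the
  eigenvalues of the operator. For an abstract closed semibounded form with compactly embedded domain,
  successive minimisation yields an orthonormal sequence of weak eigenvectors (\<open>eigensequence\<close>). On a
  graph, closedness and compactness come from the Riesz-Fischer theorem, the Arzela-Ascoli theorem
  and a trace estimate that bounds the boundary terms by a small multiple of the kinetic energy plus a
  multiple of the mass (\<open>graph_form_estimate\<close>). Weak eigenvectors are eigenfunctions of the operator by du
  Bois-Reymond's lemma (\<open>weak_second_derivative\<close>, \<open>weak_imp_eigenfunction\<close>), and eigenfunctions are
  weak eigenvectors by integration by parts (\<open>eigenfunction_imp_weak\<close>). Comparing the two ways of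
  counting shows that \<open>\<lambda>\<^sub>k\<close> is the \<open>k\<close>-th successive minimum (\<open>eigenvalue_sequence\<close>).
\<close>

section \<open>Linear algebra and hermitian forms\<close>

text \<open>
  What dimension counting amounts to in the min-max argument: \<open>n + 1\<close> trial functions
  have a nontrivial combination satisfying \<open>n\<close> orthogonality constraints. The
  induction eliminates one unknown by means of one equation.
\<close>

lemma underdetermined_system:
  fixes M :: "nat \<Rightarrow> nat \<Rightarrow> complex"
  shows "\<exists>c. (\<exists>j\<le>n. c j \<noteq> 0) \<and> (\<forall>i<n. (\<Sum>j\<le>n. M i j * c j) = 0)"
proof (induction n arbitrary: M)
  case 0
  show ?case by (rule exI[of _ "\<lambda>_. 1"]) simp
next
  case (Suc n)
  show ?case
  proof (cases "\<exists>k\<le>Suc n. M n k \<noteq> 0")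
    case False
    obtain c where c: "\<exists>j\<le>n. c j \<noteq> 0" "\<forall>i<n. (\<Sum>j\<le>n. M i j * c j) = 0"
      using Suc.IH[of M] by blast
    define d where "d = (\<lambda>j. if j \<le> n then c j else 0)"
    have "\<exists>j\<le>Suc n. d j \<noteq> 0" using c(1) by (auto simp: d_def intro: le_SucI)
    moreover have "(\<Sum>j\<le>Suc n. M i j * d j) = 0" if "i < Suc n" for i
    proof (cases "i = n")
      case True
      with False show ?thesis by (intro sum.neutral) auto
    next
      case False
      then show ?thesis using c(2) that by (simp add: d_def)
    qed
    ultimately show ?thesis by blast
  next
    case True
    then obtain k where k: "k \<le> Suc n" "M n k \<noteq> 0" by blast
    \<comment> \<open>The last equation eliminates the unknown \<open>k\<close>; \<open>s\<close> enumerates the other unknowns.\<close>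
    define s where "s = (\<lambda>j. if j < k then j else Suc j)"
    have s: "bij_betw s {..n} ({..Suc n} - {k})"
    proof (rule bij_betwI[where g = "\<lambda>j. if j < k then j else j - 1"])
      show "s \<in> {..n} \<rightarrow> {..Suc n} - {k}" by (auto simp: s_def)
      show "(\<lambda>j. if j < k then j else j - 1) \<in> {..Suc n} - {k} \<rightarrow> {..n}"
        using k by (auto split: if_splits; arith)
    qed (auto simp: s_def)
    define N where "N = (\<lambda>i j. M i (s j) - M i k / M n k * M n (s j))"
    obtain c where c: "\<exists>j\<le>n. c j \<noteq> 0" "\<forall>i<n. (\<Sum>j\<le>n. N i j * c j) = 0"
      using Suc.IH[of N] by blast
    define t where "t = the_inv_into {..n} s"
    have ts: "t (s j) = j" if "j \<le> n" for j
      unfolding t_def using s that by (intro the_inv_into_f_f) (auto simp: bij_betw_def)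
    define d where "d = (\<lambda>j. if j = k then - (\<Sum>j\<le>n. M n (s j) * c j) / M n k else c (t j))"
    have sk: "s j \<noteq> k" "s j \<le> Suc n" if "j \<le> n" for j
      using bij_betwE[OF s] that by auto
    have ds: "d (s j) = c j" if "j \<le> n" for j using sk[OF that] ts[OF that] by (simp add: d_def)
    obtain j0 where "j0 \<le> n" "c j0 \<noteq> 0" using c(1) by blast
    then have "\<exists>j\<le>Suc n. d j \<noteq> 0" using ds[of j0] sk[of j0] by (intro exI[of _ "s j0"]) auto
    moreover have "(\<Sum>j\<le>Suc n. M i j * d j) = 0" if "i < Suc n" for i
    proof -
      have "(\<Sum>j\<le>Suc n. M i j * d j) = M i k * d k + (\<Sum>j\<in>{..Suc n} - {k}. M i j * d j)"
        using k(1) by (intro sum.remove) auto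
      also have "(\<Sum>j\<in>{..Suc n} - {k}. M i j * d j) = (\<Sum>j\<le>n. M i (s j) * c j)"
        using ds by (subst sum.reindex_bij_betw[OF s, symmetric]) (auto intro!: sum.cong)
      finally have eq: "(\<Sum>j\<le>Suc n. M i j * d j) = M i k * d k + (\<Sum>j\<le>n. M i (s j) * c j)" .
      show ?thesis
      proof (cases "i = n")
        case True
        then show ?thesis using eq k by (simp add: d_def)
      next
        case False
        then have "(\<Sum>j\<le>n. N i j * c j) = 0" using c(2) that by simp
        then have "(\<Sum>j\<le>n. M i (s j) * c j) = M i k / M n k * (\<Sum>j\<le>n. M n (s j) * c j)"
          by (simp add: N_def algebra_simps sum_subtractf sum_distrib_left)
        then show ?thesis using eq by (simp add: d_def)
      qed
    qed
    ultimately show ?thesis by blast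
  qed
qed

text \<open>
  Sesquilinear forms are conjugate linear in the first argument. Hermitian and positive
  semidefinite are predicates of a form and a subspace, so that the inner product, the energy form,
  their combinations and their restrictions to subspaces can all be treated alike.
\<close>

locale complex_space = vector_space scale
  for scale :: "complex \<Rightarrow> 'a::ab_group_add \<Rightarrow> 'a" (infixr \<open>\<star>\<close> 75)
begin

abbreviation "lincomb n c w \<equiv> (\<Sum>j\<le>(n :: nat). c j \<star> w j)"

definition hermitian_on :: "'a set \<Rightarrow> ('a \<Rightarrow> 'a \<Rightarrow> complex) \<Rightarrow> bool" where
  "hermitian_on V p \<longleftrightarrow> subspace V \<and>
     (\<forall>x\<in>V. \<forall>y\<in>V. \<forall>z\<in>V. p x (y + z) = p x y + p x z) \<and>
     (\<forall>x\<in>V. \<forall>y\<in>V. \<forall>c. p x (c \<star> y) = c * p x y) \<and>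
     (\<forall>x\<in>V. \<forall>y\<in>V. p y x = cnj (p x y))"

definition psd_on :: "'a set \<Rightarrow> ('a \<Rightarrow> 'a \<Rightarrow> complex) \<Rightarrow> bool" where
  "psd_on V p \<longleftrightarrow> hermitian_on V p \<and> (\<forall>x\<in>V. 0 \<le> Re (p x x))"

lemma hermitian_on_subset: "hermitian_on V p \<Longrightarrow> subspace U \<Longrightarrow> U \<subseteq> V \<Longrightarrow> hermitian_on U p"
  unfolding hermitian_on_def subset_eq by blast

context
  fixes V p assumes h: "hermitian_on V p"
begin

lemma hermitian_subspace: "subspace V" using h by (simp add: hermitian_on_def)

lemma hermitian_closed:
  "0 \<in> V" "x \<in> V \<Longrightarrow> y \<in> V \<Longrightarrow> x + y \<in> V" "x \<in> V \<Longrightarrow> y \<in> V \<Longrightarrow> x - y \<in> V"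
  "x \<in> V \<Longrightarrow> c \<star> x \<in> V" "(\<And>i. i \<in> I \<Longrightarrow> f i \<in> V) \<Longrightarrow> sum f I \<in> V"
  using hermitian_subspace
  by (auto intro: subspace_0 subspace_add subspace_diff subspace_scale subspace_sum)

lemma hermitian_swap: "x \<in> V \<Longrightarrow> y \<in> V \<Longrightarrow> p y x = cnj (p x y)"
  using h unfolding hermitian_on_def by blast

lemma hermitian_add_right: "x \<in> V \<Longrightarrow> y \<in> V \<Longrightarrow> z \<in> V \<Longrightarrow> p x (y + z) = p x y + p x z"
  using h unfolding hermitian_on_def by blast

lemma hermitian_scale_right: "x \<in> V \<Longrightarrow> y \<in> V \<Longrightarrow> p x (c \<star> y) = c * p x y"
  using h unfolding hermitian_on_def by blast

lemma hermitian_add_left: "x \<in> V \<Longrightarrow> y \<in> V \<Longrightarrow> z \<in> V \<Longrightarrow> p (y + z) x = p y x + p z x"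
  using hermitian_swap[of x "y + z"] hermitian_swap[of x y] hermitian_swap[of x z]
    hermitian_add_right[of x y z] hermitian_closed(2)[of y z] by simp

lemma hermitian_scale_left: "x \<in> V \<Longrightarrow> y \<in> V \<Longrightarrow> p (c \<star> y) x = cnj c * p y x"
  using hermitian_swap[of x "c \<star> y"] hermitian_swap[of x y]
    hermitian_scale_right[of x y c] hermitian_closed(4)[of y c] by simp

lemma hermitian_zero_right: "x \<in> V \<Longrightarrow> p x 0 = 0"
  using hermitian_scale_right[of x 0 0] hermitian_closed by simp

lemma hermitian_diff_right: "x \<in> V \<Longrightarrow> y \<in> V \<Longrightarrow> z \<in> V \<Longrightarrow> p x (y - z) = p x y - p x z"
  using hermitian_add_right[of x "y - z" z] hermitian_closed by simp

lemma hermitian_sum_right: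
  "x \<in> V \<Longrightarrow> (\<And>i. i \<in> I \<Longrightarrow> f i \<in> V) \<Longrightarrow> p x (sum f I) = (\<Sum>i\<in>I. p x (f i))"
proof (induction I rule: infinite_finite_induct)
  case (insert j I)
  then show ?case using hermitian_add_right hermitian_closed(5)[of I f] by simp
qed (simp_all add: hermitian_zero_right)

lemma hermitian_sum_left:
  "x \<in> V \<Longrightarrow> (\<And>i. i \<in> I \<Longrightarrow> f i \<in> V) \<Longrightarrow> p (sum f I) x = (\<Sum>i\<in>I. p (f i) x)"
proof -
  assume x: "x \<in> V" and f: "\<And>i. i \<in> I \<Longrightarrow> f i \<in> V"
  have "p (sum f I) x = cnj (\<Sum>i\<in>I. p x (f i))"
    using hermitian_swap[of x "sum f I"] hermitian_sum_right[of x I f] hermitian_closed(5)[of I f] x f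
    by simp
  also have "\<dots> = (\<Sum>i\<in>I. p (f i) x)"
    unfolding cnj_sum by (rule sum.cong) (use hermitian_swap[OF x f] in auto)
  finally show ?thesis .
qed

lemma hermitian_real: "x \<in> V \<Longrightarrow> p x x = of_real (Re (p x x))"
  using arg_cong[OF hermitian_swap[of x x], of Im] by (simp add: complex_eq_iff)

lemma hermitian_square_add:
  assumes "x \<in> V" "y \<in> V"
  shows "Re (p (x + c \<star> y) (x + c \<star> y)) = Re (p x x) + 2 * Re (c * p x y) + (cmod c)\<^sup>2 * Re (p y y)"
proof -
  have "p (x + c \<star> y) (x + c \<star> y) = p x x + c * p x y + cnj c * p y x + (cnj c * c) * p y y"
    using assms by (simp add: hermitian_add_right hermitian_add_left hermitian_scale_right
        hermitian_scale_left hermitian_closed algebra_simps)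
  moreover have "cnj c * c = of_real ((cmod c)\<^sup>2)"
    using complex_norm_square[of c] by (simp add: mult.commute)
  moreover have "Re (cnj c * p y x) = Re (c * p x y)"
    using hermitian_swap[of x y] assms by simp
  ultimately show ?thesis by simp
qed

lemma parallelogram:
  assumes "x \<in> V" "y \<in> V"
  shows "Re (p (x - y) (x - y)) + Re (p (x + y) (x + y)) = 2 * Re (p x x) + 2 * Re (p y y)"
  using hermitian_square_add[OF assms, of 1] hermitian_square_add[OF assms, of "-1"] by simp

end

context
  fixes V p assumes psd: "psd_on V p"
begin

lemma psd_hermitian: "hermitian_on V p" using psd by (simp add: psd_on_def)

lemma psd_nonneg: "x \<in> V \<Longrightarrow> 0 \<le> Re (p x x)" using psd by (simp add: psd_on_def)

text \<open>
  Evaluate the form at \<open>x - s cnj (p x y) y\<close> for real \<open>s\<close>. If \<open>p y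
  y = 0\<close>, a large \<open>s\<close> forces \<open>p x y = 0\<close>; otherwise \<open>s = 1 /
  p y y\<close> is optimal.
\<close>

lemma Cauchy_Schwarz_psd:
  assumes "x \<in> V" "y \<in> V"
  shows "(cmod (p x y))\<^sup>2 \<le> Re (p x x) * Re (p y y)"
proof -
  define A B z where "A = Re (p x x)" and "B = Re (p y y)" and "z = p x y"
  have AB: "0 \<le> A" "0 \<le> B" using assms psd_nonneg by (auto simp: A_def B_def)
  have main: "0 \<le> A - 2 * s * (cmod z)\<^sup>2 + s\<^sup>2 * (cmod z)\<^sup>2 * B" for s :: real
  proof -
    have "x + (- of_real s * cnj z) \<star> y \<in> V" using hermitian_closed[OF psd_hermitian] assms by blast
    then have "0 \<le> A + 2 * Re ((- of_real s * cnj z) * z) + (cmod (- of_real s * cnj z))\<^sup>2 * B"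
      using psd_nonneg[of "x + (- of_real s * cnj z) \<star> y"]
        hermitian_square_add[OF psd_hermitian assms, of "- of_real s * cnj z"]
      unfolding A_def B_def z_def by linarith
    moreover have "(- of_real s * cnj z) * z = of_real (- s * (cmod z)\<^sup>2)"
      using complex_norm_square[of z] by (simp add: mult.commute mult.left_commute)
    ultimately show ?thesis by (simp only: Re_complex_of_real) (simp add: norm_mult power_mult_distrib)
  qed
  have "(cmod z)\<^sup>2 \<le> A * B"
  proof (cases "B = 0")
    case True
    have "cmod z = 0"
    proof (rule ccontr)
      assume "cmod z \<noteq> 0"
      then show False using main[of "(A + 1) / (cmod z)\<^sup>2"] True AB(1) by simp
    qed
    then show ?thesis using True by simp
  next
    case False
    then have "0 \<le> A - (cmod z)\<^sup>2 / B" using main[of "1 / B"] by (simp add: power2_eq_square)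
    then show ?thesis using False AB by (simp add: pos_divide_le_eq)
  qed
  then show ?thesis by (simp add: A_def B_def z_def)
qed

lemma psd_null: "x \<in> V \<Longrightarrow> y \<in> V \<Longrightarrow> Re (p x x) = 0 \<Longrightarrow> p x y = 0"
  using Cauchy_Schwarz_psd[of x y] by simp

lemma psd_tendsto_right:
  assumes "y \<in> V" "x \<in> V" "\<And>n. X n \<in> V"
    and lim: "(\<lambda>n. Re (p (X n - x) (X n - x))) \<longlonglongrightarrow> 0"
  shows "(\<lambda>n. p y (X n)) \<longlonglongrightarrow> p y x"
proof -
  note cl = hermitian_closed[OF psd_hermitian]
  have "(\<lambda>n. sqrt (Re (p y y) * Re (p (X n - x) (X n - x)))) \<longlonglongrightarrow> sqrt (Re (p y y) * 0)"
    by (intro tendsto_intros lim)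
  then have sq: "(\<lambda>n. sqrt (Re (p y y) * Re (p (X n - x) (X n - x)))) \<longlonglongrightarrow> 0" by simp
  have le: "norm (p y (X n) - p y x) \<le> sqrt (Re (p y y) * Re (p (X n - x) (X n - x)))" for n
    using Cauchy_Schwarz_psd[of y "X n - x"] hermitian_diff_right[OF psd_hermitian, of y "X n" x]
      assms(1-3) cl by (simp add: real_le_rsqrt)
  have "(\<lambda>n. p y (X n) - p y x) \<longlonglongrightarrow> 0"
    by (rule Lim_null_comparison[OF always_eventually sq]) (simp add: le)
  then show ?thesis by (simp add: LIM_zero_iff)
qed

lemma psd_tendsto_square:
  assumes "x \<in> V" "\<And>n. X n \<in> V"
    and lim: "(\<lambda>n. Re (p (X n - x) (X n - x))) \<longlonglongrightarrow> 0"
  shows "(\<lambda>n. Re (p (X n) (X n))) \<longlonglongrightarrow> Re (p x x)"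
proof -
  note cl = hermitian_closed[OF psd_hermitian]
  have "(\<lambda>n. Re (p (X n - x) (X n - x)) + 2 * Re (p x (X n)) - Re (p x x))
     \<longlonglongrightarrow> 0 + 2 * Re (p x x) - Re (p x x)"
    by (intro tendsto_intros lim psd_tendsto_right assms)
  moreover have "Re (p (X n) (X n)) = Re (p (X n - x) (X n - x)) + 2 * Re (p x (X n)) - Re (p x x)" for n
    using hermitian_square_add[OF psd_hermitian, of x "X n" "-1"]
      hermitian_square_add[OF psd_hermitian, of "X n" x "-1"] assms(1,2)
      hermitian_swap[OF psd_hermitian, of x "X n"] by simp
  ultimately show ?thesis by simp
qed

end

end

section \<open>The variational principle for closed forms\<close>

context complex_space
begin

definition cauchy_for :: "('a \<Rightarrow> 'a \<Rightarrow> complex) \<Rightarrow> (nat \<Rightarrow> 'a) \<Rightarrow> bool" where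
  "cauchy_for p X \<longleftrightarrow> (\<forall>e>0. \<exists>N. \<forall>m\<ge>N. \<forall>n\<ge>N. Re (p (X m - X n) (X m - X n)) < e)"

end

text \<open>
  The abstract setting for an operator that is bounded below and has discrete spectrum: a closed
  semibounded form \<open>a\<close> whose domain \<open>V\<close> embeds compactly into the space
  with inner product \<open>ip\<close>. Compactness and closedness are stated for sequences in
  \<open>V\<close>.
\<close>

locale form_space = complex_space scale
  for scale :: "complex \<Rightarrow> 'a::ab_group_add \<Rightarrow> 'a" (infixr \<open>\<star>\<close> 75) +
  fixes V :: "'a set" and ip a :: "'a \<Rightarrow> 'a \<Rightarrow> complex"
  assumes ip_psd: "psd_on V ip"
    and a_hermitian: "hermitian_on V a"
    and bounded_below: "\<exists>c. \<forall>x\<in>V. - c * Re (ip x x) \<le> Re (a x x)"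
    and compact_embedding: "\<lbrakk>\<And>n. X n \<in> V; \<And>n. Re (ip (X n) (X n)) \<le> K; \<And>n. Re (a (X n) (X n)) \<le> K\<rbrakk>
          \<Longrightarrow> \<exists>r. strict_mono (r :: nat \<Rightarrow> nat) \<and> cauchy_for ip (X \<circ> r)"
    and closed_form: "\<lbrakk>\<And>n. X n \<in> V; cauchy_for ip X; cauchy_for a X\<rbrakk> \<Longrightarrow>
          \<exists>x\<in>V. (\<lambda>n. Re (ip (X n - x) (X n - x))) \<longlonglongrightarrow> 0 \<and> (\<lambda>n. Re (a (X n - x) (X n - x))) \<longlonglongrightarrow> 0"
    and infinite_dimensional: "\<exists>w. (\<forall>j\<le>n. w j \<in> V) \<and>
          (\<forall>c. (\<exists>j\<le>n::nat. c j \<noteq> 0) \<longrightarrow> 0 < Re (ip (lincomb n c w) (lincomb n c w)))"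
begin

lemma ip_hermitian: "hermitian_on V ip"
  using ip_psd by (rule psd_hermitian)

lemmas V_closed = hermitian_closed[OF ip_hermitian]

text \<open>
  Adding a multiple of \<open>ip\<close> makes the energy positive, so that the Cauchy-Schwarz
  inequality and the resulting continuity properties apply to it.
\<close>

lemma shifted_psd: "\<exists>c::real. psd_on V (\<lambda>x y. a x y + of_real c * ip x y)"
proof -
  obtain c where c: "\<forall>x\<in>V. - c * Re (ip x x) \<le> Re (a x x)" using bounded_below by blast
  have "hermitian_on V (\<lambda>x y. a x y + of_real c * ip x y)"
    unfolding hermitian_on_def
  proof (intro conjI ballI allI)
    fix x y assume xy: "x \<in> V" "y \<in> V"
    show "a y x + of_real c * ip y x = cnj (a x y + of_real c * ip x y)"
      using hermitian_swap[OF a_hermitian xy] hermitian_swap[OF ip_hermitian xy] by simp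
  qed (simp_all add: hermitian_subspace[OF ip_hermitian] hermitian_add_right[OF a_hermitian]
      hermitian_add_right[OF ip_hermitian] hermitian_scale_right[OF a_hermitian]
      hermitian_scale_right[OF ip_hermitian] algebra_simps)
  moreover have "0 \<le> Re (a x x + of_real c * ip x x)" if "x \<in> V" for x
    using c that by auto
  ultimately show ?thesis unfolding psd_on_def by blast
qed

text \<open>
  The direct method: a minimising sequence has bounded energy, hence an \<open>ip\<close>-Cauchy
  subsequence; by the parallelogram law this subsequence is Cauchy in energy as well, and
  closedness of the form provides the limit.
\<close>

lemma minimizer_exists:
  assumes U: "subspace U" "U \<subseteq> V"
    and closed: "\<And>X x. (\<And>n. X n \<in> U) \<Longrightarrow> x \<in> V \<Longrightarrow> (\<lambda>n. Re (ip (X n - x) (X n - x))) \<longlonglongrightarrow> 0 \<Longrightarrow> x \<in> U"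
    and x0: "x0 \<in> U" "0 < Re (ip x0 x0)"
  shows "\<exists>u\<in>U. ip u u = 1 \<and> (\<forall>y\<in>U. Re (a u u) * Re (ip y y) \<le> Re (a y y))"
proof -
  let ?n = "\<lambda>x. Re (ip x x)" and ?a = "\<lambda>x. Re (a x x)"
  have UV: "x \<in> V" if "x \<in> U" for x using that U(2) by blast
  have n_scale: "?n (of_real s \<star> x) = s\<^sup>2 * ?n x" and a_scale: "?a (of_real s \<star> x) = s\<^sup>2 * ?a x"
    if "x \<in> U" for s x
    using that UV V_closed
    by (simp_all add: hermitian_scale_right[OF ip_hermitian] hermitian_scale_left[OF ip_hermitian]
        hermitian_scale_right[OF a_hermitian] hermitian_scale_left[OF a_hermitian] power2_eq_square)
  obtain c where c: "\<And>x. x \<in> V \<Longrightarrow> - c * ?n x \<le> ?a x" using bounded_below by blast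
  define A where "A = {?a x |x. x \<in> U \<and> ?n x = 1}"
  define m where "m = Inf A"
  have normalize: "\<exists>s. s \<noteq> 0 \<and> ?n (of_real s \<star> x) = 1 \<and> of_real s \<star> x \<in> U"
    if "x \<in> U" "0 < ?n x" for x
    using that subspace_scale[OF U(1)] n_scale[OF that(1), of "1 / sqrt (?n x)"]
    by (intro exI[of _ "1 / sqrt (?n x)"]) (simp add: power_divide del: of_real_divide)
  have A: "A \<noteq> {}" "bdd_below A"
    using normalize[OF x0] c UV by (auto simp: A_def bdd_below_def intro!: exI[of _ "-c"])
      (metis mult.right_neutral)
  have m_le: "m * ?n y \<le> ?a y" if y: "y \<in> U" for y
  proof (cases "?n y = 0")
    case True
    then show ?thesis using c[OF UV[OF y]] by simp
  next
    case False
    then have "0 < ?n y" using psd_nonneg[OF ip_psd UV[OF y]] by simp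
    then obtain s where s: "s \<noteq> 0" "?n (of_real s \<star> y) = 1" "of_real s \<star> y \<in> U" using normalize y by blast
    then have "m \<le> ?a (of_real s \<star> y)" unfolding m_def by (intro cInf_lower A) (auto simp: A_def)
    then have "m * (s\<^sup>2 * ?n y) \<le> s\<^sup>2 * ?a y" using s n_scale[OF y] a_scale[OF y] by simp
    then have "s\<^sup>2 * (m * ?n y) \<le> s\<^sup>2 * ?a y" by (simp add: algebra_simps)
    then show ?thesis using s(1) by simp
  qed
  have "\<exists>x. x \<in> U \<and> ?n x = 1 \<and> ?a x < m + inverse (real (Suc n))" for n
    using cInf_lessD[OF A(1), of "m + inverse (real (Suc n))"] unfolding m_def[symmetric]
    by (auto simp: A_def)
  then obtain X where X: "\<And>n. X n \<in> U" "\<And>n. ?n (X n) = 1"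
      "\<And>n. ?a (X n) < m + inverse (real (Suc n))" by metis
  have Xm: "m \<le> ?a (X n)" for n using m_le[OF X(1)[of n]] X(2)[of n] by simp
  have "(\<lambda>n. m + inverse (real (Suc n))) \<longlonglongrightarrow> m + 0"
    by (intro tendsto_intros LIMSEQ_inverse_real_of_nat)
  then have lim_m: "(\<lambda>n. m + inverse (real (Suc n))) \<longlonglongrightarrow> m" by simp
  have aX: "(\<lambda>n. ?a (X n)) \<longlonglongrightarrow> m"
    by (rule tendsto_sandwich[OF _ _ tendsto_const lim_m])
      (auto intro!: always_eventually Xm less_imp_le[OF X(3)] simp del: of_nat_Suc)
  have "\<exists>r. strict_mono (r :: nat \<Rightarrow> nat) \<and> cauchy_for ip (X \<circ> r)"
  proof (rule compact_embedding[where K = "max 1 (m + 1)"])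
    show "?a (X n) \<le> max 1 (m + 1)" for n
      using X(3)[of n] le_imp_inverse_le[of 1 "real (Suc n)"] by simp
  qed (use X UV in auto)
  then obtain r where r: "strict_mono (r :: nat \<Rightarrow> nat)" "cauchy_for ip (X \<circ> r)" by blast
  define Y where "Y = X \<circ> r"
  have Y: "Y n \<in> U" "?n (Y n) = 1" for n using X by (auto simp: Y_def)
  have aY: "(\<lambda>n. ?a (Y n)) \<longlonglongrightarrow> m"
    using LIMSEQ_subseq_LIMSEQ[OF aX r(1)] by (simp add: Y_def o_def)
  \<comment> \<open>The parallelogram law turns the minimality of the energies into the Cauchy property.\<close>
  have para: "?a (x - y) \<le> 2 * (?a x - m) + 2 * (?a y - m) + m * ?n (x - y)"
    if "x \<in> U" "y \<in> U" "?n x = 1" "?n y = 1" for x y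
  proof -
    have "?n (x + y) = 4 - ?n (x - y)"
      using parallelogram[OF ip_hermitian UV[OF that(1)] UV[OF that(2)]] that(3,4) by linarith
    moreover have "m * ?n (x + y) \<le> ?a (x + y)" by (rule m_le[OF subspace_add[OF U(1) that(1,2)]])
    ultimately have "m * (4 - ?n (x - y)) \<le> ?a (x + y)" by simp
    then have "4 * m - m * ?n (x - y) \<le> ?a (x + y)" unfolding right_diff_distrib by linarith
    moreover define d where "d = m * ?n (x - y)"
    ultimately have "4 * m - d \<le> ?a (x + y)" by simp
    then have "?a (x - y) \<le> 2 * (?a x - m) + 2 * (?a y - m) + d"
      using parallelogram[OF a_hermitian UV[OF that(1)] UV[OF that(2)]] by simp
    then show ?thesis by (simp only: d_def)
  qed
  have "cauchy_for a Y"
    unfolding cauchy_for_def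
  proof (intro allI impI)
    fix e :: real assume e: "0 < e"
    define d where "d = e / (5 + \<bar>m\<bar>)"
    have d: "0 < d" "d * (5 + \<bar>m\<bar>) = e" using e by (auto simp: d_def)
    obtain N1 where N1: "\<forall>i\<ge>N1. \<forall>j\<ge>N1. ?n (Y i - Y j) < d"
      using r(2) d(1) unfolding cauchy_for_def Y_def by blast
    obtain N2 where N2: "\<forall>i\<ge>N2. ?a (Y i) < m + d"
      using order_tendstoD(2)[OF aY, of "m + d"] d(1) by (auto simp: eventually_sequentially)
    have "?a (Y i - Y j) < e" if "i \<ge> max N1 N2" "j \<ge> max N1 N2" for i j
    proof -
      have n0: "0 \<le> ?n (Y i - Y j)" "?n (Y i - Y j) < d"
        using psd_nonneg[OF ip_psd] V_closed UV Y N1 that by auto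
      have "m * ?n (Y i - Y j) \<le> \<bar>m\<bar> * ?n (Y i - Y j)" using n0 by (intro mult_right_mono) auto
      also have "\<dots> \<le> \<bar>m\<bar> * d" using n0 by (intro mult_left_mono) auto
      finally have "?a (Y i - Y j) < 2 * d + 2 * d + \<bar>m\<bar> * d"
        using para[OF Y(1) Y(1) Y(2) Y(2), of i j] N2 that by (smt (verit) max.bounded_iff)
      also have "\<dots> \<le> e" using d by (simp add: algebra_simps)
      finally show ?thesis .
    qed
    then show "\<exists>N. \<forall>i\<ge>N. \<forall>j\<ge>N. ?a (Y i - Y j) < e" by blast
  qed
  then obtain u where u: "u \<in> V" "(\<lambda>n. ?n (Y n - u)) \<longlonglongrightarrow> 0" "(\<lambda>n. ?a (Y n - u)) \<longlonglongrightarrow> 0"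
    using closed_form[of Y] Y(1) UV r(2) unfolding Y_def[symmetric] by blast
  have uU: "u \<in> U" by (rule closed[OF Y(1) u(1,2)])
  have "(\<lambda>n. ?n (Y n)) \<longlonglongrightarrow> ?n u"
    by (rule psd_tendsto_square[OF ip_psd u(1) UV[OF Y(1)] u(2)])
  then have nu: "?n u = 1" using Y(2) by (simp add: LIMSEQ_const_iff)
  obtain c' where c': "psd_on V (\<lambda>x y. a x y + of_real c' * ip x y)" using shifted_psd by blast
  have "(\<lambda>n. ?a (Y n - u) + c' * ?n (Y n - u)) \<longlonglongrightarrow> 0 + c' * 0"
    by (intro tendsto_intros u)
  then have "(\<lambda>n. Re (a (Y n) (Y n) + of_real c' * ip (Y n) (Y n))) \<longlonglongrightarrow> Re (a u u + of_real c' * ip u u)"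
    by (intro psd_tendsto_square[OF c' u(1) UV[OF Y(1)]]) simp
  then have "(\<lambda>n. ?a (Y n) + c') \<longlonglongrightarrow> ?a u + c'" using Y(2) nu by simp
  from tendsto_diff[OF this tendsto_const[of c']] have "(\<lambda>n. ?a (Y n)) \<longlonglongrightarrow> ?a u" by simp
  then have "?a u = m" using aY LIMSEQ_unique by blast
  then show ?thesis using uU nu m_le hermitian_real[OF ip_hermitian u(1)] by (intro bexI[of _ u]) auto
qed

text \<open>
  At a minimiser \<open>u\<close> of the Rayleigh quotient the form \<open>a - \<mu> ip\<close> is
  positive semidefinite and vanishes at \<open>u\<close>, so by the Cauchy-Schwarz inequality it
  pairs \<open>u\<close> to zero with every vector.
\<close>

lemma minimizer_weak_equation:
  assumes U: "subspace U" "U \<subseteq> V" and u: "u \<in> U" "ip u u = 1"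
    and min: "\<And>y. y \<in> U \<Longrightarrow> Re (a u u) * Re (ip y y) \<le> Re (a y y)" and y: "y \<in> U"
  shows "a u y = of_real (Re (a u u)) * ip u y"
proof -
  define \<mu> where "\<mu> = Re (a u u)"
  define p where "p = (\<lambda>x y. a x y - of_real \<mu> * ip x y)"
  have hU: "hermitian_on U a" "hermitian_on U ip"
    using hermitian_on_subset[OF _ U] a_hermitian ip_hermitian by auto
  have "hermitian_on U p"
    unfolding hermitian_on_def
  proof (intro conjI ballI allI)
    fix x y assume xy: "x \<in> U" "y \<in> U"
    show "p y x = cnj (p x y)"
      using hermitian_swap[OF hU(1) xy] hermitian_swap[OF hU(2) xy] by (simp add: p_def)
  qed (simp_all add: p_def U hermitian_add_right[OF hU(1)] hermitian_add_right[OF hU(2)]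
      hermitian_scale_right[OF hU(1)] hermitian_scale_right[OF hU(2)] algebra_simps)
  then have "psd_on U p" using min by (simp add: psd_on_def p_def \<mu>_def)
  moreover have "Re (p u u) = 0" using u by (simp add: p_def \<mu>_def)
  ultimately have "p u y = 0" using psd_null u(1) y by blast
  then show ?thesis by (simp add: p_def \<mu>_def)
qed

text \<open>
  Minimise successively over the orthogonal complement of the minimisers found so far. The weak
  equation holds at first on that complement only; it extends to \<open>V\<close> because \<open>u
  n\<close> is orthogonal to the earlier minimisers in the energy form too. The minima are
  unbounded, since an orthonormal sequence has no \<open>ip\<close>-Cauchy subsequence.
\<close>

theorem eigensequence:
  obtains u and lam :: "nat \<Rightarrow> real"
  where "\<And>n. u n \<in> V"
    and "\<And>m n. ip (u m) (u n) = (if m = n then 1 else 0)"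
    and "\<And>n y. y \<in> V \<Longrightarrow> a (u n) y = of_real (lam n) * ip (u n) y"
    and "\<And>n y. y \<in> V \<Longrightarrow> (\<And>i. i < n \<Longrightarrow> ip (u i) y = 0) \<Longrightarrow> lam n * Re (ip y y) \<le> Re (a y y)"
    and "\<And>K. \<exists>n. K < lam n"
proof -
  define P where "P = (\<lambda>(f :: nat \<Rightarrow> 'a) n x. x \<in> V \<and> ip x x = 1 \<and> (\<forall>i<n. ip (f i) x = 0) \<and>
    (\<forall>y\<in>V. (\<forall>i<n. ip (f i) y = 0) \<longrightarrow> Re (a x x) * Re (ip y y) \<le> Re (a y y)))"
  have "\<exists>u. \<forall>n. P u n (u n)"
  proof (rule dependent_wellorder_choice)
    show "P f n x = P g n x" if "\<And>i. i < n \<Longrightarrow> f i = g i" for x f g n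
      using that by (simp add: P_def cong: conj_cong)
  next
    fix n f assume f: "\<And>i. i < n \<Longrightarrow> P f i (f i)"
    then have fV: "f i \<in> V" if "i < n" for i using that by (simp add: P_def)
    define U where "U = {x \<in> V. \<forall>i<n. ip (f i) x = 0}"
    have U: "subspace U" "U \<subseteq> V"
      using hermitian_add_right[OF ip_hermitian fV] hermitian_scale_right[OF ip_hermitian fV]
        hermitian_zero_right[OF ip_hermitian fV] V_closed fV
      unfolding U_def by (auto intro!: subspaceI)
    obtain w where w: "\<And>j. j \<le> n \<Longrightarrow> w j \<in> V"
      "\<And>c. \<exists>j\<le>n. c j \<noteq> 0 \<Longrightarrow> 0 < Re (ip (lincomb n c w) (lincomb n c w))"
      using infinite_dimensional[of n] by blast
    obtain c where c: "\<exists>j\<le>n. c j \<noteq> 0" "\<forall>i<n. (\<Sum>j\<le>n. ip (f i) (w j) * c j) = 0"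
      using underdetermined_system[of n "\<lambda>i j. ip (f i) (w j)"] by blast
    have x0: "(lincomb n c w) \<in> U"
      unfolding U_def
    proof (intro CollectI conjI allI impI)
      fix i assume i: "i < n"
      have "ip (f i) (lincomb n c w) = (\<Sum>j\<le>n. ip (f i) (c j \<star> w j))"
        using w fV i V_closed by (intro hermitian_sum_right[OF ip_hermitian]) auto
      also have "\<dots> = (\<Sum>j\<le>n. ip (f i) (w j) * c j)"
        using w fV i by (intro sum.cong) (auto simp: hermitian_scale_right[OF ip_hermitian])
      finally show "ip (f i) (lincomb n c w) = 0" using c i by simp
    qed (auto intro!: V_closed w)
    have "\<exists>u\<in>U. ip u u = 1 \<and> (\<forall>y\<in>U. Re (a u u) * Re (ip y y) \<le> Re (a y y))"
    proof (rule minimizer_exists[OF U _ x0 w(2)[OF c(1)]])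
      fix X x assume X: "\<And>n. X n \<in> U" "x \<in> V" "(\<lambda>n. Re (ip (X n - x) (X n - x))) \<longlonglongrightarrow> 0"
      have "ip (f i) x = 0" if "i < n" for i
      proof -
        have "(\<lambda>k. ip (f i) (X k)) \<longlonglongrightarrow> ip (f i) x"
          using X U(2) by (intro psd_tendsto_right[OF ip_psd fV[OF that]]) auto
        moreover have "ip (f i) (X k) = 0" for k using X(1)[of k] that by (auto simp: U_def)
        ultimately show ?thesis by (simp add: LIMSEQ_const_iff)
      qed
      then show "x \<in> U" using X(2) by (simp add: U_def)
    qed
    then show "\<exists>x. P f n x" by (auto simp: P_def U_def)
  qed
  then obtain u where u: "\<And>n. P u n (u n)" by blast
  have uV: "u n \<in> V" for n using u[of n] by (simp add: P_def)
  have orth: "ip (u m) (u n) = (if m = n then 1 else 0)" for m n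
  proof (cases m n rule: linorder_cases)
    case less
    then show ?thesis using u[of n] by (simp add: P_def)
  next
    case equal
    then show ?thesis using u[of n] by (simp add: P_def)
  next
    case greater
    then have "ip (u n) (u m) = 0" using u[of m] by (simp add: P_def)
    then show ?thesis using greater hermitian_swap[OF ip_hermitian uV[of n] uV[of m]] by simp
  qed
  define lam where "lam n = Re (a (u n) (u n))" for n
  have min: "lam n * Re (ip y y) \<le> Re (a y y)" if "y \<in> V" "\<And>i. i < n \<Longrightarrow> ip (u i) y = 0" for n y
    using u[of n] that by (simp add: P_def lam_def)
  have weak: "a (u n) y = of_real (lam n) * ip (u n) y" if "y \<in> V" for n y
    using that
  proof (induction n arbitrary: y rule: less_induct)
    case (less n)
    define U where "U = {x \<in> V. \<forall>i<n. ip (u i) x = 0}"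
    have U: "subspace U" "U \<subseteq> V"
      using hermitian_add_right[OF ip_hermitian uV] hermitian_scale_right[OF ip_hermitian uV]
        hermitian_zero_right[OF ip_hermitian uV] V_closed
      unfolding U_def by (auto intro!: subspaceI)
    \<comment> \<open>Project \<open>y\<close> onto the orthogonal complement of the earlier eigenvectors.\<close>
    define z where "z = (\<Sum>i<n. ip (u i) y \<star> u i)"
    have zV: "z \<in> V" "y - z \<in> V" unfolding z_def by (auto intro!: V_closed uV less.prems)
    have uz: "p (u m) z = (\<Sum>i<n. ip (u i) y * p (u m) (u i))" if "hermitian_on V p" for p m
      unfolding z_def using hermitian_scale_right[OF that uV uV]
      by (subst hermitian_sum_right[OF that uV]) (auto intro!: V_closed uV)
    have "ip (u m) z = ip (u m) y" if "m < n" for m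
      using that by (simp add: uz[OF ip_hermitian] orth if_distrib sum.delta' cong: if_cong)
    then have "y - z \<in> U" using zV less.prems uV
      by (auto simp: U_def hermitian_diff_right[OF ip_hermitian])
    then have eq: "a (u n) (y - z) = of_real (lam n) * ip (u n) (y - z)"
      unfolding lam_def using u[of n] by (intro minimizer_weak_equation[OF U]) (auto simp: U_def P_def)
    have "ip (u n) z = 0" by (simp add: uz[OF ip_hermitian] orth)
    moreover have "a (u n) (u i) = 0" if "i < n" for i
    proof -
      have "a (u i) (u n) = 0" using less.IH[OF that uV[of n]] orth[of i n] that by simp
      then show ?thesis using hermitian_swap[OF a_hermitian uV[of i] uV[of n]] by simp
    qed
    then have "a (u n) z = 0" by (simp add: uz[OF a_hermitian])
    ultimately show ?case
      using eq zV less.prems uV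
      by (simp add: hermitian_diff_right[OF ip_hermitian] hermitian_diff_right[OF a_hermitian])
  qed
  have "\<exists>n. K < lam n" for K
  proof (rule ccontr)
    assume "\<not> ?thesis"
    then have "\<exists>r. strict_mono (r :: nat \<Rightarrow> nat) \<and> cauchy_for ip (u \<circ> r)"
      using uV orth by (intro compact_embedding[where K = "max 1 K"]) (auto simp: lam_def not_less max_def intro: order_trans)
    then obtain r where r: "strict_mono (r :: nat \<Rightarrow> nat)" "cauchy_for ip (u \<circ> r)" by blast
    then obtain N where "\<forall>m\<ge>N. \<forall>n\<ge>N. Re (ip (u (r m) - u (r n)) (u (r m) - u (r n))) < 1"
      unfolding cauchy_for_def o_def by (meson zero_less_one)
    then have "Re (ip (u (r N) - u (r (Suc N))) (u (r N) - u (r (Suc N)))) < 1" by simp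
    moreover have "r N \<noteq> r (Suc N)" using r(1) by (metis lessI less_irrefl strict_mono_less)
    ultimately show False
      using hermitian_square_add[OF ip_hermitian uV uV, of "r N" "-1" "r (Suc N)"] orth by simp
  qed
  then show ?thesis using that uV orth weak min by metis
qed

text \<open>
  Courant's argument: a trial space of dimension \<open>n + 1\<close> contains a vector orthogonal
  to \<open>n\<close> given ones.
\<close>

lemma trial_space_bound:
  assumes uV: "\<And>i. i < n \<Longrightarrow> u i \<in> V"
    and min: "\<And>y. y \<in> V \<Longrightarrow> (\<And>i. i < n \<Longrightarrow> ip (u i) y = 0) \<Longrightarrow> l * Re (ip y y) \<le> Re (a y y)"
    and w: "\<And>j. j \<le> (n :: nat) \<Longrightarrow> w j \<in> V"
    and pos: "\<And>c. \<exists>j\<le>n. c j \<noteq> 0 \<Longrightarrow> 0 < Re (ip (lincomb n c w) (lincomb n c w))"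
    and le: "\<And>c. Re (a (lincomb n c w) (lincomb n c w))
                \<le> t * Re (ip (lincomb n c w) (lincomb n c w))"
  shows "l \<le> t"
proof -
  obtain c where c: "\<exists>j\<le>n. c j \<noteq> 0" "\<forall>i<n. (\<Sum>j\<le>n. ip (u i) (w j) * c j) = 0"
    using underdetermined_system[of n "\<lambda>i j. ip (u i) (w j)"] by blast
  let ?y = "lincomb n c w"
  have "ip (u i) ?y = 0" if "i < n" for i
  proof -
    have "ip (u i) ?y = (\<Sum>j\<le>n. ip (u i) (c j \<star> w j))"
      using w uV that V_closed by (intro hermitian_sum_right[OF ip_hermitian]) auto
    also have "\<dots> = (\<Sum>j\<le>n. ip (u i) (w j) * c j)"
      using w uV that by (intro sum.cong) (auto simp: hermitian_scale_right[OF ip_hermitian])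
    finally show ?thesis using c that by simp
  qed
  moreover have "?y \<in> V" by (auto intro!: V_closed w)
  ultimately have "l * Re (ip ?y ?y) \<le> t * Re (ip ?y ?y)" using min le[of c] by (meson order_trans)
  then show ?thesis using pos[OF c(1)] by simp
qed

end

section \<open>Square integrable functions and weak derivatives on an interval\<close>

definition fscale :: "complex \<Rightarrow> (real \<Rightarrow> complex) \<Rightarrow> real \<Rightarrow> complex" where
  "fscale c f = (\<lambda>x. c * f x)"

interpretation funs: complex_space fscale
  by unfold_locales (auto simp: fscale_def fun_eq_iff algebra_simps)

definition l2_inner :: "real \<Rightarrow> (real \<Rightarrow> complex) \<Rightarrow> (real \<Rightarrow> complex) \<Rightarrow> complex" where
  "l2_inner l f g = (LINT x|lebesgue_on {0..l}. cnj (f x) * g x)"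

definition l2_sq :: "real \<Rightarrow> (real \<Rightarrow> complex) \<Rightarrow> real" where
  "l2_sq l f = (LINT x|lebesgue_on {0..l}. (cmod (f x))\<^sup>2)"

lemma L2_measurable: "L2 l f \<Longrightarrow> f \<in> borel_measurable (lebesgue_on {0..l})"
  by (simp add: L2_def)

lemma L2_cnj_mult_integrable:
  assumes "L2 l f" "L2 l g"
  shows "integrable (lebesgue_on {0..l}) (\<lambda>x. cnj (f x) * g x)"
proof (rule Bochner_Integration.integrable_bound)
  show "integrable (lebesgue_on {0..l}) (\<lambda>x. (cmod (f x))\<^sup>2 + (cmod (g x))\<^sup>2)"
    using assms by (simp add: L2_def)
  show "(\<lambda>x. cnj (f x) * g x) \<in> borel_measurable (lebesgue_on {0..l})"
    using L2_measurable[OF assms(1)] L2_measurable[OF assms(2)]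
    by (intro borel_measurable_times measurable_compose[OF _ borel_measurable_continuous_onI[of cnj]])
      (auto intro: continuous_intros)
  have "norm (cnj (f x) * g x) \<le> norm ((cmod (f x))\<^sup>2 + (cmod (g x))\<^sup>2)" for x
  proof -
    have "2 * (cmod (f x) * cmod (g x)) \<le> (cmod (f x))\<^sup>2 + (cmod (g x))\<^sup>2"
      using sum_squares_bound[of "cmod (f x)" "cmod (g x)"] by simp
    moreover have "0 \<le> cmod (f x) * cmod (g x)" by simp
    ultimately have "cmod (f x) * cmod (g x) \<le> (cmod (f x))\<^sup>2 + (cmod (g x))\<^sup>2" by linarith
    then show ?thesis by (simp add: norm_mult)
  qed
  then show "AE x in lebesgue_on {0..l}. norm (cnj (f x) * g x) \<le> norm ((cmod (f x))\<^sup>2 + (cmod (g x))\<^sup>2)"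
    by (intro AE_I2)
qed

lemma L2_cnj: "L2 l f \<Longrightarrow> L2 l (\<lambda>x. cnj (f x))"
  unfolding L2_def
  by (auto intro: measurable_compose[OF _ borel_measurable_continuous_onI[of cnj]] continuous_intros)

lemma L2_mult_integrable:
  "L2 l f \<Longrightarrow> L2 l g \<Longrightarrow> integrable (lebesgue_on {0..l}) (\<lambda>x. f x * g x)"
  using L2_cnj_mult_integrable[OF L2_cnj] by simp

lemma L2_add:
  assumes "L2 l f" "L2 l g" shows "L2 l (\<lambda>x. f x + g x)"
  unfolding L2_def
proof
  show m: "(\<lambda>x. f x + g x) \<in> borel_measurable (lebesgue_on {0..l})"
    using assms by (auto simp: L2_def)
  show "integrable (lebesgue_on {0..l}) (\<lambda>x. (cmod (f x + g x))\<^sup>2)"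
  proof (rule Bochner_Integration.integrable_bound)
    show "integrable (lebesgue_on {0..l}) (\<lambda>x. 2 * (cmod (f x))\<^sup>2 + 2 * (cmod (g x))\<^sup>2)"
      using assms by (simp add: L2_def)
    show "(\<lambda>x. (cmod (f x + g x))\<^sup>2) \<in> borel_measurable (lebesgue_on {0..l})"
      using m by measurable
    have "norm ((cmod (f x + g x))\<^sup>2) \<le> norm (2 * (cmod (f x))\<^sup>2 + 2 * (cmod (g x))\<^sup>2)" for x
    proof -
      have "(cmod (f x + g x))\<^sup>2 \<le> (cmod (f x) + cmod (g x))\<^sup>2"
        by (intro power_mono norm_triangle_ineq) auto
      also have "\<dots> \<le> 2 * (cmod (f x))\<^sup>2 + 2 * (cmod (g x))\<^sup>2"
        using sum_squares_bound[of "cmod (f x)" "cmod (g x)"] by (simp add: power2_sum)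
      finally show ?thesis by simp
    qed
    then show "AE x in lebesgue_on {0..l}. norm ((cmod (f x + g x))\<^sup>2)
        \<le> norm (2 * (cmod (f x))\<^sup>2 + 2 * (cmod (g x))\<^sup>2)"
      by (intro AE_I2)
  qed
qed

lemma L2_bounded_mult:
  assumes b: "b \<in> borel_measurable (lebesgue_on {0..l})" and f: "L2 l f"
    and K: "AE x in lebesgue_on {0..l}. cmod (b x) \<le> K"
  shows "L2 l (\<lambda>x. b x * f x)"
  unfolding L2_def
proof
  show m: "(\<lambda>x. b x * f x) \<in> borel_measurable (lebesgue_on {0..l})"
    using b f by (auto simp: L2_def)
  show "integrable (lebesgue_on {0..l}) (\<lambda>x. (cmod (b x * f x))\<^sup>2)"
  proof (rule Bochner_Integration.integrable_bound)
    show "integrable (lebesgue_on {0..l}) (\<lambda>x. K\<^sup>2 * (cmod (f x))\<^sup>2)"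
      using f by (simp add: L2_def)
    show "(\<lambda>x. (cmod (b x * f x))\<^sup>2) \<in> borel_measurable (lebesgue_on {0..l})"
      using m by measurable
    show "AE x in lebesgue_on {0..l}. norm ((cmod (b x * f x))\<^sup>2) \<le> norm (K\<^sup>2 * (cmod (f x))\<^sup>2)"
      using K by (rule AE_mp) (auto intro!: AE_I2 mult_mono power_mono simp: norm_mult power_mult_distrib)
  qed
qed

lemma L2_scale: "L2 l f \<Longrightarrow> L2 l (\<lambda>x. c * f x)"
  by (rule L2_bounded_mult[where K = "cmod c"]) auto

lemma L2_diff: "L2 l f \<Longrightarrow> L2 l g \<Longrightarrow> L2 l (\<lambda>x. f x - g x)"
  using L2_add[of l f "\<lambda>x. (-1) * g x"] L2_scale[of l g "-1"] by simp

lemma finite_measure_interval: "finite_measure (lebesgue_on {0..l::real})"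
  by (rule finite_measure_lebesgue_on) auto

lemma L2_const: "L2 l (\<lambda>_. c)"
proof -
  interpret finite_measure "lebesgue_on {0..l}" by (rule finite_measure_interval)
  show ?thesis by (simp add: L2_def)
qed

lemma L2_zero: "L2 l 0" "L2 l (\<lambda>_. 0)"
  using L2_const[of l 0] by (simp_all add: zero_fun_def)

lemma continuous_measurable_interval:
  "continuous_on {0..l::real} f \<Longrightarrow> f \<in> borel_measurable (lebesgue_on {0..l})"
  by (rule continuous_imp_measurable_on_sets_lebesgue) auto

lemma L2_continuous:
  assumes "continuous_on {0..l} f" shows "L2 l f"
proof -
  have "bounded (f ` {0..l})" using assms compact_continuous_image compact_imp_bounded by blast
  then obtain K where "\<And>x. x \<in> {0..l} \<Longrightarrow> cmod (f x) \<le> K" by (meson bounded_iff imageI)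
  then have "L2 l (\<lambda>x. f x * 1)"
    using continuous_measurable_interval[OF assms] L2_const
    by (intro L2_bounded_mult[where K = K]) (auto intro!: AE_I2)
  then show ?thesis by simp
qed

lemma L2_integrable: "L2 l f \<Longrightarrow> integrable (lebesgue_on {0..l}) f"
  using L2_mult_integrable[OF L2_const[of l 1]] by simp

lemma L2_indicator_mult:
  assumes "S \<in> sets lebesgue" "L2 l f" shows "L2 l (\<lambda>x. indicator S x * f x)"
proof (rule L2_bounded_mult[OF _ assms(2), where K = 1])
  show "(indicator S :: real \<Rightarrow> complex) \<in> borel_measurable (lebesgue_on {0..l})"
    using assms(1) by (intro measurable_restrict_space1) auto
qed (auto intro!: AE_I2 simp: indicator_def)

lemma l2_inner_self: "l2_inner l f f = of_real (l2_sq l f)"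
proof -
  have "cnj z * z = of_real ((cmod z)\<^sup>2)" for z
    using complex_norm_square[of z] by (simp add: mult.commute)
  then have "l2_inner l f f = (LINT x|lebesgue_on {0..l}. complex_of_real ((cmod (f x))\<^sup>2))"
    unfolding l2_inner_def by (intro Bochner_Integration.integral_cong) auto
  then show ?thesis by (simp only: l2_sq_def integral_complex_of_real)
qed

text \<open>
  This makes the Cauchy-Schwarz inequality and the parallelogram law available in
  \<open>L\<^sup>2\<close>.
\<close>

lemma l2_psd: "funs.psd_on (Collect (L2 l)) (l2_inner l)"
  unfolding funs.psd_on_def funs.hermitian_on_def
proof (intro conjI ballI allI)
  show "funs.subspace (Collect (L2 l))"
    by (rule funs.subspaceI) (auto simp: L2_zero plus_fun_def fscale_def L2_add L2_scale)
next
  fix x y z assume "x \<in> Collect (L2 l)" "y \<in> Collect (L2 l)" "z \<in> Collect (L2 l)"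
  then show "l2_inner l x (y + z) = l2_inner l x y + l2_inner l x z"
    using L2_cnj_mult_integrable[of l x y] L2_cnj_mult_integrable[of l x z]
    by (simp add: l2_inner_def plus_fun_def distrib_left)
next
  fix x y c assume "x \<in> Collect (L2 l)" "y \<in> Collect (L2 l)"
  show "l2_inner l x (fscale c y) = c * l2_inner l x y"
    unfolding l2_inner_def fscale_def integral_mult_right_zero[symmetric] by (simp add: mult.left_commute)
next
  fix x y assume xy: "x \<in> Collect (L2 l)" "y \<in> Collect (L2 l)"
  show "l2_inner l y x = cnj (l2_inner l x y)"
  proof -
    have "cnj (l2_inner l x y) = (LINT t|lebesgue_on {0..l}. cnj (cnj (x t) * y t))"
      unfolding l2_inner_def using xy
      by (intro integral_bounded_linear[OF bounded_linear_cnj, symmetric] L2_cnj_mult_integrable) auto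
    then show ?thesis by (simp add: l2_inner_def mult.commute)
  qed
next
  fix x show "0 \<le> Re (l2_inner l x x)"
    by (simp add: l2_inner_self l2_sq_def)
qed

lemmas l2_hermitian = funs.psd_hermitian[OF l2_psd]

lemma l2_Cauchy_Schwarz:
  "L2 l f \<Longrightarrow> L2 l g \<Longrightarrow> (cmod (l2_inner l f g))\<^sup>2 \<le> l2_sq l f * l2_sq l g"
  using funs.Cauchy_Schwarz_psd[OF l2_psd, of f l g] by (simp add: l2_inner_self)

lemma l2_sq_nonneg: "0 \<le> l2_sq l f" by (simp add: l2_sq_def)

lemma l2_sq_const: "0 \<le> l \<Longrightarrow> l2_sq l (\<lambda>_. c) = l * (cmod c)\<^sup>2"
  by (simp add: l2_sq_def measure_restrict_space)

lemma l2_sq_le_bound: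
  assumes "0 \<le> l" "L2 l f" "\<And>x. x \<in> {0..l} \<Longrightarrow> cmod (f x) \<le> K"
  shows "l2_sq l f \<le> l * K\<^sup>2"
proof -
  have "l2_sq l f \<le> l2_sq l (\<lambda>_. complex_of_real K)"
    unfolding l2_sq_def
  proof (rule integral_mono)
    fix x assume "x \<in> space (lebesgue_on {0..l})"
    then have "cmod (f x) \<le> K" using assms(3) by simp
    then show "(cmod (f x))\<^sup>2 \<le> (cmod (complex_of_real K))\<^sup>2"
      by (intro power_mono) auto
  qed (use assms(2) L2_const in \<open>auto simp: L2_def\<close>)
  then show ?thesis using assms(1) by (simp add: l2_sq_const)
qed

lemma has_L2_derivI:
  "L2 l g \<Longrightarrow> (\<And>x. x \<in> {0..l} \<Longrightarrow> f x = f 0 + (LINT t|lebesgue_on {0..x}. g t)) \<Longrightarrow> has_L2_deriv l f g"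
  unfolding has_L2_deriv_def by blast

lemma has_L2_deriv_value:
  "has_L2_deriv l f g \<Longrightarrow> x \<in> {0..l} \<Longrightarrow> f x = f 0 + (LINT t|lebesgue_on {0..x}. g t)"
  unfolding has_L2_deriv_def by blast

lemma has_L2_deriv_L2: "has_L2_deriv l f g \<Longrightarrow> L2 l g" by (simp add: has_L2_deriv_def)

lemma lebesgue_on_initial:
  fixes g :: "real \<Rightarrow> complex"
  assumes "x \<in> {0..l}"
  shows "(LINT t|lebesgue_on {0..x}. g t) = (LINT t|lebesgue_on {0..l}. indicator {0..x} t * g t)"
proof -
  have "lebesgue_on {0..x} = restrict_space (lebesgue_on {0..l}) {0..x}"
    using assms by (subst restrict_restrict_space) (auto simp: Int_absorb1)
  moreover have "{0..x} \<inter> space (lebesgue_on {0..l}) \<in> sets (lebesgue_on {0..l})"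
    using assms by (auto simp: sets_restrict_space)
  ultimately show ?thesis
    by (simp add: integral_restrict_space indicator_scaleR_eq_if)
      (auto intro!: Bochner_Integration.integral_cong simp: indicator_def)
qed

lemma has_L2_deriv_increment:
  assumes "has_L2_deriv l f g" "0 \<le> x" "x \<le> y" "y \<le> l"
  shows "f y - f x = l2_inner l (indicator {x<..y}) g"
proof -
  have int: "integrable (lebesgue_on {0..l}) (\<lambda>t. indicator {0..z} t * g t)" for z
    using L2_indicator_mult[of "{0..z}" l g] has_L2_deriv_L2[OF assms(1)] by (auto intro: L2_integrable)
  have val: "f z = f 0 + (LINT t|lebesgue_on {0..l}. indicator {0..z} t * g t)" if "z \<in> {0..l}" for z
    using has_L2_deriv_value[OF assms(1) that] lebesgue_on_initial[OF that, of g] by (simp only:)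
  have "f y - f x = (LINT t|lebesgue_on {0..l}. indicator {0..y} t * g t) -
      (LINT t|lebesgue_on {0..l}. indicator {0..x} t * g t)"
    using val[of x] val[of y] assms(2-4) by simp
  also have "\<dots> = (LINT t|lebesgue_on {0..l}. indicator {0..y} t * g t - indicator {0..x} t * g t)"
    using int by simp
  also have "\<dots> = l2_inner l (indicator {x<..y}) g"
    unfolding l2_inner_def using assms
    by (intro Bochner_Integration.integral_cong) (auto simp: indicator_def)
  finally show ?thesis .
qed

lemma L2_indicator: "S \<in> sets lebesgue \<Longrightarrow> L2 l (indicator S)"
  using L2_indicator_mult[OF _ L2_const[of l 1], of S] by simp

lemma l2_sq_indicator:
  assumes "0 \<le> x" "x \<le> y" "y \<le> l"
  shows "l2_sq l (indicator {x<..y}) = y - x"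
proof -
  have "(cmod (indicator S t))\<^sup>2 = indicator S t" for S and t :: real
    by (simp add: indicator_def)
  then have "l2_sq l (indicator {x<..y}) = measure (lebesgue_on {0..l}) ({x<..y} \<inter> {0..l})"
    by (simp add: l2_sq_def)
  also have "{x<..y} \<inter> {0..l} = {x<..y}" using assms by auto
  also have "measure (lebesgue_on {0..l}) {x<..y} = measure lebesgue {x<..y}"
    using assms by (intro measure_restrict_space) auto
  finally show ?thesis using assms by simp
qed

text \<open>
  The Cauchy-Schwarz inequality for the derivative and the indicator of the interval between the
  two points.
\<close>

lemma has_L2_deriv_Hoelder:
  assumes f: "has_L2_deriv l f g" and "x \<in> {0..l}" "y \<in> {0..l}"
  shows "(cmod (f x - f y))\<^sup>2 \<le> \<bar>x - y\<bar> * l2_sq l g"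
proof -
  have *: "(cmod (f y - f x))\<^sup>2 \<le> (y - x) * l2_sq l g" if "0 \<le> x" "x \<le> y" "y \<le> l" for x y
    using l2_Cauchy_Schwarz[OF L2_indicator has_L2_deriv_L2[OF f], of "{x<..y}"] that
    by (simp add: has_L2_deriv_increment[OF f] l2_sq_indicator)
  show ?thesis
    using *[of x y] *[of y x] assms(2,3) by (cases "x \<le> y") (auto simp: norm_minus_commute)
qed

lemma has_L2_deriv_continuous:
  assumes "has_L2_deriv l f g" shows "continuous_on {0..l} f"
proof (rule continuous_onI)
  fix x e :: real assume x: "x \<in> {0..l}" and e: "0 < e"
  let ?d = "e\<^sup>2 / (l2_sq l g + 1)"
  have pos: "0 < l2_sq l g + 1" using l2_sq_nonneg[of l g] by simp
  have "dist (f y) (f x) \<le> e" if y: "y \<in> {0..l}" "dist y x < ?d" for y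
  proof -
    have "\<bar>y - x\<bar> * l2_sq l g \<le> ?d * (l2_sq l g + 1)"
      using y(2) l2_sq_nonneg[of l g] pos by (intro mult_mono) (auto simp: dist_real_def)
    then have "(cmod (f y - f x))\<^sup>2 \<le> e\<^sup>2"
      using has_L2_deriv_Hoelder[OF assms y(1) x] pos by simp
    then have "cmod (f y - f x) \<le> e" using e by (rule power2_le_imp_le[OF _ less_imp_le])
    then show ?thesis by (simp add: dist_norm)
  qed
  then show "\<exists>d>0. \<forall>y\<in>{0..l}. dist y x < d \<longrightarrow> dist (f y) (f x) \<le> e"
    using e pos by (intro exI[of _ ?d]) auto
qed

lemma has_L2_deriv_self_L2: "has_L2_deriv l f g \<Longrightarrow> L2 l f"
  by (intro L2_continuous has_L2_deriv_continuous)

text \<open>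
  Compare \<open>f x\<close> with \<open>f y\<close> by the Hoelder estimate and average over
  \<open>y\<close> in an interval of length \<open>d\<close> next to \<open>x\<close>. For small
  \<open>d\<close> the derivative enters with a small factor, which makes boundary terms a small
  perturbation of the kinetic energy.
\<close>

lemma has_L2_deriv_sup_bound:
  assumes f: "has_L2_deriv l f g" and d: "0 < d" "d \<le> l" and x: "x \<in> {0..l}"
  shows "(cmod (f x))\<^sup>2 \<le> 2 / d * l2_sq l f + 2 * d * l2_sq l g"
proof -
  obtain s where s: "0 \<le> s" "s + d \<le> l" "s \<le> x" "x \<le> s + d"
  proof (cases "x + d \<le> l")
    case True
    then show ?thesis using that[of x] x d by auto
  next
    case False
    then show ?thesis using that[of "l - d"] x d by auto
  qed
  let ?J = "{s<..s + d}" and ?G = "l2_sq l g"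
  have fL2: "L2 l f" using f by (rule has_L2_deriv_self_L2)
  have intf: "integrable (lebesgue_on {0..l}) (\<lambda>y. (cmod (f y))\<^sup>2)" using fL2 by (simp add: L2_def)
  have J2: "(cmod (indicator ?J y))\<^sup>2 = indicator ?J y" for y by (simp add: indicator_def)
  have intJ: "integrable (lebesgue_on {0..l}) (indicator ?J :: real \<Rightarrow> real)"
    using L2_indicator[of ?J l] by (simp add: L2_def J2)
  have J: "(LINT y|lebesgue_on {0..l}. indicator ?J y) = d"
    using l2_sq_indicator[of s "s + d" l] s d
    by (simp add: l2_sq_def J2)
  have "d * ((cmod (f x))\<^sup>2 - 2 * d * ?G) = (LINT y|lebesgue_on {0..l}. indicator ?J y * ((cmod (f x))\<^sup>2 - 2 * d * ?G))"
    using J by simp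
  also have "\<dots> \<le> (LINT y|lebesgue_on {0..l}. 2 * (cmod (f y))\<^sup>2)"
  proof (rule integral_mono)
    fix y assume y: "y \<in> space (lebesgue_on {0..l})"
    show "indicator ?J y * ((cmod (f x))\<^sup>2 - 2 * d * ?G) \<le> 2 * (cmod (f y))\<^sup>2"
    proof (cases "y \<in> ?J")
      case True
      have "(cmod (f x))\<^sup>2 \<le> (cmod (f y) + cmod (f x - f y))\<^sup>2"
        using norm_triangle_ineq[of "f y" "f x - f y"] by (intro power_mono) auto
      also have "\<dots> \<le> 2 * (cmod (f y))\<^sup>2 + 2 * (cmod (f x - f y))\<^sup>2"
        using sum_squares_bound[of "cmod (f y)" "cmod (f x - f y)"] by (simp add: power2_sum)
      also have "(cmod (f x - f y))\<^sup>2 \<le> \<bar>x - y\<bar> * ?G" using has_L2_deriv_Hoelder[OF f x] y by simp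
      also have "\<dots> \<le> d * ?G" using True s l2_sq_nonneg[of l g] by (intro mult_right_mono) auto
      finally show ?thesis using True by simp
    qed simp
  qed (use intf intJ in auto)
  also have "\<dots> = 2 * l2_sq l f" by (simp add: l2_sq_def)
  finally show ?thesis using d by (simp add: field_simps)
qed

lemma has_L2_deriv_add:
  assumes "has_L2_deriv l f g" "has_L2_deriv l f' g'"
  shows "has_L2_deriv l (\<lambda>x. f x + f' x) (\<lambda>x. g x + g' x)"
proof (rule has_L2_derivI)
  fix x assume x: "x \<in> {0..l}"
  have "integrable (lebesgue_on {0..l}) (\<lambda>t. indicator {0..x} t * g t)"
    "integrable (lebesgue_on {0..l}) (\<lambda>t. indicator {0..x} t * g' t)"
    using has_L2_deriv_L2[OF assms(1)] has_L2_deriv_L2[OF assms(2)]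
    by (auto intro!: L2_integrable L2_indicator_mult)
  then have "(LINT t|lebesgue_on {0..x}. g t + g' t) = (LINT t|lebesgue_on {0..x}. g t) + (LINT t|lebesgue_on {0..x}. g' t)"
    by (simp add: lebesgue_on_initial[OF x] distrib_left)
  moreover note has_L2_deriv_value[OF assms(1) x] has_L2_deriv_value[OF assms(2) x]
  ultimately show "f x + f' x = f 0 + f' 0 + (LINT t|lebesgue_on {0..x}. g t + g' t)" by (simp only: ac_simps)
qed (intro L2_add has_L2_deriv_L2[OF assms(1)] has_L2_deriv_L2[OF assms(2)])

lemma has_L2_deriv_scale:
  "has_L2_deriv l f g \<Longrightarrow> has_L2_deriv l (\<lambda>x. c * f x) (\<lambda>x. c * g x)"
proof -
  assume f: "has_L2_deriv l f g"
  have "c * f x = c * f 0 + (LINT t|lebesgue_on {0..x}. c * g t)" if "x \<in> {0..l}" for x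
  proof -
    from has_L2_deriv_value[OF f that]
    have "c * f x = c * f 0 + c * (LINT t|lebesgue_on {0..x}. g t)" by (simp only: distrib_left)
    then show ?thesis by simp
  qed
  then show ?thesis by (rule has_L2_derivI[OF L2_scale[OF has_L2_deriv_L2[OF f]]])
qed

lemma has_L2_deriv_diff:
  "has_L2_deriv l f g \<Longrightarrow> has_L2_deriv l f' g' \<Longrightarrow> has_L2_deriv l (\<lambda>x. f x - f' x) (\<lambda>x. g x - g' x)"
  using has_L2_deriv_add[of l f g "\<lambda>x. (-1) * f' x" "\<lambda>x. (-1) * g' x"] has_L2_deriv_scale[of l f' g' "-1"]
  by simp

lemma has_L2_deriv_zero: "has_L2_deriv l (\<lambda>_. 0) (\<lambda>_. 0)"
  by (simp add: has_L2_deriv_def L2_zero)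

lemma has_L2_deriv_cong:
  assumes "has_L2_deriv l f g" "\<And>x. x \<in> {0..l} \<Longrightarrow> f' x = f x" "\<And>x. x \<in> {0..l} \<Longrightarrow> g' x = g x"
  shows "has_L2_deriv l f' g'"
proof -
  have "L2 l g'"
  proof -
    have "g' \<in> borel_measurable (lebesgue_on {0..l}) \<longleftrightarrow> g \<in> borel_measurable (lebesgue_on {0..l})"
      by (rule measurable_cong) (simp add: assms(3))
    moreover have "integrable (lebesgue_on {0..l}) (\<lambda>x. (cmod (g' x))\<^sup>2) \<longleftrightarrow>
        integrable (lebesgue_on {0..l}) (\<lambda>x. (cmod (g x))\<^sup>2)"
      by (rule Bochner_Integration.integrable_cong) (simp_all add: assms(3))
    ultimately show ?thesis using assms(1) by (simp add: has_L2_deriv_def L2_def)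
  qed
  moreover have "f' x = f' 0 + (LINT t|lebesgue_on {0..x}. g' t)" if x: "x \<in> {0..l}" for x
  proof -
    have "(LINT t|lebesgue_on {0..x}. g' t) = (LINT t|lebesgue_on {0..x}. g t)"
      using x assms(3) by (intro Bochner_Integration.integral_cong) auto
    moreover note has_L2_deriv_value[OF assms(1) x]
    moreover have "f' 0 = f 0" using x by (intro assms(2)) auto
    ultimately show ?thesis using assms(2)[OF x] by (simp only:)
  qed
  ultimately show ?thesis by (rule has_L2_derivI)
qed

section \<open>Completeness and integration by parts\<close>

lemma L1_le_L2:
  assumes "0 \<le> l" "L2 l g"
  shows "(LINT x|lebesgue_on {0..l}. cmod (g x)) \<le> sqrt (l * l2_sq l g)"
proof (rule real_le_rsqrt)
  let ?h = "\<lambda>x. complex_of_real (cmod (g x))"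
  have m: "?h \<in> borel_measurable (lebesgue_on {0..l})"
    using L2_measurable[OF assms(2)] by measurable
  have h: "L2 l ?h" using assms(2) m by (simp add: L2_def)
  have "l2_inner l (\<lambda>_. 1) ?h = of_real (LINT x|lebesgue_on {0..l}. cmod (g x))"
    by (simp add: l2_inner_def)
  moreover have "l2_sq l ?h = l2_sq l g" by (simp add: l2_sq_def)
  ultimately show "(LINT x|lebesgue_on {0..l}. cmod (g x))\<^sup>2 \<le> l * l2_sq l g"
    using l2_Cauchy_Schwarz[OF L2_const h, of 1] assms(1) by (simp add: l2_sq_const)
qed

text \<open>
  Riesz-Fischer. On a bounded interval an \<open>L\<^sup>2\<close>-Cauchy sequence is Cauchy in
  \<open>L\<^sup>1\<close>, so a subsequence converges almost everywhere; Fatou's lemma identifies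
  its pointwise limit as the \<open>L\<^sup>2\<close> limit.
\<close>

theorem L2_complete:
  assumes l: "0 \<le> l" and g: "\<And>n. L2 l (g n)"
    and cauchy: "\<And>e. 0 < e \<Longrightarrow> \<exists>N. \<forall>m\<ge>N. \<forall>n\<ge>N. l2_sq l (\<lambda>x. g m x - g n x) < e"
  obtains h where "L2 l h" "(\<lambda>n. l2_sq l (\<lambda>x. g n x - h x)) \<longlonglongrightarrow> 0"
proof -
  let ?M = "lebesgue_on {0..l}"
  have mg: "g n \<in> borel_measurable ?M" for n using g by (rule L2_measurable)
  have diff: "L2 l (\<lambda>x. g m x - g n x)" for m n using g g by (rule L2_diff)
  have cauchy1: "\<exists>N. \<forall>i\<ge>N. \<forall>j\<ge>N. (LINT x|?M. norm (g i x - g j x)) < e" if e: "0 < e" for e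
  proof -
    obtain N where N: "\<forall>m\<ge>N. \<forall>n\<ge>N. l2_sq l (\<lambda>x. g m x - g n x) < e\<^sup>2 / (l + 1)"
      using cauchy[of "e\<^sup>2 / (l + 1)"] e l by auto
    have "(LINT x|?M. norm (g i x - g j x)) < e" if "i \<ge> N" "j \<ge> N" for i j
    proof -
      have "l * l2_sq l (\<lambda>x. g i x - g j x) \<le> l * (e\<^sup>2 / (l + 1))"
        using N that l by (intro mult_left_mono) (auto intro: less_imp_le)
      also have "\<dots> < e\<^sup>2" using l e by (simp add: field_simps)
      finally have "sqrt (l * l2_sq l (\<lambda>x. g i x - g j x)) < sqrt (e\<^sup>2)" by (rule real_sqrt_less_mono)
      then show ?thesis using L1_le_L2[OF l diff[of i j]] e by simp
    qed
    then show ?thesis by blast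
  qed
  obtain r where r: "strict_mono r" "AE x in ?M. Cauchy (\<lambda>i. g (r i) x)"
    using cauchy_L1_AE_cauchy_subseq[of ?M g, OF L2_integrable[OF g] cauchy1] by blast
  define h where "h x = lim (\<lambda>i. g (r i) x)" for x
  have mh: "h \<in> borel_measurable ?M"
    unfolding h_def by (rule borel_measurable_lim_metric) (rule mg)
  have conv: "AE x in ?M. (\<lambda>i. g (r i) x) \<longlonglongrightarrow> h x"
    using r(2) by (rule AE_mp) (auto intro!: AE_I2 simp: h_def Cauchy_convergent_iff convergent_LIMSEQ_iff)
  \<comment> \<open>Fatou's lemma along the almost everywhere convergent subsequence.\<close>
  have fatou: "(\<integral>\<^sup>+ x. ennreal ((cmod (g n x - h x))\<^sup>2) \<partial>?M) \<le> ennreal e"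
    if n: "\<And>i. N \<le> i \<Longrightarrow> l2_sq l (\<lambda>x. g n x - g i x) \<le> e" for n N e
  proof -
    have "AE x in ?M. ennreal ((cmod (g n x - h x))\<^sup>2) = liminf (\<lambda>i. ennreal ((cmod (g n x - g (r i) x))\<^sup>2))"
      using conv
    proof (rule AE_mp, intro AE_I2 impI)
      fix x assume c: "(\<lambda>i. g (r i) x) \<longlonglongrightarrow> h x"
      have "(\<lambda>i. ennreal ((cmod (g n x - g (r i) x))\<^sup>2)) \<longlonglongrightarrow> ennreal ((cmod (g n x - h x))\<^sup>2)"
        by (intro tendsto_ennrealI tendsto_power tendsto_norm tendsto_diff tendsto_const c)
      then show "ennreal ((cmod (g n x - h x))\<^sup>2) = liminf (\<lambda>i. ennreal ((cmod (g n x - g (r i) x))\<^sup>2))"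
        by (rule lim_imp_Liminf[OF sequentially_bot, symmetric])
    qed
    then have "(\<integral>\<^sup>+ x. ennreal ((cmod (g n x - h x))\<^sup>2) \<partial>?M) =
        (\<integral>\<^sup>+ x. liminf (\<lambda>i. ennreal ((cmod (g n x - g (r i) x))\<^sup>2)) \<partial>?M)"
      by (rule nn_integral_cong_AE)
    also have "\<dots> \<le> liminf (\<lambda>i. \<integral>\<^sup>+ x. ennreal ((cmod (g n x - g (r i) x))\<^sup>2) \<partial>?M)"
      using mg by (intro nn_integral_liminf) measurable
    also have "\<dots> = liminf (\<lambda>i. ennreal (l2_sq l (\<lambda>x. g n x - g (r i) x)))"
      unfolding l2_sq_def using diff[unfolded L2_def]
      by (intro arg_cong[where f = liminf] ext nn_integral_eq_integral) auto
    also have "\<dots> \<le> liminf (\<lambda>i. ennreal e)"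
    proof (rule Liminf_mono)
      have "l2_sq l (\<lambda>x. g n x - g (r i) x) \<le> e" if "N \<le> i" for i
        using n[of "r i"] seq_suble[OF r(1), of i] that by linarith
      then show "\<forall>\<^sub>F i in sequentially. ennreal (l2_sq l (\<lambda>x. g n x - g (r i) x)) \<le> ennreal e"
        unfolding eventually_sequentially by (intro exI[of _ N]) (auto intro: ennreal_leI)
    qed
    also have "\<dots> = ennreal e" by (rule lim_imp_Liminf) auto
    finally show ?thesis .
  qed
  have key: "L2 l (\<lambda>x. g n x - h x) \<and> l2_sq l (\<lambda>x. g n x - h x) \<le> e"
    if "\<And>i. N \<le> i \<Longrightarrow> l2_sq l (\<lambda>x. g n x - g i x) \<le> e" for n N e
  proof -
    have m: "(\<lambda>x. g n x - h x) \<in> borel_measurable ?M" using mg mh by measurable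
    have e: "0 \<le> e" using that[of N] l2_sq_nonneg[of l "\<lambda>x. g n x - g N x"] by simp
    have f: "(\<integral>\<^sup>+ x. ennreal ((cmod (g n x - h x))\<^sup>2) \<partial>?M) \<le> ennreal e" by (rule fatou[OF that])
    then have "(\<integral>\<^sup>+ x. ennreal ((cmod (g n x - h x))\<^sup>2) \<partial>?M) < \<infinity>"
      by (rule le_less_trans) simp
    then have "integrable ?M (\<lambda>x. (cmod (g n x - h x))\<^sup>2)"
      using m by (intro integrableI_bounded) auto
    moreover have "l2_sq l (\<lambda>x. g n x - h x) \<le> e"
      unfolding l2_sq_def using m f e
      by (intro integral_real_bounded) auto
    ultimately show ?thesis using m by (simp add: L2_def)
  qed
  have close: "\<exists>N. \<forall>n\<ge>N. L2 l (\<lambda>x. g n x - h x) \<and> l2_sq l (\<lambda>x. g n x - h x) \<le> e" if e: "0 < e" for e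
  proof -
    obtain N where "\<forall>m\<ge>N. \<forall>n\<ge>N. l2_sq l (\<lambda>x. g m x - g n x) < e" using cauchy[OF e] by blast
    then show ?thesis by (intro exI[of _ N] allI impI key[of N]) (auto intro: less_imp_le)
  qed
  obtain N where "L2 l (\<lambda>x. g N x - h x)" using close[of 1] by auto
  then have "L2 l (\<lambda>x. g N x - (g N x - h x))" by (rule L2_diff[OF g])
  then have "L2 l h" by simp
  moreover have "(\<lambda>n. l2_sq l (\<lambda>x. g n x - h x)) \<longlonglongrightarrow> 0"
  proof (rule LIMSEQ_I)
    fix e :: real assume "0 < e"
    then obtain N where "\<forall>n\<ge>N. l2_sq l (\<lambda>x. g n x - h x) \<le> e / 2" using close[of "e / 2"] by auto
    then show "\<exists>N. \<forall>n\<ge>N. norm (l2_sq l (\<lambda>x. g n x - h x) - 0) < e"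
      using \<open>0 < e\<close> l2_sq_nonneg by (intro exI[of _ N]) (force simp: abs_of_nonneg)
  qed
  ultimately show ?thesis using that by blast
qed

lemma AE_not_point: "AE x in lebesgue_on S. x \<noteq> (a::real)" if "S \<in> sets lebesgue"
proof -
  have "AE x in lebesgue. x \<noteq> a"
    using AE_lborel_singleton[of a] by (rule AE_completion)
  then show ?thesis using that by (subst AE_restrict_space_iff) auto
qed

lemma has_L2_deriv_integral:
  assumes "L2 l g"
  shows "has_L2_deriv l (\<lambda>x. c + (LINT t|lebesgue_on {0..x}. g t)) g"
proof (rule has_L2_derivI[OF assms])
  fix x assume x: "x \<in> {0..l}"
  have "(LINT t|lebesgue_on {0..0}. g t) = 0"
  proof -
    have "AE t in lebesgue_on {0..l}. indicator {0..0} t * g t = 0"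
      using AE_not_point[of "{0..l}" 0] by (rule AE_mp) (auto intro!: AE_I2 simp: indicator_def)
    then have "(LINT t|lebesgue_on {0..l}. indicator {0..0} t * g t) = 0" by (rule integral_eq_zero_AE)
    then show ?thesis using x by (subst lebesgue_on_initial[of 0 l]) auto
  qed
  then show "c + (LINT t|lebesgue_on {0..x}. g t) =
      c + (LINT t|lebesgue_on {0..0}. g t) + (LINT t|lebesgue_on {0..x}. g t)" by simp
qed

text \<open>
  The factors are differentiable only almost everywhere, so the formula is derived from Fubini's
  theorem: \<open>u' x * v' t\<close> is integrated over the triangle \<open>t \<le> x\<close> in
  both orders.
\<close>

theorem has_L2_deriv_by_parts:
  assumes l: "0 \<le> l" and u: "has_L2_deriv l u u'" and v: "has_L2_deriv l v v'"
  shows "(LINT x|lebesgue_on {0..l}. u' x * v x) + (LINT x|lebesgue_on {0..l}. u x * v' x)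
       = u l * v l - u 0 * v 0"
proof -
  let ?M = "lebesgue_on {0..l}"
  interpret M: finite_measure ?M by (rule finite_measure_interval)
  interpret P: pair_sigma_finite ?M ?M by unfold_locales
  have L2s: "L2 l u'" "L2 l v'" "L2 l u" "L2 l v"
    using u v by (auto intro: has_L2_deriv_L2 has_L2_deriv_self_L2)
  have [measurable]: "u' \<in> borel_measurable ?M" "v' \<in> borel_measurable ?M"
    using L2s by (auto intro: L2_measurable)
  have [measurable]: "(\<lambda>x. x) \<in> borel_measurable ?M"
    using id_borel_measurable_lebesgue_on[of "{0..l}"] by (simp add: id_def)
  have int_u': "integrable ?M u'" and int_v': "integrable ?M v'" using L2s by (auto intro: L2_integrable)
  define k where "k = (\<lambda>x t. if t \<le> x then u' x * v' t else 0)"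
  have "integrable (?M \<Otimes>\<^sub>M ?M) (\<lambda>p. u' (fst p) * v' (snd p))"
    using int_u' int_v'
    by (intro P.Fubini_integrable) (auto simp: norm_mult)
  then have "integrable (?M \<Otimes>\<^sub>M ?M) (case_prod k)"
    by (rule Bochner_Integration.integrable_bound) (auto simp: k_def split_def intro!: AE_I2)
  then have "(LINT t|?M. LINT x|?M. k x t) = (LINT x|?M. LINT t|?M. k x t)"
    by (rule P.Fubini_integral)
  moreover have "(LINT x|?M. LINT t|?M. k x t) = (LINT x|?M. u' x * v x - u' x * v 0)"
  proof (rule Bochner_Integration.integral_cong[OF refl])
    fix x assume "x \<in> space ?M"
    then have x: "x \<in> {0..l}" by simp
    have "(LINT t|?M. k x t) = (LINT t|?M. u' x * (indicator {0..x} t * v' t))"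
      by (intro Bochner_Integration.integral_cong) (auto simp: k_def indicator_def)
    also have "\<dots> = u' x * (LINT t|lebesgue_on {0..x}. v' t)"
      by (simp add: lebesgue_on_initial[OF x])
    also have "(LINT t|lebesgue_on {0..x}. v' t) = v x - v 0"
      using has_L2_deriv_value[OF v x] by (simp only: add_diff_cancel_left')
    finally show "(LINT t|?M. k x t) = u' x * v x - u' x * v 0" by (simp add: right_diff_distrib)
  qed
  moreover have "(LINT t|?M. LINT x|?M. k x t) = (LINT t|?M. u l * v' t - u t * v' t)"
  proof (rule Bochner_Integration.integral_cong[OF refl])
    fix t assume "t \<in> space ?M"
    then have t: "0 \<le> t" "t \<le> l" by auto
    have "(LINT x|?M. k x t) = (LINT x|?M. cnj (indicator {t<..l} x) * u' x * v' t)"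
    proof (rule integral_cong_AE)
      show "AE x in ?M. k x t = cnj (indicator {t<..l} x) * u' x * v' t"
        using AE_not_point[of "{0..l}" t] by (rule AE_mp) (auto intro!: AE_I2 simp: k_def indicator_def)
      show "(\<lambda>x. k x t) \<in> borel_measurable ?M" unfolding k_def by measurable
      have "(\<lambda>x. cnj (indicator {t<..l} x) * u' x) \<in> borel_measurable ?M"
        using L2_cnj_mult_integrable[OF L2_indicator[of "{t<..l}"] L2s(1)] by auto
      then show "(\<lambda>x. cnj (indicator {t<..l} x) * u' x * v' t) \<in> borel_measurable ?M" by measurable
    qed
    also have "\<dots> = l2_inner l (indicator {t<..l}) u' * v' t" by (simp add: l2_inner_def)
    also have "l2_inner l (indicator {t<..l}) u' = u l - u t"
      using has_L2_deriv_increment[OF u t(1), of l] t(2) by simp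
    finally show "(LINT x|?M. k x t) = u l * v' t - u t * v' t" by (simp add: left_diff_distrib)
  qed
  moreover have "(LINT x|?M. u' x * v x - u' x * v 0) = (LINT x|?M. u' x * v x) - (LINT x|?M. u' x) * v 0"
    using L2_mult_integrable[OF L2s(1,4)] int_u' by simp
  moreover have "(LINT t|?M. u l * v' t - u t * v' t) = u l * (LINT x|?M. v' x) - (LINT x|?M. u x * v' x)"
    using L2_mult_integrable[OF L2s(3,2)] int_v' by simp
  moreover have "(LINT x|?M. u' x) = u l - u 0" "(LINT x|?M. v' x) = v l - v 0"
    using has_L2_deriv_value[OF u, of l] has_L2_deriv_value[OF v, of l] l by auto
  ultimately show ?thesis by (simp add: algebra_simps)
qed

section \<open>Regularity, compactness and closedness on an interval\<close>

lemma has_L2_deriv_C1: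
  assumes "\<And>x. x \<in> {0..l} \<Longrightarrow> (f has_vector_derivative g x) (at x within {0..l})"
    and g: "continuous_on {0..l} g"
  shows "has_L2_deriv l f g"
proof (rule has_L2_derivI[OF L2_continuous[OF g]])
  fix x assume x: "x \<in> {0..l}"
  have "(g has_integral (f x - f 0)) {0..x}"
  proof (rule fundamental_theorem_of_calculus)
    show "(f has_vector_derivative g y) (at y within {0..x})" if "y \<in> {0..x}" for y
      by (rule has_vector_derivative_within_subset[OF assms(1)]) (use x that in auto)
  qed (use x in auto)
  moreover have "continuous_on {0..x} g" by (rule continuous_on_subset[OF g]) (use x in auto)
  then have "integrable (lebesgue_on {0..x}) g" by (rule L2_integrable[OF L2_continuous])
  then have "(LINT t|lebesgue_on {0..x}. g t) = integral {0..x} g"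
    by (rule lebesgue_integral_eq_integral) auto
  ultimately show "f x = f 0 + (LINT t|lebesgue_on {0..x}. g t)"
    by (simp add: integral_unique)
qed

lemma has_L2_deriv_continuous_imp_C1:
  assumes f: "has_L2_deriv l f w" and w: "continuous_on {0..l} w" and x: "x \<in> {0..l}"
  shows "(f has_vector_derivative w x) (at x within {0..l})"
proof -
  have D: "((\<lambda>u. f 0 + integral {0..u} w) has_vector_derivative 0 + w x) (at x within {0..l})"
    by (intro has_vector_derivative_add has_vector_derivative_const integral_has_vector_derivative w x)
  have "f y = f 0 + integral {0..y} w" if y: "y \<in> {0..l}" for y
  proof -
    have "continuous_on {0..y} w" by (rule continuous_on_subset[OF w]) (use y in auto)
    then have "integrable (lebesgue_on {0..y}) w" by (rule L2_integrable[OF L2_continuous])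
    then have "(LINT t|lebesgue_on {0..y}. w t) = integral {0..y} w"
      by (rule lebesgue_integral_eq_integral) auto
    then show ?thesis using has_L2_deriv_value[OF f y] by (simp only:)
  qed
  from has_vector_derivative_transform[OF x this D] show ?thesis by simp
qed

lemma deriv_on_eqI:
  assumes "0 < l" "x \<in> {0..l}" "(f has_vector_derivative d) (at x within {0..l})"
  shows "deriv_on l f x = d"
  unfolding deriv_on_def using assms by (rule vector_derivative_within_closed_interval)

lemma has_L2_deriv2_imp_deriv:
  assumes "0 < l" "has_L2_deriv2 l f g"
  shows "has_L2_deriv l f (deriv_on l f)"
proof (rule has_L2_deriv_C1)
  fix x assume x: "x \<in> {0..l}"
  have "f differentiable (at x within {0..l})"
    using assms(2) x by (simp add: has_L2_deriv2_def differentiable_on_def)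
  then show "(f has_vector_derivative deriv_on l f x) (at x within {0..l})"
    unfolding deriv_on_def by (simp add: vector_derivative_works)
next
  show "continuous_on {0..l} (deriv_on l f)"
    using assms(2) has_L2_deriv_continuous by (auto simp: has_L2_deriv2_def)
qed

text \<open>
  Regularity: a weak derivative that agrees almost everywhere with a function having an
  \<open>L\<^sup>2\<close> derivative is a classical derivative.
\<close>

lemma has_L2_deriv2_AE_deriv:
  assumes l: "0 < l" and f: "has_L2_deriv l f g" and w: "has_L2_deriv l w h"
    and eq: "AE x in lebesgue_on {0..l}. g x = w x"
  shows "has_L2_deriv2 l f h" "\<And>x. x \<in> {0..l} \<Longrightarrow> deriv_on l f x = w x"
proof -
  have wc: "continuous_on {0..l} w" by (rule has_L2_deriv_continuous[OF w])
  have "has_L2_deriv l f w"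
  proof (rule has_L2_derivI[OF L2_continuous[OF wc]])
    fix x assume x: "x \<in> {0..l}"
    have "(LINT t|lebesgue_on {0..l}. indicator {0..x} t * g t) = (LINT t|lebesgue_on {0..l}. indicator {0..x} t * w t)"
    proof (rule integral_cong_AE)
      show "AE t in lebesgue_on {0..l}. indicator {0..x} t * g t = indicator {0..x} t * w t"
        using eq by (rule AE_mp) (auto intro!: AE_I2)
    qed (use L2_indicator_mult[of "{0..x}" l] has_L2_deriv_L2[OF f] L2_continuous[OF wc] in \<open>auto intro: L2_measurable\<close>)
    then show "f x = f 0 + (LINT t|lebesgue_on {0..x}. w t)"
      using has_L2_deriv_value[OF f x] by (simp only: lebesgue_on_initial[OF x])
  qed
  note C1 = has_L2_deriv_continuous_imp_C1[OF this wc]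
  show d: "\<And>x. x \<in> {0..l} \<Longrightarrow> deriv_on l f x = w x" using deriv_on_eqI[OF l _ C1] by blast
  have "f differentiable_on {0..l}"
    unfolding differentiable_on_def using C1 by (blast intro: differentiableI_vector)
  moreover have "has_L2_deriv l (deriv_on l f) h" by (rule has_L2_deriv_cong[OF w]) (simp_all add: d)
  ultimately show "has_L2_deriv2 l f h" by (simp add: has_L2_deriv2_def)
qed

lemma has_L2_deriv_cnj:
  assumes "has_L2_deriv l f g" shows "has_L2_deriv l (\<lambda>x. cnj (f x)) (\<lambda>x. cnj (g x))"
proof (rule has_L2_derivI[OF L2_cnj[OF has_L2_deriv_L2[OF assms]]])
  fix x assume x: "x \<in> {0..l}"
  have "integrable (lebesgue_on {0..l}) (\<lambda>t. indicator {0..x} t * g t)"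
    using has_L2_deriv_L2[OF assms] by (intro L2_integrable L2_indicator_mult) auto
  from integral_bounded_linear[OF bounded_linear_cnj this]
  have "(LINT t|lebesgue_on {0..x}. cnj (g t)) = cnj (LINT t|lebesgue_on {0..x}. g t)"
    by (simp add: lebesgue_on_initial[OF x] indicator_def if_distrib cong: if_cong)
  then show "cnj (f x) = cnj (f 0) + (LINT t|lebesgue_on {0..x}. cnj (g t))"
    using arg_cong[OF has_L2_deriv_value[OF assms x], of cnj] by (simp only: complex_cnj_add)
qed

lemma has_L2_deriv_green:
  assumes "0 \<le> l" "has_L2_deriv l \<phi> \<psi>" "has_L2_deriv l w h"
  shows "l2_inner l \<psi> w + l2_inner l \<phi> h = cnj (\<phi> l) * w l - cnj (\<phi> 0) * w 0"
  using has_L2_deriv_by_parts[OF assms(1) has_L2_deriv_cnj[OF assms(2)] assms(3)]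
  by (simp add: l2_inner_def)

lemma l2_sq_eq_0_AE: "L2 l f \<Longrightarrow> l2_sq l f = 0 \<Longrightarrow> AE x in lebesgue_on {0..l}. f x = 0"
  unfolding l2_sq_def L2_def by (subst (asm) integral_nonneg_eq_0_iff_AE) auto

text \<open>
  The lemma of du Bois-Reymond. Let \<open>H\<close> be a primitive of \<open>h\<close>. Every
  \<open>L\<^sup>2\<close> function of mean zero is the derivative of an admissible
  \<open>\<phi>\<close>, so \<open>g + H\<close> is orthogonal to all of them, in particular to
  \<open>g + H\<close> minus its mean \<open>c\<close>. Hence \<open>g = c - H\<close> almost
  everywhere.
\<close>

theorem weak_second_derivative:
  assumes l: "0 < l" and f: "has_L2_deriv l f g" and h: "L2 l h"
    and weak: "\<And>\<phi> \<psi>. has_L2_deriv l \<phi> \<psi> \<Longrightarrow> \<phi> 0 = 0 \<Longrightarrow> \<phi> l = 0 \<Longrightarrow> l2_inner l \<psi> g = l2_inner l \<phi> h"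
  shows "has_L2_deriv2 l f (\<lambda>x. - h x)" "AE x in lebesgue_on {0..l}. g x = deriv_on l f x"
proof -
  define H where "H x = 0 + (LINT t|lebesgue_on {0..x}. h t)" for x
  have H: "has_L2_deriv l H h" unfolding H_def[abs_def] by (rule has_L2_deriv_integral[OF h])
  have gL2: "L2 l g" by (rule has_L2_deriv_L2[OF f])
  have HL2: "L2 l H" by (rule has_L2_deriv_self_L2[OF H])
  define c where "c = (LINT x|lebesgue_on {0..l}. g x + H x) / of_real l"
  define \<psi> where "\<psi> x = (g x + H x) - c" for x
  have psi: "L2 l \<psi>" unfolding \<psi>_def[abs_def] using gL2 HL2 by (intro L2_diff L2_add L2_const)
  define \<phi> where "\<phi> x = 0 + (LINT t|lebesgue_on {0..x}. \<psi> t)" for x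
  have phi: "has_L2_deriv l \<phi> \<psi>" unfolding \<phi>_def[abs_def] by (rule has_L2_deriv_integral[OF psi])
  have int: "integrable (lebesgue_on {0..l}) (\<lambda>x. g x + H x)" "integrable (lebesgue_on {0..l}) (\<lambda>x. c)"
    using gL2 HL2 by (auto intro!: L2_integrable L2_add L2_const)
  have mean0: "(LINT x|lebesgue_on {0..l}. \<psi> x) = 0"
    unfolding \<psi>_def Bochner_Integration.integral_diff[OF int] using l
    by (simp add: c_def measure_restrict_space scaleR_conv_of_real)
  have phi_l: "\<phi> l = 0" by (simp add: \<phi>_def mean0)
  have phi_0: "\<phi> 0 = 0"
    using has_L2_deriv_value[OF phi, of l] l phi_l mean0 by auto
  have "l2_inner l \<psi> g = l2_inner l \<phi> h" by (rule weak[OF phi phi_0 phi_l])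
  moreover have "l2_inner l \<psi> H + l2_inner l \<phi> h = 0"
    using has_L2_deriv_green[OF less_imp_le[OF l] phi H] phi_0 phi_l by simp
  moreover have "l2_inner l \<psi> (\<lambda>_. c) = 0"
  proof -
    have "l2_inner l \<psi> (\<lambda>_. c) = cnj (LINT x|lebesgue_on {0..l}. \<psi> x) * c"
      using integral_bounded_linear[OF bounded_linear_cnj L2_integrable[OF psi]]
      by (simp add: l2_inner_def)
    then show ?thesis by (simp add: mean0)
  qed
  moreover have "\<psi> = (g + H) - (\<lambda>_. c)" by (simp add: \<psi>_def fun_eq_iff)
  then have "l2_inner l \<psi> \<psi> = l2_inner l \<psi> g + l2_inner l \<psi> H - l2_inner l \<psi> (\<lambda>_. c)"
    using funs.hermitian_diff_right[OF l2_hermitian, of \<psi> l "g + H" "\<lambda>_. c"]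
      funs.hermitian_add_right[OF l2_hermitian, of \<psi> l g H] psi gL2 HL2 L2_add[OF gL2 HL2] L2_const
    by (simp add: plus_fun_def)
  ultimately have "l2_inner l \<psi> \<psi> = 0" by (simp add: add_eq_0_iff)
  then have "AE x in lebesgue_on {0..l}. \<psi> x = 0"
    by (intro l2_sq_eq_0_AE psi) (simp add: l2_inner_self)
  then have eq: "AE x in lebesgue_on {0..l}. g x = c - H x"
    by (rule AE_mp) (auto intro!: AE_I2 simp: \<psi>_def algebra_simps)
  have "has_L2_deriv l (\<lambda>_. c) (\<lambda>_. 0)" by (rule has_L2_deriv_C1) auto
  from has_L2_deriv_diff[OF this H] have w: "has_L2_deriv l (\<lambda>x. c - H x) (\<lambda>x. - h x)" by simp
  show "has_L2_deriv2 l f (\<lambda>x. - h x)" by (rule has_L2_deriv2_AE_deriv(1)[OF l f w eq])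
  show "AE x in lebesgue_on {0..l}. g x = deriv_on l f x"
    using eq by (rule AE_mp) (auto intro!: AE_I2 simp: has_L2_deriv2_AE_deriv(2)[OF l f w eq])
qed

text \<open>
  Let the length \<open>d\<close> in \<open>has_L2_deriv_sup_bound\<close> tend to
  \<open>0\<close>.
\<close>

lemma has_L2_deriv_null:
  assumes l: "0 < l" and f: "has_L2_deriv l f g" and null: "l2_sq l f = 0" and x: "x \<in> {0..l}"
  shows "f x = 0"
proof -
  have "(\<lambda>n. 2 * (l * inverse (real (Suc n))) * l2_sq l g) \<longlonglongrightarrow> 2 * (l * 0) * l2_sq l g"
    by (intro tendsto_intros LIMSEQ_inverse_real_of_nat)
  moreover have "(cmod (f x))\<^sup>2 \<le> 2 * (l * inverse (real (Suc n))) * l2_sq l g" for n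
    using has_L2_deriv_sup_bound[OF f, of "l * inverse (real (Suc n))", OF _ _ x] l null
      mult_left_le[of "inverse (real (Suc n))" l] le_imp_inverse_le[of 1 "real (Suc n)"]
    by simp
  ultimately have "(cmod (f x))\<^sup>2 \<le> 2 * (l * 0) * l2_sq l g"
    by (intro LIMSEQ_le_const) auto
  then show ?thesis by simp
qed

text \<open>
  Bounded energy gives equicontinuity through the Hoelder estimate, so the Arzela-Ascoli theorem
  yields uniform convergence, hence \<open>L\<^sup>2\<close> convergence, of a subsequence.
\<close>

lemma has_L2_deriv_compact:
  assumes l: "0 < l" and f: "\<And>n. has_L2_deriv l (f n) (g n)"
    and K: "\<And>n. l2_sq l (f n) \<le> K" "\<And>n. l2_sq l (g n) \<le> K"
  shows "\<exists>r. strict_mono (r :: nat \<Rightarrow> nat) \<and>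
     (\<forall>e>0. \<exists>N. \<forall>m\<ge>N. \<forall>n\<ge>N. l2_sq l (\<lambda>x. f (r m) x - f (r n) x) < e)"
proof -
  have K0: "0 \<le> K" using K(1)[of 0] l2_sq_nonneg[of l "f 0"] by simp
  define B where "B = sqrt (2 / l * K + 2 * l * K)"
  have bound: "cmod (f n x) \<le> B" if "x \<in> {0..l}" for n x
    unfolding B_def
  proof (rule real_le_rsqrt)
    have "(cmod (f n x))\<^sup>2 \<le> 2 / l * l2_sq l (f n) + 2 * l * l2_sq l (g n)"
      by (rule has_L2_deriv_sup_bound[OF f l order_refl that])
    also have "\<dots> \<le> 2 / l * K + 2 * l * K" using K l by (intro add_mono mult_left_mono) auto
    finally show "(cmod (f n x))\<^sup>2 \<le> 2 / l * K + 2 * l * K" .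
  qed
  have equi: "\<exists>d. 0 < d \<and> (\<forall>n y. y \<in> {0..l} \<and> norm (x - y) < d \<longrightarrow> norm (f n x - f n y) < e)"
    if x: "x \<in> {0..l}" and e: "0 < e" for x e :: real
  proof (intro exI[of _ "e\<^sup>2 / (K + 1)"] conjI allI impI)
    show "0 < e\<^sup>2 / (K + 1)" using e K0 by simp
    fix n y assume y: "y \<in> {0..l} \<and> norm (x - y) < e\<^sup>2 / (K + 1)"
    have "(cmod (f n x - f n y))\<^sup>2 \<le> \<bar>x - y\<bar> * l2_sq l (g n)"
      using has_L2_deriv_Hoelder[OF f x] y by blast
    also have "\<dots> \<le> \<bar>x - y\<bar> * (K + 1)" using K(2)[of n] by (intro mult_left_mono) auto
    also have "\<dots> < e\<^sup>2" using y K0 by (simp add: pos_less_divide_eq)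
    finally show "norm (f n x - f n y) < e" using e by (intro power2_less_imp_less[of _ e]) auto
  qed
  obtain F r where r: "strict_mono (r :: nat \<Rightarrow> nat)"
    and lim: "\<And>e. 0 < e \<Longrightarrow> \<exists>N. \<forall>n x. n \<ge> N \<and> x \<in> {0..l} \<longrightarrow> norm (f (r n) x - F x) < e"
  proof (rule Arzela_Ascoli[of "{0..l}" f B])
    show "compact {0..l}" by simp
    show "norm (f n x) \<le> B" if "x \<in> {0..l}" for n x by (rule bound[OF that])
    show "\<exists>d. 0 < d \<and> (\<forall>n y. y \<in> {0..l} \<and> norm (x - y) < d \<longrightarrow> norm (f n x - f n y) < e)"
      if "x \<in> {0..l}" "0 < e" for x e by (rule equi[OF that])
  qed (use that in blast)
  have "\<exists>N. \<forall>m\<ge>N. \<forall>n\<ge>N. l2_sq l (\<lambda>x. f (r m) x - f (r n) x) < e" if e: "0 < e" for e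
  proof -
    define d where "d = sqrt (e / (2 * l)) / 2"
    have d: "0 < d" "l * (2 * d)\<^sup>2 = e / 2" using e l by (auto simp: d_def power_divide)
    obtain N where N: "\<And>n x. n \<ge> N \<Longrightarrow> x \<in> {0..l} \<Longrightarrow> norm (f (r n) x - F x) < d" using lim[OF d(1)] by blast
    have "l2_sq l (\<lambda>x. f (r m) x - f (r n) x) < e" if "m \<ge> N" "n \<ge> N" for m n
    proof -
      have "cmod (f (r m) x - f (r n) x) \<le> 2 * d" if x: "x \<in> {0..l}" for x
        using norm_triangle_ineq4[of "f (r m) x - F x" "f (r n) x - F x"]
          N[OF \<open>m \<ge> N\<close> x] N[OF \<open>n \<ge> N\<close> x] by simp
      then have "l2_sq l (\<lambda>x. f (r m) x - f (r n) x) \<le> l * (2 * d)\<^sup>2"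
        using l by (intro l2_sq_le_bound L2_diff has_L2_deriv_self_L2[OF f]) auto
      then show ?thesis using d e by simp
    qed
    then show ?thesis by blast
  qed
  then show ?thesis using r by blast
qed

text \<open>
  The limit is rebuilt from the \<open>L\<^sup>2\<close> limit of the derivatives and the limit of
  the values at \<open>0\<close>; the latter exists because point values are controlled by the
  norms of function and derivative.
\<close>

lemma has_L2_deriv_complete:
  assumes l: "0 < l" and f: "\<And>n. has_L2_deriv l (f n) (g n)"
    and cf: "\<And>e. 0 < e \<Longrightarrow> \<exists>N. \<forall>m\<ge>N. \<forall>n\<ge>N. l2_sq l (\<lambda>x. f m x - f n x) < e"
    and cg: "\<And>e. 0 < e \<Longrightarrow> \<exists>N. \<forall>m\<ge>N. \<forall>n\<ge>N. l2_sq l (\<lambda>x. g m x - g n x) < e"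
  shows "\<exists>F h. has_L2_deriv l F h \<and> (\<lambda>n. l2_sq l (\<lambda>x. f n x - F x)) \<longlonglongrightarrow> 0
    \<and> (\<lambda>n. l2_sq l (\<lambda>x. g n x - h x)) \<longlonglongrightarrow> 0"
proof -
  obtain h where h: "L2 l h" "(\<lambda>n. l2_sq l (\<lambda>x. g n x - h x)) \<longlonglongrightarrow> 0"
    using L2_complete[of l g, OF less_imp_le[OF l] has_L2_deriv_L2[OF f] cg] by blast
  have "Cauchy (\<lambda>n. f n 0)"
  proof (rule CauchyI)
    fix e :: real assume e: "0 < e"
    obtain N1 where N1: "\<forall>m\<ge>N1. \<forall>n\<ge>N1. l2_sq l (\<lambda>x. f m x - f n x) < e\<^sup>2 * l / 4"
      using cf[of "e\<^sup>2 * l / 4"] e l by auto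
    obtain N2 where N2: "\<forall>m\<ge>N2. \<forall>n\<ge>N2. l2_sq l (\<lambda>x. g m x - g n x) < e\<^sup>2 / (4 * l)"
      using cg[of "e\<^sup>2 / (4 * l)"] e l by auto
    have "norm (f m 0 - f n 0) < e" if "m \<ge> max N1 N2" "n \<ge> max N1 N2" for m n
    proof -
      have "(cmod (f m 0 - f n 0))\<^sup>2 \<le> 2 / l * l2_sq l (\<lambda>x. f m x - f n x) + 2 * l * l2_sq l (\<lambda>x. g m x - g n x)"
        using has_L2_deriv_sup_bound[OF has_L2_deriv_diff[OF f f] l order_refl, of 0 m n] l by simp
      also have "\<dots> < 2 / l * (e\<^sup>2 * l / 4) + 2 * l * (e\<^sup>2 / (4 * l))"
        using N1 N2 that l by (intro add_strict_mono mult_strict_left_mono) auto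
      also have "\<dots> = e\<^sup>2" using l by (simp add: field_simps)
      finally show ?thesis using e by (intro power2_less_imp_less[of _ e]) auto
    qed
    then show "\<exists>M. \<forall>m\<ge>M. \<forall>n\<ge>M. norm (f m 0 - f n 0) < e" by blast
  qed
  then obtain c where c: "(\<lambda>n. f n 0) \<longlonglongrightarrow> c" using Cauchy_convergent_iff convergentD by blast
  define F where "F x = c + (LINT t|lebesgue_on {0..x}. h t)" for x
  have F: "has_L2_deriv l F h" unfolding F_def[abs_def] by (rule has_L2_deriv_integral[OF h(1)])
  have "(LINT t|lebesgue_on {0..0}. h t) = 0"
    using has_L2_deriv_value[OF F, of 0] l by simp
  then have F0: "F 0 = c" by (simp add: F_def)
  have "l2_sq l (\<lambda>x. f n x - F x) \<le> l * (2 * (cmod (f n 0 - c))\<^sup>2 + 2 * (l * l2_sq l (\<lambda>x. g n x - h x)))" for n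
  proof -
    let ?d = "\<lambda>x. f n x - F x" and ?G = "l2_sq l (\<lambda>x. g n x - h x)"
    have d: "has_L2_deriv l ?d (\<lambda>x. g n x - h x)" by (rule has_L2_deriv_diff[OF f F])
    let ?K = "sqrt (2 * (cmod (f n 0 - c))\<^sup>2 + 2 * (l * ?G))"
    have "cmod (?d x) \<le> ?K" if x: "x \<in> {0..l}" for x
    proof (rule real_le_rsqrt)
      have "(cmod (?d x))\<^sup>2 \<le> (cmod (?d 0) + cmod (?d x - ?d 0))\<^sup>2"
        using norm_triangle_ineq[of "?d 0" "?d x - ?d 0"] by (intro power_mono) auto
      also have "\<dots> \<le> 2 * (cmod (?d 0))\<^sup>2 + 2 * (cmod (?d x - ?d 0))\<^sup>2"
        using sum_squares_bound[of "cmod (?d 0)" "cmod (?d x - ?d 0)"] by (simp add: power2_sum)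
      also have "(cmod (?d x - ?d 0))\<^sup>2 \<le> \<bar>x - 0\<bar> * ?G" using l by (intro has_L2_deriv_Hoelder[OF d x]) auto
      also have "\<dots> \<le> l * ?G" using x l2_sq_nonneg by (intro mult_right_mono) auto
      finally show "(cmod (?d x))\<^sup>2 \<le> 2 * (cmod (f n 0 - c))\<^sup>2 + 2 * (l * ?G)" using F0 by simp
    qed
    then have "l2_sq l ?d \<le> l * ?K\<^sup>2" using l by (intro l2_sq_le_bound has_L2_deriv_self_L2[OF d]) auto
    then show ?thesis using l l2_sq_nonneg[of l "\<lambda>x. g n x - h x"] by simp
  qed
  moreover have "(\<lambda>n. l * (2 * (cmod (f n 0 - c))\<^sup>2 + 2 * (l * l2_sq l (\<lambda>x. g n x - h x))))
     \<longlonglongrightarrow> l * (2 * (cmod (c - c))\<^sup>2 + 2 * (l * 0))"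
    by (intro tendsto_intros c h(2))
  then have lim0: "(\<lambda>n. l * (2 * (cmod (f n 0 - c))\<^sup>2 + 2 * (l * l2_sq l (\<lambda>x. g n x - h x)))) \<longlonglongrightarrow> 0"
    by simp
  ultimately have "(\<lambda>n. l2_sq l (\<lambda>x. f n x - F x)) \<longlonglongrightarrow> 0"
    by (intro tendsto_sandwich[OF always_eventually always_eventually tendsto_const lim0]) (auto simp: l2_sq_nonneg)
  then show ?thesis using F h(2) by blast
qed

section \<open>Vertex conditions in variational form\<close>

lemma app_outside: "i \<notin> S \<Longrightarrow> app S M x i = 0"
  by (simp add: app_def)

lemma app_cong: "(\<And>j. j \<in> S \<Longrightarrow> x j = y j) \<Longrightarrow> app S M x = app S M y"
  by (auto simp: app_def fun_eq_iff)

lemma app_add: "app S M (\<lambda>i. x i + y i) = (\<lambda>i. app S M x i + app S M y i)"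
  by (auto simp: app_def fun_eq_iff distrib_left sum.distrib)

lemma app_scale: "app S M (\<lambda>i. c * x i) = (\<lambda>i. c * app S M x i)"
  by (auto simp: app_def fun_eq_iff sum_distrib_left mult.left_commute)

lemma inner_on_cong: "(\<And>i. i \<in> S \<Longrightarrow> x i = x' i) \<Longrightarrow> (\<And>i. i \<in> S \<Longrightarrow> y i = y' i) \<Longrightarrow> inner_on S x y = inner_on S x' y'"
  by (auto simp: inner_on_def)

lemma inner_on_add_right: "inner_on S x (\<lambda>i. y i + z i) = inner_on S x y + inner_on S x z"
  by (simp add: inner_on_def distrib_left sum.distrib)

lemma inner_on_scale_right: "inner_on S x (\<lambda>i. c * y i) = c * inner_on S x y"
  by (simp add: inner_on_def sum_distrib_left mult.left_commute)

lemma inner_on_diff_right: "inner_on S x (\<lambda>i. y i - z i) = inner_on S x y - inner_on S x z"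
  by (simp add: inner_on_def right_diff_distrib sum_subtractf)

lemma inner_on_swap: "inner_on S y x = cnj (inner_on S x y)"
  by (simp add: inner_on_def mult.commute)

lemma inner_on_zero: "inner_on S x (\<lambda>_. 0) = 0" "inner_on S (\<lambda>_. 0) x = 0"
  by (simp_all add: inner_on_def)

lemma inner_on_eq_0_imp:
  assumes "finite S" "\<And>y. inner_on S y x = 0" "i \<in> S"
  shows "x i = 0"
proof -
  have "inner_on S (\<lambda>j. if j = i then 1 else 0) x = (\<Sum>j\<in>S. if j = i then x j else 0)"
    unfolding inner_on_def by (rule sum.cong) auto
  also have "\<dots> = x i" using assms(1,3) by simp
  finally have "inner_on S (\<lambda>j. if j = i then 1 else 0) x = x i" .
  then show ?thesis using assms(2) by simp
qed

lemma app_eq_0I: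
  assumes "finite S" "\<And>y. inner_on S y (app S M x) = 0"
  shows "app S M x = (\<lambda>_. 0)"
  using inner_on_eq_0_imp[OF assms] app_outside[of _ S M x] by (auto simp: fun_eq_iff)

definition matrix_comp :: "'i set \<Rightarrow> 'i matr \<Rightarrow> 'i matr \<Rightarrow> 'i matr" where
  "matrix_comp S M N = (\<lambda>i j. \<Sum>k\<in>S. M i k * N k j)"

lemma app_matrix_comp: "app S (matrix_comp S M N) x = app S M (app S N x)"
proof
  fix i
  have "(\<Sum>j\<in>S. (\<Sum>k\<in>S. M i k * N k j) * x j) = (\<Sum>k\<in>S. M i k * (\<Sum>j\<in>S. N k j * x j))"
    unfolding sum_distrib_left sum_distrib_right mult.assoc by (rule sum.swap)
  then show "app S (matrix_comp S M N) x i = app S M (app S N x) i"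
    by (simp add: app_def matrix_comp_def)
qed

text \<open>
  A vertex condition in variational form. The essential conditions \<open>A F = 0\<close> restrict
  the form domain, and \<open>B\<close> is the matrix of the boundary term of the quadratic form.
  The conditions on \<open>F'\<close> are the natural ones: they say that the boundary terms cancel
  against all admissible boundary vectors.
\<close>

definition form_condition :: "'i set \<Rightarrow> 'i vcond \<Rightarrow> 'i matr \<Rightarrow> 'i matr \<Rightarrow> bool" where
  "form_condition S C A B \<longleftrightarrow>
     (\<forall>x y. inner_on S y (app S B x) = cnj (inner_on S x (app S B y))) \<and>
     (\<forall>F F'. C F F' \<longleftrightarrow> app S A F = (\<lambda>_. 0) \<and>
        (\<forall>Y. app S A Y = (\<lambda>_. 0) \<longrightarrow> inner_on S Y F' = inner_on S Y (app S B F)))"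

text \<open>
  Take \<open>A = P\<^sub>D\<close> and \<open>B = P\<^sub>R \<Lambda> P\<^sub>R\<close>. Testing
  with the vectors in the range of \<open>P\<^sub>N\<close> and of \<open>P\<^sub>R\<close>, which
  are admissible by orthogonality to the range of \<open>P\<^sub>D\<close>, recovers the conditions
  \<open>P\<^sub>N F' = 0\<close> and \<open>P\<^sub>R F' = \<Lambda> P\<^sub>R F\<close>.
\<close>

lemma form_condition_local_self_adjoint:
  assumes S: "finite S" and C: "local_self_adjoint S C"
  shows "\<exists>A B. form_condition S C A B"
proof -
  obtain PD PN PR L where P: "orth_proj S PD" "orth_proj S PN" "orth_proj S PR"
    and orth: "orth_ran S PD PN" "orth_ran S PD PR" "orth_ran S PN PR"
    and sum: "\<forall>x. \<forall>i\<in>S. app S PD x i + app S PN x i + app S PR x i = x i"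
    and bij: "bij_betw (app S L) (range_on S PR) (range_on S PR)"
    and L: "\<forall>x\<in>range_on S PR. \<forall>y\<in>range_on S PR. inner_on S (app S L x) y = inner_on S x (app S L y)"
    and iff: "\<forall>F F'. C F F' \<longleftrightarrow> app S PD F = (\<lambda>_. 0) \<and> app S PN F' = (\<lambda>_. 0) \<and>
        app S PR F' = app S L (app S PR F)"
    using C unfolding local_self_adjoint_def by (elim exE conjE)
  define B where "B = matrix_comp S PR (matrix_comp S L PR)"
  have B: "app S B x = app S PR (app S L (app S PR x))" for x by (simp add: B_def app_matrix_comp)
  have adj: "inner_on S (app S M x) y = inner_on S x (app S M y)" and idem: "app S M (app S M x) = app S M x"
    if "orth_proj S M" for M x y
    using that by (auto simp: orth_proj_def)
  have ran: "app S PR x \<in> range_on S PR" for x by (simp add: range_on_def)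
  have ranL: "app S L (app S PR x) \<in> range_on S PR" for x
    using bij ran[of x] by (auto dest: bij_betwE)
  have fixR: "app S PR y = y" if "y \<in> range_on S PR" for y
    using that idem[OF P(3)] by (auto simp: range_on_def)
  have BL: "app S B x = app S L (app S PR x)" for x using fixR[OF ranL] by (simp add: B)
  have null: "app S M (app S N y) = (\<lambda>_. 0)" if M: "orth_proj S M" and MN: "orth_ran S M N" for M N y
  proof (rule app_eq_0I[OF S])
    fix x
    have "inner_on S (app S M x) (app S N y) = 0"
      using MN unfolding orth_ran_def range_on_def by blast
    then show "inner_on S x (app S M (app S N y)) = 0" using adj[OF M] by simp
  qed
  have herm: "inner_on S y (app S B x) = cnj (inner_on S x (app S B y))" for x y
  proof -
    have "inner_on S y (app S B x) = inner_on S (app S PR y) (app S L (app S PR x))"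
      using adj[OF P(3)] by (simp add: B)
    also have "\<dots> = inner_on S (app S L (app S PR y)) (app S PR x)" using L ran by simp
    also have "\<dots> = inner_on S (app S B y) x" using adj[OF P(3)] by (simp add: B)
    finally show ?thesis using inner_on_swap by metis
  qed
  have "C F F' \<longleftrightarrow> app S PD F = (\<lambda>_. 0) \<and>
      (\<forall>Y. app S PD Y = (\<lambda>_. 0) \<longrightarrow> inner_on S Y F' = inner_on S Y (app S B F))" for F F'
  proof
    assume "C F F'"
    then have F: "app S PD F = (\<lambda>_. 0)" "app S PN F' = (\<lambda>_. 0)" "app S PR F' = app S L (app S PR F)"
      using iff by auto
    have "inner_on S Y F' = inner_on S Y (app S B F)" if Y: "app S PD Y = (\<lambda>_. 0)" for Y
    proof -
      have "inner_on S Y F' = inner_on S Y (\<lambda>i. app S PD F' i + app S PN F' i + app S PR F' i)"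
        by (rule inner_on_cong) (use sum in auto)
      also have "\<dots> = inner_on S Y (app S PD F') + inner_on S Y (app S PN F') + inner_on S Y (app S PR F')"
        by (simp only: inner_on_add_right)
      also have "inner_on S Y (app S PD F') = 0"
        using adj[OF P(1), of Y F'] Y by (simp add: inner_on_zero)
      finally show ?thesis using F by (simp add: BL inner_on_zero)
    qed
    then show "app S PD F = (\<lambda>_. 0) \<and>
      (\<forall>Y. app S PD Y = (\<lambda>_. 0) \<longrightarrow> inner_on S Y F' = inner_on S Y (app S B F))" using F(1) by blast
  next
    assume F: "app S PD F = (\<lambda>_. 0) \<and>
      (\<forall>Y. app S PD Y = (\<lambda>_. 0) \<longrightarrow> inner_on S Y F' = inner_on S Y (app S B F))"
    have "app S PN F' = (\<lambda>_. 0)"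
    proof (rule app_eq_0I[OF S])
      fix y
      have "inner_on S (app S PN y) F' = inner_on S (app S PN y) (app S B F)"
        using F null[OF P(1) orth(1)] by blast
      also have "\<dots> = 0" using orth(3) unfolding orth_ran_def range_on_def B by blast
      finally show "inner_on S y (app S PN F') = 0" using adj[OF P(2)] by simp
    qed
    moreover have "app S PR F' i = app S L (app S PR F) i" for i
    proof (cases "i \<in> S")
      case True
      have "inner_on S y (\<lambda>i. app S PR F' i - app S B F i) = 0" for y
      proof -
        have "inner_on S (app S PR y) F' = inner_on S (app S PR y) (app S B F)"
          using F null[OF P(1) orth(2)] by blast
        then have "inner_on S y (app S PR F') = inner_on S y (app S PR (app S B F))"
          using adj[OF P(3)] by simp
        also have "app S PR (app S B F) = app S B F" unfolding B by (rule idem[OF P(3)])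
        finally show ?thesis by (simp add: inner_on_diff_right)
      qed
      from inner_on_eq_0_imp[OF S this True] show ?thesis by (simp add: BL)
    qed (simp add: app_outside)
    ultimately show "C F F'" using F iff by (auto simp: fun_eq_iff)
  qed
  then show ?thesis using herm unfolding form_condition_def by blast
qed

lemma app_zero_matrix: "app S (\<lambda>_ _. 0) x = (\<lambda>_. 0)"
  by (simp add: app_def fun_eq_iff)

lemma inner_on_delta_prime_form:
  "inner_on S Y (app S (\<lambda>_ _. complex_of_real (1 / \<beta>)) F)
     = complex_of_real (1 / \<beta>) * cnj (\<Sum>i\<in>S. Y i) * (\<Sum>i\<in>S. F i)"
  by (simp add: inner_on_def app_def sum_distrib_left[symmetric] sum_distrib_right[symmetric] mult_ac
      sum_divide_distrib[symmetric])

text \<open>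
  A \<open>\<delta>'\<close> condition has no essential part: all boundary values are admissible,
  and the boundary term is \<open>|\<Sum> F|\<^sup>2 / \<beta>\<close>. This is what allows
  boundary values to be moved between \<open>\<delta>'\<close> vertices.
\<close>

lemma form_condition_delta_prime:
  assumes S: "finite S" and "\<beta> \<noteq> 0"
  shows "form_condition S (delta_prime S \<beta>) (\<lambda>_ _. 0) (\<lambda>_ _. complex_of_real (1 / \<beta>))"
proof -
  let ?b = "complex_of_real (1 / \<beta>)"
  have "delta_prime S \<beta> F F' \<longleftrightarrow>
      (\<forall>Y. inner_on S Y F' = ?b * cnj (\<Sum>i\<in>S. Y i) * (\<Sum>i\<in>S. F i))" for F F'
  proof
    assume "delta_prime S \<beta> F F'"
    then obtain c where c: "\<forall>i\<in>S. F' i = c" "(\<Sum>i\<in>S. F i) = complex_of_real \<beta> * c"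
      by (auto simp: delta_prime_def)
    have "inner_on S Y F' = cnj (\<Sum>i\<in>S. Y i) * c" for Y
      using c(1) by (simp add: inner_on_def sum_distrib_right)
    then show "\<forall>Y. inner_on S Y F' = ?b * cnj (\<Sum>i\<in>S. Y i) * (\<Sum>i\<in>S. F i)"
      using c(2) \<open>\<beta> \<noteq> 0\<close> by simp
  next
    assume Y: "\<forall>Y. inner_on S Y F' = ?b * cnj (\<Sum>i\<in>S. Y i) * (\<Sum>i\<in>S. F i)"
    have "inner_on S y (\<lambda>i. F' i - ?b * (\<Sum>i\<in>S. F i)) = 0" for y
    proof -
      define z where "z = ?b * (\<Sum>i\<in>S. F i)"
      have "inner_on S y F' = cnj (\<Sum>i\<in>S. y i) * z" using Y by (simp add: z_def)
      moreover have "inner_on S y (\<lambda>_. z) = cnj (\<Sum>i\<in>S. y i) * z"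
        by (simp add: inner_on_def sum_distrib_right)
      ultimately show ?thesis by (simp only: inner_on_diff_right z_def[symmetric] diff_self)
    qed
    from inner_on_eq_0_imp[OF S this] have "F' i = ?b * (\<Sum>i\<in>S. F i)" if "i \<in> S" for i
      using that by auto
    then show "delta_prime S \<beta> F F'" unfolding delta_prime_def using \<open>\<beta> \<noteq> 0\<close>
      by (intro exI[of _ "?b * (\<Sum>i\<in>S. F i)"]) simp
  qed
  then show ?thesis
    unfolding form_condition_def inner_on_delta_prime_form app_zero_matrix by (simp add: mult_ac)
qed

section \<open>The quadratic form of a quantum graph\<close>

definition pscale :: "complex \<Rightarrow> 'e gfun \<times> 'e gfun \<Rightarrow> 'e gfun \<times> 'e gfun" where
  "pscale c p = (gscale c (fst p), gscale c (snd p))"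

interpretation pairs: complex_space pscale
  by unfold_locales (auto simp: pscale_def gscale_def prod_eq_iff fun_eq_iff algebra_simps)

text \<open>
  Elements are pairs of a function and its derivative. The derivative is determined only almost
  everywhere; carrying it along makes the energy an explicit expression in the pair.
\<close>

definition form_domain ::
  "('v, 'e) mgraph \<Rightarrow> ('v \<Rightarrow> ('e \<times> bool) matr) \<Rightarrow> ('e gfun \<times> 'e gfun) set" where
  "form_domain G A = {(f, g).
     (\<forall>e\<in>edges G. has_L2_deriv (len G e) (f e) (g e)) \<and>
     (\<forall>e x. e \<notin> edges G \<or> x \<notin> {0..len G e} \<longrightarrow> f e x = 0 \<and> g e x = 0) \<and>
     (\<forall>v\<in>verts G. app (ends_at G v) (A v) (bval G f) = (\<lambda>_. 0))}"

definition graph_inner :: "('v, 'e) mgraph \<Rightarrow> 'e gfun \<times> 'e gfun \<Rightarrow> 'e gfun \<times> 'e gfun \<Rightarrow> complex" where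
  "graph_inner G p p' = (\<Sum>e\<in>edges G. l2_inner (len G e) (fst p e) (fst p' e))"

definition boundary_form ::
  "('v, 'e) mgraph \<Rightarrow> ('v \<Rightarrow> ('e \<times> bool) matr) \<Rightarrow> ('e \<times> bool \<Rightarrow> complex) \<Rightarrow> ('e \<times> bool \<Rightarrow> complex) \<Rightarrow> complex" where
  "boundary_form G B Y F = (\<Sum>v\<in>verts G. inner_on (ends_at G v) Y (app (ends_at G v) (B v) F))"

definition graph_form ::
  "('v, 'e) mgraph \<Rightarrow> ('e \<Rightarrow> real \<Rightarrow> real) \<Rightarrow> ('v \<Rightarrow> ('e \<times> bool) matr)
     \<Rightarrow> 'e gfun \<times> 'e gfun \<Rightarrow> 'e gfun \<times> 'e gfun \<Rightarrow> complex" where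
  "graph_form G q B p p' =
     (\<Sum>e\<in>edges G. l2_inner (len G e) (snd p e) (snd p' e)) +
     (\<Sum>e\<in>edges G. l2_inner (len G e) (fst p e) (\<lambda>x. complex_of_real (q e x) * fst p' e x)) +
     boundary_form G B (bval G (fst p)) (bval G (fst p'))"

text \<open>
  Of a function this is the mass, of its derivative the kinetic energy.
\<close>

definition graph_mass :: "('v, 'e) mgraph \<Rightarrow> 'e gfun \<Rightarrow> real" where
  "graph_mass G f = (\<Sum>e\<in>edges G. l2_sq (len G e) (f e))"

lemma graph_mass_nonneg: "0 \<le> graph_mass G f"
  by (simp add: graph_mass_def sum_nonneg l2_sq_nonneg)

lemma graph_inner_self: "graph_inner G p p = of_real (graph_mass G (fst p))"
  by (simp add: graph_inner_def graph_mass_def l2_inner_self)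

lemma bval_add: "bval G (f + g) = (\<lambda>i. bval G f i + bval G g i)"
  by (auto simp: bval_def fun_eq_iff)

lemma bval_scale: "bval G (gscale c f) = (\<lambda>i. c * bval G f i)"
  by (auto simp: bval_def gscale_def fun_eq_iff)

lemma boundary_form_add: "boundary_form G B Y (\<lambda>i. F i + F' i) = boundary_form G B Y F + boundary_form G B Y F'"
  by (simp add: boundary_form_def app_add inner_on_add_right sum.distrib)

lemma boundary_form_scale: "boundary_form G B Y (\<lambda>i. c * F i) = c * boundary_form G B Y F"
  by (simp add: boundary_form_def app_scale inner_on_scale_right sum_distrib_left)

lemma finite_ends_at: "finite (edges G) \<Longrightarrow> finite (ends_at G v)"
  by (rule finite_subset[of _ "edges G \<times> UNIV"]) (auto simp: ends_at_def)

text \<open>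
  Every edge has its two ends at exactly one vertex each.
\<close>

lemma sum_ends:
  assumes "compact_metric_graph G"
  shows "(\<Sum>v\<in>verts G. \<Sum>i\<in>ends_at G v. h i) = (\<Sum>e\<in>edges G. h (e, False) + h (e, True))"
proof -
  have "ends_at G v = {i \<in> edges G \<times> UNIV. att G i = v}" for v by (auto simp: ends_at_def)
  then have "(\<Sum>v\<in>verts G. \<Sum>i\<in>ends_at G v. h i) = sum h (edges G \<times> UNIV)"
    using assms by (simp only:) (intro sum.group, auto simp: compact_metric_graph_def)
  also have "\<dots> = (\<Sum>e\<in>edges G. \<Sum>b\<in>UNIV. h (e, b))" by (simp add: sum.cartesian_product)
  finally show ?thesis by (simp add: UNIV_bool add.commute)
qed

lemma inner_app_bound:
  assumes "finite S"
  shows "cmod (inner_on S F (app S M F)) \<le> (\<Sum>i\<in>S. \<Sum>j\<in>S. cmod (M i j)) * (\<Sum>k\<in>S. (cmod (F k))\<^sup>2)"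
proof -
  let ?T = "\<Sum>k\<in>S. (cmod (F k))\<^sup>2"
  have le: "cmod (F i) * cmod (F j) \<le> ?T" if "i \<in> S" "j \<in> S" for i j
  proof -
    have "(cmod (F i))\<^sup>2 \<le> ?T" "(cmod (F j))\<^sup>2 \<le> ?T" using assms that by (auto intro: member_le_sum)
    moreover have "2 * cmod (F i) * cmod (F j) \<le> (cmod (F i))\<^sup>2 + (cmod (F j))\<^sup>2" by (rule sum_squares_bound)
    ultimately show ?thesis by linarith
  qed
  have "inner_on S F (app S M F) = (\<Sum>i\<in>S. \<Sum>j\<in>S. cnj (F i) * (M i j * F j))"
    by (simp add: inner_on_def app_def sum_distrib_left)
  also have "cmod \<dots> \<le> (\<Sum>i\<in>S. \<Sum>j\<in>S. cmod (cnj (F i) * (M i j * F j)))"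
    by (rule order_trans[OF norm_sum], rule sum_mono, rule norm_sum)
  also have "\<dots> = (\<Sum>i\<in>S. \<Sum>j\<in>S. cmod (M i j) * (cmod (F i) * cmod (F j)))"
    by (simp add: norm_mult mult_ac)
  also have "\<dots> \<le> (\<Sum>i\<in>S. \<Sum>j\<in>S. cmod (M i j) * ?T)" by (intro sum_mono mult_left_mono le) auto
  also have "\<dots> = (\<Sum>i\<in>S. \<Sum>j\<in>S. cmod (M i j)) * ?T" by (simp add: sum_distrib_right)
  finally show ?thesis .
qed

lemma boundary_form_bound:
  assumes G: "compact_metric_graph G"
  shows "\<exists>b\<ge>0. \<forall>F. cmod (boundary_form G B F F) \<le> b * (\<Sum>e\<in>edges G. (cmod (F (e, False)))\<^sup>2 + (cmod (F (e, True)))\<^sup>2)"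
proof -
  define \<beta> where "\<beta> v = (\<Sum>i\<in>ends_at G v. \<Sum>j\<in>ends_at G v. cmod (B v i j))" for v
  define b where "b = sum \<beta> (verts G)"
  have fin: "finite (verts G)" "finite (ends_at G v)" for v
    using G finite_ends_at by (auto simp: compact_metric_graph_def)
  have b0: "0 \<le> \<beta> v" for v by (simp add: \<beta>_def sum_nonneg)
  have "cmod (boundary_form G B F F) \<le> b * (\<Sum>e\<in>edges G. (cmod (F (e, False)))\<^sup>2 + (cmod (F (e, True)))\<^sup>2)" for F
  proof -
    have "cmod (boundary_form G B F F) \<le> (\<Sum>v\<in>verts G. \<beta> v * (\<Sum>k\<in>ends_at G v. (cmod (F k))\<^sup>2))"
      unfolding boundary_form_def \<beta>_def
      by (intro order_trans[OF norm_sum] sum_mono inner_app_bound fin)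
    also have "\<dots> \<le> (\<Sum>v\<in>verts G. b * (\<Sum>k\<in>ends_at G v. (cmod (F k))\<^sup>2))"
      unfolding b_def using fin b0 by (intro sum_mono mult_right_mono member_le_sum sum_nonneg) auto
    also have "\<dots> = b * (\<Sum>e\<in>edges G. (cmod (F (e, False)))\<^sup>2 + (cmod (F (e, True)))\<^sup>2)"
      by (simp only: sum_distrib_left[symmetric] sum_ends[OF G])
    finally show ?thesis .
  qed
  moreover have "0 \<le> b" unfolding b_def using b0 by (simp add: sum_nonneg)
  ultimately show ?thesis by blast
qed

lemma l2_sq_bounded_mult:
  assumes b: "b \<in> borel_measurable (lebesgue_on {0..l})" and f: "L2 l f"
    and K: "AE x in lebesgue_on {0..l}. cmod (b x) \<le> K"
  shows "l2_sq l (\<lambda>x. b x * f x) \<le> K\<^sup>2 * l2_sq l f"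
proof -
  have "l2_sq l (\<lambda>x. b x * f x) \<le> (LINT x|lebesgue_on {0..l}. K\<^sup>2 * (cmod (f x))\<^sup>2)"
    unfolding l2_sq_def
  proof (rule integral_mono_AE)
    show "AE x in lebesgue_on {0..l}. (cmod (b x * f x))\<^sup>2 \<le> K\<^sup>2 * (cmod (f x))\<^sup>2"
      using K by (rule AE_mp) (auto intro!: AE_I2 mult_mono power_mono simp: norm_mult power_mult_distrib)
  qed (use f L2_bounded_mult[OF assms] in \<open>auto simp: L2_def\<close>)
  then show ?thesis by (simp add: l2_sq_def)
qed

lemma Linf_bound:
  assumes "Linf l q"
  shows "(\<lambda>x. complex_of_real (q x)) \<in> borel_measurable (lebesgue_on {0..l})"
    and "\<exists>K\<ge>0. AE x in lebesgue_on {0..l}. cmod (complex_of_real (q x)) \<le> K"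
proof -
  show "(\<lambda>x. complex_of_real (q x)) \<in> borel_measurable (lebesgue_on {0..l})"
    using assms by (auto simp: Linf_def)
  obtain K where "AE x in lebesgue_on {0..l}. \<bar>q x\<bar> \<le> K" using assms by (auto simp: Linf_def)
  then have "AE x in lebesgue_on {0..l}. cmod (complex_of_real (q x)) \<le> \<bar>K\<bar>"
    by (rule AE_mp) (auto intro!: AE_I2)
  then show "\<exists>K\<ge>0. AE x in lebesgue_on {0..l}. cmod (complex_of_real (q x)) \<le> K" by (intro exI[of _ "\<bar>K\<bar>"]) simp
qed

lemma L2_potential: "Linf l q \<Longrightarrow> L2 l f \<Longrightarrow> L2 l (\<lambda>x. complex_of_real (q x) * f x)"
  using Linf_bound[of l q] L2_bounded_mult by blast

lemma potential_bound:
  assumes "Linf l q"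
  shows "\<exists>K\<ge>0. \<forall>f. L2 l f \<longrightarrow> cmod (l2_inner l f (\<lambda>x. complex_of_real (q x) * f x)) \<le> K * l2_sq l f"
proof -
  obtain K where K: "0 \<le> K" "AE x in lebesgue_on {0..l}. cmod (complex_of_real (q x)) \<le> K"
    using Linf_bound[OF assms] by blast
  have "cmod (l2_inner l f (\<lambda>x. complex_of_real (q x) * f x)) \<le> K * l2_sq l f" if f: "L2 l f" for f
  proof (rule power2_le_imp_le)
    have "(cmod (l2_inner l f (\<lambda>x. complex_of_real (q x) * f x)))\<^sup>2 \<le> l2_sq l f * (K\<^sup>2 * l2_sq l f)"
      by (intro order_trans[OF l2_Cauchy_Schwarz[OF f L2_potential[OF assms f]]] mult_left_mono
          l2_sq_bounded_mult[OF Linf_bound(1)[OF assms] f K(2)] l2_sq_nonneg)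
    then show "(cmod (l2_inner l f (\<lambda>x. complex_of_real (q x) * f x)))\<^sup>2 \<le> (K * l2_sq l f)\<^sup>2"
      by (simp add: power2_eq_square mult_ac)
  qed (use K l2_sq_nonneg in auto)
  then show ?thesis using K(1) by blast
qed

text \<open>
  The existence of an edge makes the form domain infinite-dimensional.
\<close>

locale quantum_graph =
  fixes G :: "('v, 'e) mgraph" and q :: "'e \<Rightarrow> real \<Rightarrow> real" and A B :: "'v \<Rightarrow> ('e \<times> bool) matr"
  assumes graph: "compact_metric_graph G"
    and potential: "\<And>e. e \<in> edges G \<Longrightarrow> Linf (len G e) (q e)"
    and B_hermitian: "\<And>v x y. v \<in> verts G \<Longrightarrow>
          inner_on (ends_at G v) y (app (ends_at G v) (B v) x) = cnj (inner_on (ends_at G v) x (app (ends_at G v) (B v) y))"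
    and edges_nonempty: "edges G \<noteq> {}"
begin

lemma finite_edges: "finite (edges G)" and finite_verts: "finite (verts G)"
  and len_pos: "e \<in> edges G \<Longrightarrow> 0 < len G e"
  using graph by (auto simp: compact_metric_graph_def)

abbreviation "V \<equiv> form_domain G A"

lemma form_domain_deriv: "p \<in> V \<Longrightarrow> e \<in> edges G \<Longrightarrow> has_L2_deriv (len G e) (fst p e) (snd p e)"
  by (auto simp: form_domain_def)

lemma form_domain_L2:
  assumes "p \<in> V" "e \<in> edges G"
  shows "L2 (len G e) (fst p e)" "L2 (len G e) (snd p e)"
  using form_domain_deriv[OF assms] has_L2_deriv_L2 has_L2_deriv_self_L2 by blast+

lemma form_domain_outside: "p \<in> V \<Longrightarrow> e \<notin> edges G \<or> x \<notin> {0..len G e} \<Longrightarrow> fst p e x = 0 \<and> snd p e x = 0"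
  by (cases p) (simp add: form_domain_def)

lemma form_domain_vertex:
  "p \<in> V \<Longrightarrow> v \<in> verts G \<Longrightarrow> app (ends_at G v) (A v) (bval G (fst p)) = (\<lambda>_. 0)"
  by (auto simp: form_domain_def)

lemma subspace_form_domain: "pairs.subspace V"
proof (rule pairs.subspaceI)
  have "app S M (bval G 0) = (\<lambda>_. 0)" for S M
    using app_scale[of S M 0 "\<lambda>_. 0"] bval_scale[of G 0 0] by (simp add: gscale_def zero_fun_def)
  then show "0 \<in> V" using has_L2_deriv_zero by (simp add: form_domain_def zero_prod_def zero_fun_def)
next
  fix p p' assume p: "p \<in> V" "p' \<in> V"
  have d: "has_L2_deriv (len G e) ((fst p + fst p') e) ((snd p + snd p') e)" if "e \<in> edges G" for e
    using has_L2_deriv_add[OF form_domain_deriv[OF p(1) that] form_domain_deriv[OF p(2) that]]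
    by (simp add: plus_fun_def)
  have "p + p' = (fst p + fst p', snd p + snd p')" by (simp add: plus_prod_def)
  also have "\<dots> \<in> V"
    unfolding form_domain_def mem_Collect_eq split
    using p d by (auto simp: bval_add app_add form_domain_outside form_domain_vertex)
  finally show "p + p' \<in> V" .
next
  fix c p assume p: "p \<in> V"
  have d: "has_L2_deriv (len G e) (gscale c (fst p) e) (gscale c (snd p) e)" if "e \<in> edges G" for e
    using has_L2_deriv_scale[OF form_domain_deriv[OF p that]] by (simp add: gscale_def)
  show "pscale c p \<in> V"
    unfolding form_domain_def mem_Collect_eq pscale_def split
    using p d form_domain_outside[OF p]
    by (simp add: bval_scale app_scale form_domain_vertex) (auto simp: gscale_def)
qed

lemma form_domain_closed:
  "p \<in> V \<Longrightarrow> p' \<in> V \<Longrightarrow> p + p' \<in> V" "p \<in> V \<Longrightarrow> p' \<in> V \<Longrightarrow> p - p' \<in> V" "p \<in> V \<Longrightarrow> pscale c p \<in> V"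
  using subspace_form_domain pairs.subspace_add pairs.subspace_diff pairs.subspace_scale by blast+

lemma fst_pscale: "fst (pscale c p) e = fscale c (fst p e)" and snd_pscale: "snd (pscale c p) e = fscale c (snd p e)"
  by (simp_all add: pscale_def gscale_def fscale_def)

lemma graph_inner_psd: "pairs.psd_on V (graph_inner G)"
  unfolding pairs.psd_on_def pairs.hermitian_on_def
proof (intro conjI ballI allI)
  fix p p' p'' assume "p \<in> V" "p' \<in> V" "p'' \<in> V"
  then show "graph_inner G p (p' + p'') = graph_inner G p p' + graph_inner G p p''"
    unfolding graph_inner_def sum.distrib[symmetric]
    by (intro sum.cong) (auto simp: form_domain_L2 funs.hermitian_add_right[OF l2_hermitian])
next
  fix p p' c assume "p \<in> V" "p' \<in> V"
  then show "graph_inner G p (pscale c p') = c * graph_inner G p p'"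
    unfolding graph_inner_def sum_distrib_left fst_pscale
    by (intro sum.cong) (auto simp: form_domain_L2 funs.hermitian_scale_right[OF l2_hermitian])
next
  fix p p' assume p: "p \<in> V" "p' \<in> V"
  show "graph_inner G p' p = cnj (graph_inner G p p')"
    unfolding graph_inner_def cnj_sum
    by (rule sum.cong[OF refl], rule funs.hermitian_swap[OF l2_hermitian]) (use p form_domain_L2 in auto)
qed (auto simp: subspace_form_domain graph_inner_self graph_mass_nonneg)

lemma potential_form_add:
  assumes "e \<in> edges G" "L2 (len G e) f" "L2 (len G e) g" "L2 (len G e) g'"
  shows "l2_inner (len G e) f (\<lambda>x. complex_of_real (q e x) * (g + g') x) =
    l2_inner (len G e) f (\<lambda>x. complex_of_real (q e x) * g x) + l2_inner (len G e) f (\<lambda>x. complex_of_real (q e x) * g' x)"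
proof -
  have "(\<lambda>x. complex_of_real (q e x) * (g + g') x) =
      (\<lambda>x. complex_of_real (q e x) * g x) + (\<lambda>x. complex_of_real (q e x) * g' x)"
    by (simp add: fun_eq_iff distrib_left)
  then show ?thesis
    using funs.hermitian_add_right[OF l2_hermitian, of f "len G e"] assms potential L2_potential by simp
qed

lemma potential_form_scale:
  assumes "e \<in> edges G" "L2 (len G e) f" "L2 (len G e) g"
  shows "l2_inner (len G e) f (\<lambda>x. complex_of_real (q e x) * fscale c g x) =
    c * l2_inner (len G e) f (\<lambda>x. complex_of_real (q e x) * g x)"
proof -
  have "(\<lambda>x. complex_of_real (q e x) * fscale c g x) = fscale c (\<lambda>x. complex_of_real (q e x) * g x)"
    by (simp add: fscale_def fun_eq_iff mult.left_commute)
  then show ?thesis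
    using funs.hermitian_scale_right[OF l2_hermitian, of f "len G e"] assms potential L2_potential by simp
qed

lemma potential_form_swap:
  assumes "e \<in> edges G" "L2 (len G e) f" "L2 (len G e) g"
  shows "l2_inner (len G e) g (\<lambda>x. complex_of_real (q e x) * f x) =
    cnj (l2_inner (len G e) f (\<lambda>x. complex_of_real (q e x) * g x))"
proof -
  have "l2_inner (len G e) g (\<lambda>x. complex_of_real (q e x) * f x) =
      l2_inner (len G e) (\<lambda>x. complex_of_real (q e x) * g x) f"
    unfolding l2_inner_def by (rule Bochner_Integration.integral_cong) auto
  also have "\<dots> = cnj (l2_inner (len G e) f (\<lambda>x. complex_of_real (q e x) * g x))"
    by (rule funs.hermitian_swap[OF l2_hermitian]) (use assms potential L2_potential in auto)
  finally show ?thesis .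
qed

lemma graph_form_hermitian: "pairs.hermitian_on V (graph_form G q B)"
  unfolding pairs.hermitian_on_def
proof (intro conjI ballI allI)
  fix p p' p'' assume p: "p \<in> V" "p' \<in> V" "p'' \<in> V"
  have "(\<Sum>e\<in>edges G. l2_inner (len G e) (snd p e) (snd (p' + p'') e)) =
      (\<Sum>e\<in>edges G. l2_inner (len G e) (snd p e) (snd p' e)) + (\<Sum>e\<in>edges G. l2_inner (len G e) (snd p e) (snd p'' e))"
    unfolding sum.distrib[symmetric] using p
    by (intro sum.cong) (auto simp: form_domain_L2 funs.hermitian_add_right[OF l2_hermitian])
  moreover have "(\<Sum>e\<in>edges G. l2_inner (len G e) (fst p e) (\<lambda>x. complex_of_real (q e x) * fst (p' + p'') e x)) =
      (\<Sum>e\<in>edges G. l2_inner (len G e) (fst p e) (\<lambda>x. complex_of_real (q e x) * fst p' e x)) +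
      (\<Sum>e\<in>edges G. l2_inner (len G e) (fst p e) (\<lambda>x. complex_of_real (q e x) * fst p'' e x))"
    unfolding sum.distrib[symmetric] fst_add plus_fun_apply[of "fst p'"] using p
    by (intro sum.cong potential_form_add) (auto simp: form_domain_L2)
  moreover have "boundary_form G B (bval G (fst p)) (bval G (fst (p' + p''))) =
      boundary_form G B (bval G (fst p)) (bval G (fst p')) + boundary_form G B (bval G (fst p)) (bval G (fst p''))"
    by (simp add: bval_add boundary_form_add)
  ultimately show "graph_form G q B p (p' + p'') = graph_form G q B p p' + graph_form G q B p p''"
    by (simp add: graph_form_def)
next
  fix p p' c assume p: "p \<in> V" "p' \<in> V"
  have "(\<Sum>e\<in>edges G. l2_inner (len G e) (snd p e) (snd (pscale c p') e)) =
      c * (\<Sum>e\<in>edges G. l2_inner (len G e) (snd p e) (snd p' e))"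
    unfolding sum_distrib_left snd_pscale using p
    by (intro sum.cong) (auto simp: form_domain_L2 funs.hermitian_scale_right[OF l2_hermitian])
  moreover have "(\<Sum>e\<in>edges G. l2_inner (len G e) (fst p e) (\<lambda>x. complex_of_real (q e x) * fst (pscale c p') e x)) =
      c * (\<Sum>e\<in>edges G. l2_inner (len G e) (fst p e) (\<lambda>x. complex_of_real (q e x) * fst p' e x))"
    unfolding sum_distrib_left fst_pscale using p
    by (intro sum.cong potential_form_scale) (auto simp: form_domain_L2)
  moreover have "boundary_form G B (bval G (fst p)) (bval G (fst (pscale c p'))) =
      c * boundary_form G B (bval G (fst p)) (bval G (fst p'))"
    by (simp add: pscale_def bval_scale boundary_form_scale)
  ultimately show "graph_form G q B p (pscale c p') = c * graph_form G q B p p'"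
    by (simp add: graph_form_def distrib_left)
next
  fix p p' assume p: "p \<in> V" "p' \<in> V"
  have "(\<Sum>e\<in>edges G. l2_inner (len G e) (snd p' e) (snd p e)) =
      cnj (\<Sum>e\<in>edges G. l2_inner (len G e) (snd p e) (snd p' e))"
    unfolding cnj_sum
    by (rule sum.cong[OF refl], rule funs.hermitian_swap[OF l2_hermitian]) (use p form_domain_L2 in auto)
  moreover have "(\<Sum>e\<in>edges G. l2_inner (len G e) (fst p' e) (\<lambda>x. complex_of_real (q e x) * fst p e x)) =
      cnj (\<Sum>e\<in>edges G. l2_inner (len G e) (fst p e) (\<lambda>x. complex_of_real (q e x) * fst p' e x))"
    unfolding cnj_sum by (rule sum.cong[OF refl], rule potential_form_swap) (use p form_domain_L2 in auto)
  moreover have "boundary_form G B Y F = cnj (boundary_form G B F Y)" for Y F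
    unfolding boundary_form_def cnj_sum by (rule sum.cong[OF refl], rule B_hermitian)
  ultimately show "graph_form G q B p' p = cnj (graph_form G q B p p')"
    unfolding graph_form_def complex_cnj_add by metis
qed (rule subspace_form_domain)

text \<open>
  The form controls the derivative: up to a multiple of the mass, the potential and the boundary
  values cost at most half of the kinetic energy.
\<close>

lemma graph_form_estimate:
  "\<exists>c\<ge>0. \<forall>p\<in>V. \<bar>Re (graph_form G q B p p) - graph_mass G (snd p)\<bar> \<le> graph_mass G (snd p) / 2 + c * graph_mass G (fst p)"
proof -
  obtain b where b: "0 \<le> b" "\<And>F. cmod (boundary_form G B F F) \<le> b * (\<Sum>e\<in>edges G. (cmod (F (e, False)))\<^sup>2 + (cmod (F (e, True)))\<^sup>2)"
    using boundary_form_bound[OF graph] by blast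
  have "\<forall>e\<in>edges G. \<exists>K\<ge>0. \<forall>f. L2 (len G e) f \<longrightarrow>
      cmod (l2_inner (len G e) f (\<lambda>x. complex_of_real (q e x) * f x)) \<le> K * l2_sq (len G e) f"
    using potential_bound potential by blast
  then obtain K where K: "\<And>e. e \<in> edges G \<Longrightarrow> 0 \<le> K e"
    "\<And>e f. e \<in> edges G \<Longrightarrow> L2 (len G e) f \<Longrightarrow>
      cmod (l2_inner (len G e) f (\<lambda>x. complex_of_real (q e x) * f x)) \<le> K e * l2_sq (len G e) f"
    by metis
  define d where "d = min (1 / (8 * (b + 1))) (Min (len G ` edges G))"
  have d0: "0 < d"
    unfolding d_def using b(1) len_pos finite_edges edges_nonempty by (auto simp: Min_gr_iff)
  have d_len: "d \<le> len G e" if "e \<in> edges G" for e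
    unfolding d_def using that finite_edges by (auto intro: min.coboundedI2)
  have d_b: "4 * b * d \<le> 1 / 2"
  proof -
    have "4 * b * d \<le> 4 * b * (1 / (8 * (b + 1)))" unfolding d_def using b(1) by (intro mult_left_mono) auto
    also have "\<dots> \<le> 1 / 2" using b(1) by (simp add: field_simps)
    finally show ?thesis .
  qed
  define c where "c = sum K (edges G) + b * (4 / d)"
  have "0 \<le> c" unfolding c_def using K(1) b(1) d0 by (auto intro!: add_nonneg_nonneg sum_nonneg)
  moreover have "\<bar>Re (graph_form G q B p p) - graph_mass G (snd p)\<bar> \<le> graph_mass G (snd p) / 2 + c * graph_mass G (fst p)"
    if p: "p \<in> V" for p
  proof -
    let ?N = "graph_mass G (fst p)" and ?D = "graph_mass G (snd p)" and ?F = "bval G (fst p)"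
    let ?Q = "\<Sum>e\<in>edges G. l2_inner (len G e) (fst p e) (\<lambda>x. complex_of_real (q e x) * fst p e x)"
    have "graph_form G q B p p = of_real ?D + ?Q + boundary_form G B ?F ?F"
      by (simp add: graph_form_def graph_mass_def l2_inner_self)
    then have "\<bar>Re (graph_form G q B p p) - ?D\<bar> = \<bar>Re (?Q + boundary_form G B ?F ?F)\<bar>" by simp
    also have "\<dots> \<le> cmod (?Q + boundary_form G B ?F ?F)" by (rule abs_Re_le_cmod)
    also have "\<dots> \<le> cmod ?Q + cmod (boundary_form G B ?F ?F)" by (rule norm_triangle_ineq)
    also have "cmod ?Q \<le> sum K (edges G) * ?N"
    proof -
      have "cmod ?Q \<le> (\<Sum>e\<in>edges G. K e * l2_sq (len G e) (fst p e))"
        by (rule order_trans[OF norm_sum], rule sum_mono, rule K(2)) (use form_domain_L2[OF p] in auto)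
      also have "\<dots> \<le> (\<Sum>e\<in>edges G. sum K (edges G) * l2_sq (len G e) (fst p e))"
        using K(1) finite_edges by (intro sum_mono mult_right_mono member_le_sum l2_sq_nonneg) auto
      finally show ?thesis by (simp only: graph_mass_def sum_distrib_left)
    qed
    also have "cmod (boundary_form G B ?F ?F) \<le> b * (4 / d * ?N + 4 * d * ?D)"
    proof (rule order_trans[OF b(2)], rule mult_left_mono[OF _ b(1)])
      have "(cmod (fst p e x))\<^sup>2 \<le> 2 / d * l2_sq (len G e) (fst p e) + 2 * d * l2_sq (len G e) (snd p e)"
        if "e \<in> edges G" "x \<in> {0..len G e}" for e x
        by (rule has_L2_deriv_sup_bound[OF form_domain_deriv[OF p that(1)] d0 d_len[OF that(1)] that(2)])
      then have "(\<Sum>e\<in>edges G. (cmod (?F (e, False)))\<^sup>2 + (cmod (?F (e, True)))\<^sup>2) \<le>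
          (\<Sum>e\<in>edges G. (2 / d * l2_sq (len G e) (fst p e) + 2 * d * l2_sq (len G e) (snd p e)) +
             (2 / d * l2_sq (len G e) (fst p e) + 2 * d * l2_sq (len G e) (snd p e)))"
        using len_pos by (intro sum_mono add_mono) (auto simp: bval_def less_imp_le)
      also have "\<dots> = (\<Sum>e\<in>edges G. 4 / d * l2_sq (len G e) (fst p e) + 4 * d * l2_sq (len G e) (snd p e))"
        by (rule sum.cong) auto
      also have "\<dots> = 4 / d * ?N + 4 * d * ?D" by (simp only: sum.distrib graph_mass_def sum_distrib_left)
      finally show "(\<Sum>e\<in>edges G. (cmod (?F (e, False)))\<^sup>2 + (cmod (?F (e, True)))\<^sup>2) \<le> 4 / d * ?N + 4 * d * ?D" .
    qed
    also have "b * (4 / d * ?N + 4 * d * ?D) \<le> b * (4 / d) * ?N + ?D / 2"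
      using mult_right_mono[OF d_b graph_mass_nonneg[of G "snd p"]] by (simp add: algebra_simps)
    finally show ?thesis by (simp add: c_def algebra_simps)
  qed
  ultimately show ?thesis by blast
qed

end

section \<open>Closedness and compactness of the graph form\<close>

text \<open>
  Used for the edges of a graph, whose functions converge along subsequences chosen one edge at a
  time.
\<close>

lemma common_subsequence:
  assumes "finite E"
    and ex: "\<And>e r. e \<in> E \<Longrightarrow> strict_mono (r :: nat \<Rightarrow> nat) \<Longrightarrow> \<exists>s. strict_mono s \<and> P e (r \<circ> s)"
    and mono: "\<And>e r s. P e r \<Longrightarrow> strict_mono s \<Longrightarrow> P e (r \<circ> s)"
  shows "\<exists>r. strict_mono (r :: nat \<Rightarrow> nat) \<and> (\<forall>e\<in>E. P e r)"
  using assms(1) ex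
proof (induction E rule: finite_induct)
  case empty
  show ?case by (rule exI[of _ id]) (simp add: strict_mono_def)
next
  case (insert e E)
  obtain r where r: "strict_mono r" "\<forall>e\<in>E. P e r" using insert.IH insert.prems by auto
  obtain s where s: "strict_mono s" "P e (r \<circ> s)" using insert.prems[of e r, OF insertI1 r(1)] by blast
  have "\<forall>e\<in>E. P e (r \<circ> s)" using r(2) s(1) mono by blast
  then show ?case using s strict_mono_o[OF r(1) s(1)] by blast
qed

lemma gfun_sum_apply: "(\<Sum>j\<in>I. f j :: 'e gfun) e x = (\<Sum>j\<in>I. f j e x)"
  by (induction I rule: infinite_finite_induct) auto

lemma l2_sq_cong: "(\<And>x. x \<in> {0..l} \<Longrightarrow> f x = g x) \<Longrightarrow> l2_sq l f = l2_sq l g"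
  unfolding l2_sq_def by (rule Bochner_Integration.integral_cong) auto

lemma has_L2_deriv_poly:
  "has_L2_deriv l (\<lambda>x. poly p (complex_of_real x)) (\<lambda>x. poly (pderiv p) (complex_of_real x))"
proof (rule has_L2_deriv_C1)
  fix x :: real
  have "(poly p has_field_derivative poly (pderiv p) (of_real x)) (at (of_real x) within of_real ` {0..l})"
    by (rule has_field_derivative_at_within[OF poly_DERIV])
  moreover have "(complex_of_real has_vector_derivative 1) (at x within {0..l})"
    unfolding has_vector_derivative_def by (auto intro!: derivative_eq_intros simp: scaleR_conv_of_real)
  ultimately show "((\<lambda>x. poly p (complex_of_real x)) has_vector_derivative poly (pderiv p) (complex_of_real x)) (at x within {0..l})"
    using field_vector_diff_chain_within[of complex_of_real 1 x "{0..l}" "poly p"] by (simp add: o_def)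
qed (intro continuous_intros)

context quantum_graph
begin

lemma graph_form_coercive:
  obtains c where "0 \<le> c"
    and "\<And>p. p \<in> V \<Longrightarrow> graph_mass G (snd p) \<le> 2 * (Re (graph_form G q B p p) + c * graph_mass G (fst p))"
    and "\<And>p. p \<in> V \<Longrightarrow> \<bar>Re (graph_form G q B p p)\<bar> \<le> 2 * graph_mass G (snd p) + c * graph_mass G (fst p)"
proof -
  obtain c where c: "0 \<le> c" "\<And>p. p \<in> V \<Longrightarrow>
      \<bar>Re (graph_form G q B p p) - graph_mass G (snd p)\<bar> \<le> graph_mass G (snd p) / 2 + c * graph_mass G (fst p)"
    using graph_form_estimate by blast
  have "\<bar>Re (graph_form G q B p p)\<bar> \<le> 2 * graph_mass G (snd p) + c * graph_mass G (fst p)"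
    "graph_mass G (snd p) \<le> 2 * (Re (graph_form G q B p p) + c * graph_mass G (fst p))" if "p \<in> V" for p
    using c(2)[OF that] graph_mass_nonneg[of G "snd p"] unfolding distrib_left by linarith+
  then show ?thesis using that c(1) by blast
qed

lemma l2_sq_le_graph_mass: "e \<in> edges G \<Longrightarrow> l2_sq (len G e) (f e) \<le> graph_mass G f"
  unfolding graph_mass_def using finite_edges by (intro member_le_sum) (auto simp: l2_sq_nonneg)

lemma graph_mass_small:
  assumes "\<And>e d. e \<in> edges G \<Longrightarrow> 0 < d \<Longrightarrow> \<exists>N. \<forall>m\<ge>N. \<forall>n\<ge>N. l2_sq (len G e) (\<lambda>x. f m e x - f n e x) < d"
    and d: "0 < d"
  shows "\<exists>N. \<forall>m\<ge>(N::nat). \<forall>n\<ge>N. graph_mass G (f m - f n) < d"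
proof -
  let ?c = "real (card (edges G))"
  have c: "0 < ?c" using finite_edges edges_nonempty by (simp add: card_gt_0_iff)
  have "\<forall>e\<in>edges G. \<exists>N. \<forall>m\<ge>N. \<forall>n\<ge>N. l2_sq (len G e) (\<lambda>x. f m e x - f n e x) < d / ?c"
    using assms(1) d c by auto
  then obtain N where N: "\<And>e m n. e \<in> edges G \<Longrightarrow> m \<ge> N e \<Longrightarrow> n \<ge> N e \<Longrightarrow>
      l2_sq (len G e) (\<lambda>x. f m e x - f n e x) < d / ?c" by metis
  have "graph_mass G (f m - f n) < d" if "m \<ge> Max (N ` edges G)" "n \<ge> Max (N ` edges G)" for m n
  proof -
    have "graph_mass G (f m - f n) < (\<Sum>e\<in>edges G. d / ?c)"
      unfolding graph_mass_def
    proof (rule sum_strict_mono[OF finite_edges edges_nonempty])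
      fix e assume e: "e \<in> edges G"
      then have "N e \<le> Max (N ` edges G)" using finite_edges by simp
      then have "l2_sq (len G e) (\<lambda>x. f m e x - f n e x) < d / ?c" using N[OF e] that by simp
      then show "l2_sq (len G e) ((f m - f n) e) < d / ?c" by (simp add: fun_diff_def)
    qed
    also have "\<dots> = d" using c by simp
    finally show ?thesis .
  qed
  then show ?thesis by blast
qed

lemma form_domain_compact:
  assumes X: "\<And>n. X n \<in> V" and N: "\<And>n. Re (graph_inner G (X n) (X n)) \<le> K"
    and a: "\<And>n. Re (graph_form G q B (X n) (X n)) \<le> K"
  shows "\<exists>r. strict_mono (r :: nat \<Rightarrow> nat) \<and> pairs.cauchy_for (graph_inner G) (X \<circ> r)"
proof -
  obtain c where c: "0 \<le> c" "\<And>p. p \<in> V \<Longrightarrow>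
      graph_mass G (snd p) \<le> 2 * (Re (graph_form G q B p p) + c * graph_mass G (fst p))"
    by (rule graph_form_coercive) (rule that)
  have m: "graph_mass G (fst (X n)) \<le> K" for n using N[of n] by (simp add: graph_inner_self)
  then have K0: "0 \<le> K" using graph_mass_nonneg order_trans by blast
  define K' where "K' = 2 * (K + c * K)"
  have K': "K \<le> K'" unfolding K'_def using K0 c(1) by (simp add: add_increasing2)
  have D: "graph_mass G (snd (X n)) \<le> K'" for n
    unfolding K'_def using order_trans[OF c(2)[OF X[of n]]]
      mult_left_mono[OF add_mono[OF a[of n] mult_left_mono[OF m[of n] c(1)]], of 2] by simp
  define P where "P = (\<lambda>e (r :: nat \<Rightarrow> nat). \<forall>d>0. \<exists>N. \<forall>m\<ge>N. \<forall>n\<ge>N.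
      l2_sq (len G e) (\<lambda>x. fst (X (r m)) e x - fst (X (r n)) e x) < d)"
  have "\<exists>r. strict_mono (r :: nat \<Rightarrow> nat) \<and> (\<forall>e\<in>edges G. P e r)"
  proof (rule common_subsequence[OF finite_edges])
    fix e and r :: "nat \<Rightarrow> nat" assume e: "e \<in> edges G"
    have "\<exists>s. strict_mono (s :: nat \<Rightarrow> nat) \<and> (\<forall>d>0. \<exists>N. \<forall>m\<ge>N. \<forall>n\<ge>N.
        l2_sq (len G e) (\<lambda>x. fst (X (r (s m))) e x - fst (X (r (s n))) e x) < d)"
    proof (rule has_L2_deriv_compact[OF len_pos[OF e], where K = K'])
      show "has_L2_deriv (len G e) (fst (X (r n)) e) (snd (X (r n)) e)" for n
        by (rule form_domain_deriv[OF X e])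
      show "l2_sq (len G e) (fst (X (r n)) e) \<le> K'" for n
        using l2_sq_le_graph_mass[OF e, of "fst (X (r n))"] m[of "r n"] K' by linarith
      show "l2_sq (len G e) (snd (X (r n)) e) \<le> K'" for n
        using l2_sq_le_graph_mass[OF e, of "snd (X (r n))"] D[of "r n"] by linarith
    qed
    then show "\<exists>s. strict_mono s \<and> P e (r \<circ> s)" by (simp add: P_def)
  next
    fix e r and s :: "nat \<Rightarrow> nat" assume P: "P e r" and s: "strict_mono s"
    show "P e (r \<circ> s)"
      unfolding P_def
    proof (intro allI impI)
      fix d :: real assume "0 < d"
      then obtain N where N: "\<forall>m\<ge>N. \<forall>n\<ge>N. l2_sq (len G e) (\<lambda>x. fst (X (r m)) e x - fst (X (r n)) e x) < d"
        using P unfolding P_def by blast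
      have "n \<le> s n" for n by (rule seq_suble[OF s])
      then show "\<exists>N. \<forall>m\<ge>N. \<forall>n\<ge>N. l2_sq (len G e) (\<lambda>x. fst (X ((r \<circ> s) m)) e x - fst (X ((r \<circ> s) n)) e x) < d"
        using N by (intro exI[of _ N]) (auto intro: order_trans)
    qed
  qed
  then obtain r where r: "strict_mono (r :: nat \<Rightarrow> nat)" "\<And>e. e \<in> edges G \<Longrightarrow> P e r" by blast
  have "\<exists>N. \<forall>m\<ge>N. \<forall>n\<ge>N. graph_mass G (fst (X (r m)) - fst (X (r n))) < d" if "0 < d" for d
    using graph_mass_small[of "\<lambda>n. fst (X (r n))" d] r(2) that unfolding P_def by blast
  then have "pairs.cauchy_for (graph_inner G) (X \<circ> r)"
    by (simp add: pairs.cauchy_for_def graph_inner_self)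
  then show ?thesis using r(1) by blast
qed

text \<open>
  The limit is taken edge by edge. It satisfies the essential vertex conditions because the trace
  estimate makes boundary values continuous in the energy norm.
\<close>

lemma form_domain_complete:
  assumes X: "\<And>n. X n \<in> V" and cN: "pairs.cauchy_for (graph_inner G) X"
    and ca: "pairs.cauchy_for (graph_form G q B) X"
  shows "\<exists>p\<in>V. (\<lambda>n. Re (graph_inner G (X n - p) (X n - p))) \<longlonglongrightarrow> 0 \<and>
    (\<lambda>n. Re (graph_form G q B (X n - p) (X n - p))) \<longlonglongrightarrow> 0"
proof -
  obtain c where c: "0 \<le> c"
    and co: "\<And>p. p \<in> V \<Longrightarrow> graph_mass G (snd p) \<le> 2 * (Re (graph_form G q B p p) + c * graph_mass G (fst p))"
    and up: "\<And>p. p \<in> V \<Longrightarrow> \<bar>Re (graph_form G q B p p)\<bar> \<le> 2 * graph_mass G (snd p) + c * graph_mass G (fst p)"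
    by (rule graph_form_coercive) (rule that)
  have XX: "X m - X n \<in> V" for m n using X form_domain_closed by blast
  have cm: "\<exists>N. \<forall>m\<ge>N. \<forall>n\<ge>N. graph_mass G (fst (X m - X n)) < d" if "0 < d" for d
    using cN that by (simp add: pairs.cauchy_for_def graph_inner_self)
  have cd: "\<exists>N. \<forall>m\<ge>N. \<forall>n\<ge>N. graph_mass G (snd (X m - X n)) < d" if d: "0 < d" for d
  proof -
    have d': "0 < d / (4 * (c + 1))" using d c by simp
    obtain N1 where N1: "\<forall>m\<ge>N1. \<forall>n\<ge>N1. graph_mass G (fst (X m - X n)) < d / (4 * (c + 1))" using cm[OF d'] by blast
    have "0 < d / 4" using d by simp
    then obtain N2 where N2: "\<forall>m\<ge>N2. \<forall>n\<ge>N2. Re (graph_form G q B (X m - X n) (X m - X n)) < d / 4"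
      using ca unfolding pairs.cauchy_for_def by blast
    have "graph_mass G (snd (X m - X n)) < d" if "m \<ge> max N1 N2" "n \<ge> max N1 N2" for m n
    proof -
      have "graph_mass G (fst (X m - X n)) < d / (4 * (c + 1))"
        and a: "Re (graph_form G q B (X m - X n) (X m - X n)) < d / 4" using N1 N2 that by auto
      then have "c * graph_mass G (fst (X m - X n)) \<le> c * (d / (4 * (c + 1)))"
        using c by (intro mult_left_mono) auto
      also have "\<dots> \<le> d / 4" using c d by (simp add: field_simps)
      finally have "Re (graph_form G q B (X m - X n) (X m - X n)) + c * graph_mass G (fst (X m - X n)) < d / 4 + d / 4"
        using a by (rule add_less_le_mono[rotated])
      from mult_strict_left_mono[OF this, of 2] show ?thesis using co[OF XX, of m n] by simp
    qed
    then show ?thesis by blast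
  qed
  have "\<forall>e\<in>edges G. \<exists>F h. has_L2_deriv (len G e) F h \<and>
      (\<lambda>n. l2_sq (len G e) (\<lambda>x. fst (X n) e x - F x)) \<longlonglongrightarrow> 0 \<and>
      (\<lambda>n. l2_sq (len G e) (\<lambda>x. snd (X n) e x - h x)) \<longlonglongrightarrow> 0"
  proof
    fix e assume e: "e \<in> edges G"
    show "\<exists>F h. has_L2_deriv (len G e) F h \<and>
      (\<lambda>n. l2_sq (len G e) (\<lambda>x. fst (X n) e x - F x)) \<longlonglongrightarrow> 0 \<and>
      (\<lambda>n. l2_sq (len G e) (\<lambda>x. snd (X n) e x - h x)) \<longlonglongrightarrow> 0"
    proof (rule has_L2_deriv_complete[OF len_pos[OF e]])
      show "has_L2_deriv (len G e) (fst (X n) e) (snd (X n) e)" for n by (rule form_domain_deriv[OF X e])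
    next
      fix d :: real assume "0 < d"
      then obtain N where N: "\<forall>m\<ge>N. \<forall>n\<ge>N. graph_mass G (fst (X m - X n)) < d" using cm by blast
      have "l2_sq (len G e) (\<lambda>x. fst (X m) e x - fst (X n) e x) \<le> graph_mass G (fst (X m - X n))" for m n
        using l2_sq_le_graph_mass[OF e, of "fst (X m - X n)"] by (simp add: fun_diff_def)
      then show "\<exists>N. \<forall>m\<ge>N. \<forall>n\<ge>N. l2_sq (len G e) (\<lambda>x. fst (X m) e x - fst (X n) e x) < d"
        using N by (meson le_less_trans)
    next
      fix d :: real assume "0 < d"
      then obtain N where N: "\<forall>m\<ge>N. \<forall>n\<ge>N. graph_mass G (snd (X m - X n)) < d" using cd by blast
      have "l2_sq (len G e) (\<lambda>x. snd (X m) e x - snd (X n) e x) \<le> graph_mass G (snd (X m - X n))" for m n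
        using l2_sq_le_graph_mass[OF e, of "snd (X m - X n)"] by (simp add: fun_diff_def)
      then show "\<exists>N. \<forall>m\<ge>N. \<forall>n\<ge>N. l2_sq (len G e) (\<lambda>x. snd (X m) e x - snd (X n) e x) < d"
        using N by (meson le_less_trans)
    qed
  qed
  from bchoice[OF this] obtain F where "\<forall>e\<in>edges G. \<exists>h. has_L2_deriv (len G e) (F e) h \<and>
      (\<lambda>n. l2_sq (len G e) (\<lambda>x. fst (X n) e x - F e x)) \<longlonglongrightarrow> 0 \<and>
      (\<lambda>n. l2_sq (len G e) (\<lambda>x. snd (X n) e x - h x)) \<longlonglongrightarrow> 0" by (rule exE)
  from bchoice[OF this] obtain h where "\<forall>e\<in>edges G. has_L2_deriv (len G e) (F e) (h e) \<and>
      (\<lambda>n. l2_sq (len G e) (\<lambda>x. fst (X n) e x - F e x)) \<longlonglongrightarrow> 0 \<and>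
      (\<lambda>n. l2_sq (len G e) (\<lambda>x. snd (X n) e x - h e x)) \<longlonglongrightarrow> 0" by (rule exE)
  then have Fh: "\<And>e. e \<in> edges G \<Longrightarrow> has_L2_deriv (len G e) (F e) (h e)"
    and limF: "\<And>e. e \<in> edges G \<Longrightarrow> (\<lambda>n. l2_sq (len G e) (\<lambda>x. fst (X n) e x - F e x)) \<longlonglongrightarrow> 0"
    and limh: "\<And>e. e \<in> edges G \<Longrightarrow> (\<lambda>n. l2_sq (len G e) (\<lambda>x. snd (X n) e x - h e x)) \<longlonglongrightarrow> 0"
    by blast+
  define f where "f e x = (if e \<in> edges G \<and> x \<in> {0..len G e} then F e x else 0)" for e x
  define g where "g e x = (if e \<in> edges G \<and> x \<in> {0..len G e} then h e x else 0)" for e x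
  have fg: "has_L2_deriv (len G e) (f e) (g e)" if "e \<in> edges G" for e
    by (rule has_L2_deriv_cong[OF Fh[OF that]]) (simp_all add: f_def g_def that)
  have limf: "(\<lambda>n. l2_sq (len G e) (\<lambda>x. fst (X n) e x - f e x)) \<longlonglongrightarrow> 0" if e: "e \<in> edges G" for e
  proof -
    have "l2_sq (len G e) (\<lambda>x. fst (X n) e x - f e x) = l2_sq (len G e) (\<lambda>x. fst (X n) e x - F e x)" for n
      by (rule l2_sq_cong) (simp add: f_def e)
    then show ?thesis using limF[OF e] by (simp only:)
  qed
  have limg: "(\<lambda>n. l2_sq (len G e) (\<lambda>x. snd (X n) e x - g e x)) \<longlonglongrightarrow> 0" if e: "e \<in> edges G" for e
  proof -
    have "l2_sq (len G e) (\<lambda>x. snd (X n) e x - g e x) = l2_sq (len G e) (\<lambda>x. snd (X n) e x - h e x)" for n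
      by (rule l2_sq_cong) (simp add: g_def e)
    then show ?thesis using limh[OF e] by (simp only:)
  qed
  have point: "(\<lambda>n. fst (X n) e x) \<longlonglongrightarrow> f e x" if e: "e \<in> edges G" and x: "x \<in> {0..len G e}" for e x
  proof -
    let ?r = "\<lambda>n. sqrt (2 / len G e * l2_sq (len G e) (\<lambda>x. fst (X n) e x - f e x) +
        2 * len G e * l2_sq (len G e) (\<lambda>x. snd (X n) e x - g e x))"
    have "?r \<longlonglongrightarrow> sqrt (2 / len G e * 0 + 2 * len G e * 0)"
      by (intro tendsto_intros limf[OF e] limg[OF e])
    then have r: "?r \<longlonglongrightarrow> 0" by simp
    have le: "norm (fst (X n) e x - f e x) \<le> ?r n" for n
      using has_L2_deriv_sup_bound[OF has_L2_deriv_diff[OF form_domain_deriv[OF X e] fg[OF e]] len_pos[OF e] order_refl x]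
      by (intro real_le_rsqrt)
    have "(\<lambda>n. fst (X n) e x - f e x) \<longlonglongrightarrow> 0"
      by (rule Lim_null_comparison[OF always_eventually r]) (rule allI, rule le)
    then show ?thesis by (simp add: LIM_zero_iff)
  qed
  have bv: "(\<lambda>n. bval G (fst (X n)) i) \<longlonglongrightarrow> bval G f i" if "fst i \<in> edges G" for i
    using point[OF that, of 0] point[OF that, of "len G (fst i)"] len_pos[OF that]
    by (cases i) (auto simp: bval_def)
  have vert: "app (ends_at G v) (A v) (bval G f) = (\<lambda>_. 0)" if v: "v \<in> verts G" for v
  proof
    fix i
    have "(\<lambda>n. app (ends_at G v) (A v) (bval G (fst (X n))) i) \<longlonglongrightarrow> app (ends_at G v) (A v) (bval G f) i"
    proof (cases "i \<in> ends_at G v")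
      case True
      have "(\<lambda>n. \<Sum>j\<in>ends_at G v. A v i j * bval G (fst (X n)) j) \<longlonglongrightarrow> (\<Sum>j\<in>ends_at G v. A v i j * bval G f j)"
        by (intro tendsto_sum tendsto_mult tendsto_const bv) (auto simp: ends_at_def)
      then show ?thesis using True by (simp add: app_def)
    qed (simp add: app_def)
    then show "app (ends_at G v) (A v) (bval G f) i = 0"
      using form_domain_vertex[OF X v] by (simp add: LIMSEQ_const_iff)
  qed
  have pV: "(f, g) \<in> V"
    unfolding form_domain_def using fg vert by (auto simp: f_def g_def)
  have "(\<lambda>n. graph_mass G (fst (X n - (f, g)))) \<longlonglongrightarrow> (\<Sum>e\<in>edges G. 0)"
    unfolding graph_mass_def using limf by (intro tendsto_sum) (simp add: fun_diff_def)
  then have lim_mass: "(\<lambda>n. graph_mass G (fst (X n - (f, g)))) \<longlonglongrightarrow> 0" by simp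
  have "(\<lambda>n. graph_mass G (snd (X n - (f, g)))) \<longlonglongrightarrow> (\<Sum>e\<in>edges G. 0)"
    unfolding graph_mass_def using limg by (intro tendsto_sum) (simp add: fun_diff_def)
  then have lim_kin: "(\<lambda>n. graph_mass G (snd (X n - (f, g)))) \<longlonglongrightarrow> 0" by simp
  have "(\<lambda>n. 2 * graph_mass G (snd (X n - (f, g))) + c * graph_mass G (fst (X n - (f, g)))) \<longlonglongrightarrow> 2 * 0 + c * 0"
    by (intro tendsto_intros lim_mass lim_kin)
  then have lim: "(\<lambda>n. 2 * graph_mass G (snd (X n - (f, g))) + c * graph_mass G (fst (X n - (f, g)))) \<longlonglongrightarrow> 0" by simp
  have le: "norm (Re (graph_form G q B (X n - (f, g)) (X n - (f, g)))) \<le>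
      2 * graph_mass G (snd (X n - (f, g))) + c * graph_mass G (fst (X n - (f, g)))" for n
    using up[OF form_domain_closed(2)[OF X[of n] pV]] by simp
  have "(\<lambda>n. Re (graph_form G q B (X n - (f, g)) (X n - (f, g)))) \<longlonglongrightarrow> 0"
    by (rule Lim_null_comparison[OF always_eventually lim]) (rule allI, rule le)
  then show ?thesis using pV lim_mass by (intro bexI[of _ "(f, g)"]) (auto simp: graph_inner_self)
qed

lemma graph_mass_eq_0_imp:
  assumes p: "p \<in> V" and null: "graph_mass G (fst p) = 0"
  shows "fst p = 0"
proof -
  have "fst p e x = 0" for e x
  proof (cases "e \<in> edges G \<and> x \<in> {0..len G e}")
    case True
    then have e: "e \<in> edges G" and x: "x \<in> {0..len G e}" by auto
    have "l2_sq (len G e) (fst p e) = 0"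
      using l2_sq_le_graph_mass[OF e, of "fst p"] l2_sq_nonneg[of "len G e" "fst p e"] null by linarith
    then show ?thesis by (rule has_L2_deriv_null[OF len_pos[OF e] form_domain_deriv[OF p e] _ x])
  next
    case False
    then show ?thesis using form_domain_outside[OF p, of e x] by blast
  qed
  then show ?thesis by (simp add: fun_eq_iff)
qed

lemma form_domain_infinite_dimensional:
  "\<exists>w. (\<forall>j\<le>n. w j \<in> V) \<and> (\<forall>c. (\<exists>j\<le>n::nat. c j \<noteq> 0) \<longrightarrow>
      0 < Re (graph_inner G (pairs.lincomb n c w) (pairs.lincomb n c w)))"
proof -
  obtain e0 where e0: "e0 \<in> edges G" using edges_nonempty by blast
  let ?l = "len G e0"
  \<comment> \<open>Polynomials on a single edge that vanish at both ends.\<close>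
  define P where "P j = monom 1 j * ([:0, 1:] * [:- complex_of_real ?l, 1:])" for j :: nat
  define ext where "ext r = (\<lambda>e x. if e = e0 \<and> x \<in> {0..?l} then poly r (complex_of_real x) else 0)" for r :: "complex poly"
  define w where "w j = (ext (P j), ext (pderiv (P j)))" for j
  have w: "w j \<in> V" for j
  proof -
    have "has_L2_deriv (len G e) (ext (P j) e) (ext (pderiv (P j)) e)" if "e \<in> edges G" for e
    proof (cases "e = e0")
      case True
      show ?thesis by (rule has_L2_deriv_cong[OF has_L2_deriv_poly[of _ "P j"]]) (simp_all add: True ext_def)
    next
      case False
      show ?thesis by (rule has_L2_deriv_cong[OF has_L2_deriv_zero]) (simp_all add: False ext_def)
    qed
    moreover have "bval G (ext (P j)) = (\<lambda>i. 0 * 0)"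
      by (auto simp: bval_def ext_def P_def fun_eq_iff)
    then have "app S M (bval G (ext (P j))) = (\<lambda>_. 0)" for S M
      using app_scale[of S M 0 "\<lambda>_. 0"] by simp
    ultimately show ?thesis unfolding w_def form_domain_def using e0 by (auto simp: ext_def)
  qed
  have "0 < Re (graph_inner G (pairs.lincomb n c w) (pairs.lincomb n c w))"
    if c: "\<exists>j\<le>n. c j \<noteq> 0" for c
  proof -
    let ?p = "pairs.lincomb n c w"
    have p: "?p \<in> V" by (intro pairs.subspace_sum subspace_form_domain pairs.subspace_scale w)
    define R where "R = (\<Sum>j\<le>n. monom (c j) j)"
    have "R \<noteq> 0"
    proof
      assume "R = 0"
      obtain j where j: "j \<le> n" "c j \<noteq> 0" using c by blast
      have "coeff R j = c j" using j(1) by (simp add: R_def coeff_sum)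
      then show False using \<open>R = 0\<close> j(2) by simp
    qed
    let ?T = "R * ([:0, 1:] * [:- complex_of_real ?l, 1:])"
    have "[:0, 1:] \<noteq> (0 :: complex poly)" "[:- complex_of_real ?l, 1:] \<noteq> 0" by simp_all
    then have T: "?T \<noteq> 0" using \<open>R \<noteq> 0\<close> by (simp only: mult_eq_0_iff) simp
    have val: "fst ?p e0 x = poly ?T (complex_of_real x)" if "x \<in> {0..?l}" for x
    proof -
      have "fst ?p e0 x = (\<Sum>j\<le>n. c j * poly (P j) (complex_of_real x))"
        using that by (simp add: fst_sum gfun_sum_apply pscale_def gscale_def w_def ext_def)
      also have "\<dots> = (\<Sum>j\<le>n. c j * complex_of_real x ^ j) * poly ([:0, 1:] * [:- complex_of_real ?l, 1:]) (complex_of_real x)"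
        unfolding P_def poly_mult[of "monom _ _"] sum_distrib_right by (simp only: poly_monom mult_1 mult.assoc)
      also have "\<dots> = poly ?T (complex_of_real x)"
        by (simp only: poly_mult[of R] R_def[symmetric]) (simp only: R_def poly_sum poly_monom)
      finally show ?thesis .
    qed
    have "fst ?p \<noteq> 0"
    proof
      assume "fst ?p = 0"
      then have "poly ?T (complex_of_real x) = 0" if "x \<in> {0..?l}" for x using val[OF that] by simp
      then have "complex_of_real ` {0..?l} \<subseteq> {z. poly ?T z = 0}" by blast
      then have "finite (complex_of_real ` {0..?l})" using poly_roots_finite[OF T] finite_subset by blast
      then have "finite {0..?l}" by (rule finite_imageD) (simp add: inj_on_def)
      then show False using infinite_Icc[OF len_pos[OF e0]] by blast
    qed
    then have "graph_mass G (fst ?p) \<noteq> 0" using graph_mass_eq_0_imp[OF p] by blast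
    then show ?thesis using graph_mass_nonneg[of G "fst ?p"] by (simp add: graph_inner_self)
  qed
  then show ?thesis using w by blast
qed

sublocale form_space pscale V "graph_inner G" "graph_form G q B"
proof
  show "\<exists>c. \<forall>p\<in>V. - c * Re (graph_inner G p p) \<le> Re (graph_form G q B p p)"
  proof -
    obtain c where c: "0 \<le> c" "\<And>p. p \<in> V \<Longrightarrow>
        graph_mass G (snd p) \<le> 2 * (Re (graph_form G q B p p) + c * graph_mass G (fst p))"
      by (rule graph_form_coercive) (rule that)
    have "- c * Re (graph_inner G p p) \<le> Re (graph_form G q B p p)" if "p \<in> V" for p
      using order_trans[OF graph_mass_nonneg c(2)[OF that]] by (simp add: graph_inner_self)
    then show ?thesis by blast
  qed
qed (fact graph_inner_psd graph_form_hermitian form_domain_compact form_domain_complete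
    form_domain_infinite_dimensional)+

end

section \<open>Eigenfunctions and the counting of eigenvalues\<close>

lemma l2_inner_cong_AE:
  assumes "L2 l f" "L2 l g" "L2 l h" "AE x in lebesgue_on {0..l}. g x = h x"
  shows "l2_inner l f g = l2_inner l f h"
  unfolding l2_inner_def
proof (rule integral_cong_AE)
  show "AE x in lebesgue_on {0..l}. cnj (f x) * g x = cnj (f x) * h x"
    using assms(4) by (rule AE_mp) (auto intro!: AE_I2)
qed (use L2_cnj_mult_integrable[OF assms(1,2)] L2_cnj_mult_integrable[OF assms(1,3)] in auto)

locale schroedinger_graph = quantum_graph G q A B
  for G :: "('v, 'e) mgraph" and q A B +
  fixes C :: "'v \<Rightarrow> ('e \<times> bool) vcond"
  assumes C_form: "\<And>v. v \<in> verts G \<Longrightarrow> form_condition (ends_at G v) (C v) (A v) (B v)"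
begin

abbreviation "H \<equiv> schroedinger G q C"

abbreviation "a \<equiv> graph_form G q B"

abbreviation "ip \<equiv> graph_inner G"

lemma graph_green:
  assumes y: "y \<in> V" and f: "\<And>e. e \<in> edges G \<Longrightarrow> has_L2_deriv2 (len G e) (f e) (g e)"
  shows "(\<Sum>e\<in>edges G. l2_inner (len G e) (snd y e) (deriv_on (len G e) (f e))) +
      (\<Sum>e\<in>edges G. l2_inner (len G e) (fst y e) (g e)) =
      - (\<Sum>v\<in>verts G. inner_on (ends_at G v) (bval G (fst y)) (bderiv G f))"
proof -
  have "l2_inner (len G e) (snd y e) (deriv_on (len G e) (f e)) + l2_inner (len G e) (fst y e) (g e) =
      - (cnj (bval G (fst y) (e, False)) * bderiv G f (e, False) + cnj (bval G (fst y) (e, True)) * bderiv G f (e, True))"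
    if e: "e \<in> edges G" for e
    using has_L2_deriv_green[OF less_imp_le[OF len_pos[OF e]] form_domain_deriv[OF y e], of "deriv_on (len G e) (f e)" "g e"]
      f[OF e] by (simp add: has_L2_deriv2_def bval_def bderiv_def)
  then show ?thesis
    unfolding inner_on_def sum_ends[OF graph] sum_negf[symmetric] sum.distrib[symmetric]
    by (intro sum.cong) auto
qed

text \<open>
  Form and operator differ by boundary terms only. Equality of these for all admissible
  \<open>y\<close> is the content of the vertex conditions.
\<close>

lemma form_eq_operator:
  assumes y: "y \<in> V" and p: "p \<in> V"
    and f: "\<And>e. e \<in> edges G \<Longrightarrow> has_L2_deriv2 (len G e) (fst p e) (g e)"
    and AE: "\<And>e. e \<in> edges G \<Longrightarrow> AE x in lebesgue_on {0..len G e}. snd p e x = deriv_on (len G e) (fst p e) x"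
    and h: "\<And>e. e \<in> edges G \<Longrightarrow> AE x in lebesgue_on {0..len G e}.
        complex_of_real \<mu> * fst p e x = - g e x + complex_of_real (q e x) * fst p e x"
  shows "a y p - of_real \<mu> * ip y p = boundary_form G B (bval G (fst y)) (bval G (fst p)) -
      (\<Sum>v\<in>verts G. inner_on (ends_at G v) (bval G (fst y)) (bderiv G (fst p)))"
proof -
  have gL2: "L2 (len G e) (g e)" if "e \<in> edges G" for e
    using f[OF that] has_L2_deriv_L2 by (auto simp: has_L2_deriv2_def)
  have "l2_inner (len G e) (snd y e) (snd p e) = l2_inner (len G e) (snd y e) (deriv_on (len G e) (fst p e))"
    if e: "e \<in> edges G" for e
    using form_domain_L2[OF y e] form_domain_L2[OF p e] AE[OF e] f[OF e] has_L2_deriv_self_L2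
    by (intro l2_inner_cong_AE) (auto simp: has_L2_deriv2_def)
  then have kin: "(\<Sum>e\<in>edges G. l2_inner (len G e) (snd y e) (snd p e)) =
      (\<Sum>e\<in>edges G. l2_inner (len G e) (snd y e) (deriv_on (len G e) (fst p e)))"
    by (intro sum.cong) auto
  have "l2_inner (len G e) (fst y e) (\<lambda>x. complex_of_real (q e x) * fst p e x) =
      of_real \<mu> * l2_inner (len G e) (fst y e) (fst p e) + l2_inner (len G e) (fst y e) (g e)"
    if e: "e \<in> edges G" for e
  proof -
    note L2 = form_domain_L2(1)[OF y e] form_domain_L2(1)[OF p e] gL2[OF e] L2_potential[OF potential[OF e] form_domain_L2(1)[OF p e]]
    have "l2_inner (len G e) (fst y e) (\<lambda>x. complex_of_real (q e x) * fst p e x) =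
        l2_inner (len G e) (fst y e) (fscale (of_real \<mu>) (fst p e) + g e)"
    proof (rule l2_inner_cong_AE[OF L2(1,4)])
      show "L2 (len G e) (fscale (of_real \<mu>) (fst p e) + g e)"
        using L2_add[OF L2_scale[OF L2(2)] L2(3)] by (simp add: fscale_def plus_fun_def)
      show "AE x in lebesgue_on {0..len G e}. complex_of_real (q e x) * fst p e x = (fscale (of_real \<mu>) (fst p e) + g e) x"
        using h[OF e] by (rule AE_mp) (auto intro!: AE_I2 simp: fscale_def)
    qed
    also have "\<dots> = l2_inner (len G e) (fst y e) (fscale (of_real \<mu>) (fst p e)) + l2_inner (len G e) (fst y e) (g e)"
      by (rule funs.hermitian_add_right[OF l2_hermitian]) (use L2 L2_scale[OF L2(2)] in \<open>auto simp: fscale_def\<close>)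
    also have "l2_inner (len G e) (fst y e) (fscale (of_real \<mu>) (fst p e)) = of_real \<mu> * l2_inner (len G e) (fst y e) (fst p e)"
      by (rule funs.hermitian_scale_right[OF l2_hermitian]) (use L2 in auto)
    finally show ?thesis .
  qed
  then have pot: "(\<Sum>e\<in>edges G. l2_inner (len G e) (fst y e) (\<lambda>x. complex_of_real (q e x) * fst p e x)) =
      of_real \<mu> * ip y p + (\<Sum>e\<in>edges G. l2_inner (len G e) (fst y e) (g e))"
    unfolding graph_inner_def sum_distrib_left sum.distrib[symmetric] by (intro sum.cong) auto
  have green: "(\<Sum>e\<in>edges G. l2_inner (len G e) (snd y e) (deriv_on (len G e) (fst p e))) +
      (\<Sum>e\<in>edges G. l2_inner (len G e) (fst y e) (g e)) =
      - (\<Sum>v\<in>verts G. inner_on (ends_at G v) (bval G (fst y)) (bderiv G (fst p)))"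
    by (rule graph_green[OF y f])
  show ?thesis
    unfolding graph_form_def kin pot using green by (simp add: algebra_simps)
qed

definition weak_eigenspace :: "real \<Rightarrow> ('e gfun \<times> 'e gfun) set" where
  "weak_eigenspace \<mu> = {p \<in> V. \<forall>y\<in>V. a y p = of_real \<mu> * ip y p}"

lemma eigenfunction_imp_weak:
  assumes "f \<in> eigenspace H \<mu>"
  shows "\<exists>p\<in>weak_eigenspace \<mu>. fst p = f"
proof -
  have dom: "f \<in> op_domain G C" and ex: "\<forall>e\<in>edges G. \<exists>g. has_L2_deriv2 (len G e) (f e) g \<and>
      (AE x in lebesgue_on {0..len G e}. gscale (of_real \<mu>) f e x = - g x + complex_of_real (q e x) * f e x)"
    using assms by (auto simp: eigenspace_def schroedinger_def)
  obtain g where g: "\<And>e. e \<in> edges G \<Longrightarrow> has_L2_deriv2 (len G e) (f e) (g e)"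
    "\<And>e. e \<in> edges G \<Longrightarrow> AE x in lebesgue_on {0..len G e}. of_real \<mu> * f e x = - g e x + complex_of_real (q e x) * f e x"
    using bchoice[OF ex] by (auto simp: gscale_def)
  define f' where "f' e x = (if e \<in> edges G \<and> x \<in> {0..len G e} then deriv_on (len G e) (f e) x else 0)" for e x
  have d: "has_L2_deriv (len G e) (f e) (f' e)" if e: "e \<in> edges G" for e
    by (rule has_L2_deriv_cong[OF has_L2_deriv2_imp_deriv[OF len_pos[OF e] g(1)[OF e]]])
      (simp_all add: f'_def e)
  have cond: "app (ends_at G v) (A v) (bval G f) = (\<lambda>_. 0) \<and>
      (\<forall>Y. app (ends_at G v) (A v) Y = (\<lambda>_. 0) \<longrightarrow>
         inner_on (ends_at G v) Y (bderiv G f) = inner_on (ends_at G v) Y (app (ends_at G v) (B v) (bval G f)))"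
    if v: "v \<in> verts G" for v
  proof -
    have "C v (bval G f) (bderiv G f)" using dom v by (simp add: op_domain_def)
    then show ?thesis using C_form[OF v] unfolding form_condition_def by blast
  qed
  have out: "f e x = 0" if "e \<notin> edges G \<or> x \<notin> {0..len G e}" for e x
    using dom that unfolding op_domain_def by blast
  have pV: "(f, f') \<in> V"
    unfolding form_domain_def mem_Collect_eq split
    using d cond out by (auto simp: f'_def)
  have "a y (f, f') = of_real \<mu> * ip y (f, f')" if y: "y \<in> V" for y
  proof -
    have "a y (f, f') - of_real \<mu> * ip y (f, f') = boundary_form G B (bval G (fst y)) (bval G (fst (f, f'))) -
      (\<Sum>v\<in>verts G. inner_on (ends_at G v) (bval G (fst y)) (bderiv G (fst (f, f'))))"
      by (rule form_eq_operator[OF y pV, of g]) (use g in \<open>auto intro!: AE_I2 simp: f'_def\<close>)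
    also have "\<dots> = 0"
      unfolding boundary_form_def sum_subtractf[symmetric]
      by (rule sum.neutral) (use cond form_domain_vertex[OF y] in auto)
    finally show ?thesis by simp
  qed
  then show ?thesis using pV by (intro bexI[of _ "(f, f')"]) (auto simp: weak_eigenspace_def)
qed

text \<open>
  Test functions living on one edge and vanishing at its ends give the differential equation on
  that edge and the regularity of the eigenvector; test functions with prescribed boundary values
  at one vertex then give the natural vertex conditions there.
\<close>

lemma weak_imp_eigenfunction:
  assumes "p \<in> weak_eigenspace \<mu>"
  shows "fst p \<in> eigenspace H \<mu>"
proof -
  have p: "p \<in> V" and weak: "\<And>y. y \<in> V \<Longrightarrow> a y p = of_real \<mu> * ip y p"
    using assms by (auto simp: weak_eigenspace_def)
  define h where "h e x = of_real \<mu> * fst p e x - complex_of_real (q e x) * fst p e x" for e x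
  have hL2: "L2 (len G e) (h e)" if e: "e \<in> edges G" for e
    unfolding h_def[abs_def] using form_domain_L2[OF p e] L2_potential[OF potential[OF e]]
    by (intro L2_diff L2_scale) auto
  have edge: "l2_inner (len G e0) \<psi> (snd p e0) = l2_inner (len G e0) \<phi> (h e0)"
    if e0: "e0 \<in> edges G" and phi: "has_L2_deriv (len G e0) \<phi> \<psi>" and zero: "\<phi> 0 = 0" "\<phi> (len G e0) = 0" for e0 \<phi> \<psi>
  proof -
    let ?l = "len G e0"
    define f where "f e x = (if e = e0 \<and> x \<in> {0..?l} then \<phi> x else 0)" for e x
    define g where "g e x = (if e = e0 \<and> x \<in> {0..?l} then \<psi> x else 0)" for e x
    have bv: "bval G f = (\<lambda>i. 0 * 0)" using zero by (auto simp: bval_def f_def fun_eq_iff)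
    have "has_L2_deriv (len G e) (f e) (g e)" for e
    proof (cases "e = e0")
      case True
      show ?thesis by (rule has_L2_deriv_cong[of _ \<phi> \<psi>]) (simp_all add: True phi f_def g_def)
    next
      case False
      show ?thesis by (rule has_L2_deriv_cong[OF has_L2_deriv_zero]) (simp_all add: False f_def g_def)
    qed
    moreover have "app S M (bval G f) = (\<lambda>_. 0)" for S M using app_scale[of S M 0 "\<lambda>_. 0"] bv by simp
    ultimately have y: "(f, g) \<in> V" unfolding form_domain_def using e0 by (auto simp: f_def g_def)
    have single: "(\<Sum>e\<in>edges G. l2_inner (len G e) (u e) (w e)) = l2_inner ?l (u e0) (w e0)"
      if "\<And>e. e \<noteq> e0 \<Longrightarrow> u e = (\<lambda>_. 0)" for u w
    proof -
      have "(\<Sum>e\<in>edges G. l2_inner (len G e) (u e) (w e)) =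
          l2_inner ?l (u e0) (w e0) + (\<Sum>e\<in>edges G - {e0}. l2_inner (len G e) (u e) (w e))"
        using finite_edges e0 by (rule sum.remove)
      also have "(\<Sum>e\<in>edges G - {e0}. l2_inner (len G e) (u e) (w e)) = 0"
        by (rule sum.neutral) (auto simp: that l2_inner_def)
      finally show ?thesis by simp
    qed
    have local: "l2_inner ?l (f e0) w = l2_inner ?l \<phi> w" "l2_inner ?l (g e0) w = l2_inner ?l \<psi> w" for w
      unfolding l2_inner_def by (auto intro!: Bochner_Integration.integral_cong simp: f_def g_def)
    have "inner_on S (bval G f) Y = 0" for S Y using bv by (simp add: inner_on_zero)
    then have "boundary_form G B (bval G f) (bval G (fst p)) = 0" by (simp add: boundary_form_def)
    moreover have fg0: "f e = (\<lambda>_. 0)" "g e = (\<lambda>_. 0)" if "e \<noteq> e0" for e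
      using that by (simp_all add: f_def g_def fun_eq_iff)
    ultimately have "l2_inner ?l \<psi> (snd p e0) + l2_inner ?l \<phi> (\<lambda>x. complex_of_real (q e0 x) * fst p e0 x) =
        of_real \<mu> * l2_inner ?l \<phi> (fst p e0)"
      using weak[OF y] single[of g "snd p"] single[of f "fst p"] single[of f "\<lambda>e x. complex_of_real (q e x) * fst p e x"]
      by (simp add: graph_form_def graph_inner_def local)
    moreover have "l2_inner ?l \<phi> (h e0) = of_real \<mu> * l2_inner ?l \<phi> (fst p e0) -
        l2_inner ?l \<phi> (\<lambda>x. complex_of_real (q e0 x) * fst p e0 x)"
    proof -
      have "integrable (lebesgue_on {0..?l}) (\<lambda>x. cnj (\<phi> x) * fst p e0 x)"
        "integrable (lebesgue_on {0..?l}) (\<lambda>x. cnj (\<phi> x) * (complex_of_real (q e0 x) * fst p e0 x))"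
        using form_domain_L2(1)[OF p e0] has_L2_deriv_self_L2[OF phi] L2_potential[OF potential[OF e0]]
        by (auto intro: L2_cnj_mult_integrable)
      then show ?thesis
        unfolding l2_inner_def h_def by (simp add: right_diff_distrib mult.left_commute[of _ "of_real \<mu>"])
    qed
    ultimately show ?thesis by (metis add_diff_cancel_right')
  qed
  have d2: "has_L2_deriv2 (len G e) (fst p e) (\<lambda>x. - h e x)" if e: "e \<in> edges G" for e
    by (rule weak_second_derivative(1)[OF len_pos[OF e] form_domain_deriv[OF p e] hL2[OF e]]) (rule edge[OF e])
  have AE: "AE x in lebesgue_on {0..len G e}. snd p e x = deriv_on (len G e) (fst p e) x" if e: "e \<in> edges G" for e
    by (rule weak_second_derivative(2)[OF len_pos[OF e] form_domain_deriv[OF p e] hL2[OF e]]) (rule edge[OF e])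
  have bdry: "boundary_form G B (bval G (fst y)) (bval G (fst p)) =
      (\<Sum>v\<in>verts G. inner_on (ends_at G v) (bval G (fst y)) (bderiv G (fst p)))" if y: "y \<in> V" for y
  proof -
    have "a y p - of_real \<mu> * ip y p = boundary_form G B (bval G (fst y)) (bval G (fst p)) -
      (\<Sum>v\<in>verts G. inner_on (ends_at G v) (bval G (fst y)) (bderiv G (fst p)))"
      by (rule form_eq_operator[OF y p d2 AE]) (auto simp: h_def)
    then show ?thesis using weak[OF y] by simp
  qed
  have vertex: "C v (bval G (fst p)) (bderiv G (fst p))" if v: "v \<in> verts G" for v
  proof -
    have "inner_on (ends_at G v) Y (bderiv G (fst p)) = inner_on (ends_at G v) Y (app (ends_at G v) (B v) (bval G (fst p)))"
      if Y: "app (ends_at G v) (A v) Y = (\<lambda>_. 0)" for Y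
    proof -
      \<comment> \<open>The piecewise linear function with boundary values \<open>Y\<close> at \<open>v\<close> and \<open>0\<close> at all other vertices.\<close>
      define Z where "Z i = (if i \<in> ends_at G v then Y i else 0)" for i
      define f where "f e x = (if e \<in> edges G \<and> x \<in> {0..len G e} then
          Z (e, False) + (Z (e, True) - Z (e, False)) / of_real (len G e) * of_real x else 0)" for e x
      define g where "g e x = (if e \<in> edges G \<and> x \<in> {0..len G e} then (Z (e, True) - Z (e, False)) / of_real (len G e) else 0)" for e and x :: real
      have bv: "bval G f i = Z i" if "fst i \<in> edges G" for i
        using len_pos[OF that] that by (cases i) (auto simp: bval_def f_def)
      have "has_L2_deriv (len G e) (f e) (g e)" if e: "e \<in> edges G" for e
      proof (rule has_L2_deriv_cong[OF has_L2_deriv_poly[of _ "[:Z (e, False), (Z (e, True) - Z (e, False)) / of_real (len G e):]"]])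
      qed (simp_all add: e f_def g_def pderiv_pCons mult.commute)
      moreover have "app (ends_at G w) (A w) (bval G f) = (\<lambda>_. 0)" if "w \<in> verts G" for w
      proof (cases "w = v")
        case True
        have "app (ends_at G v) (A v) (bval G f) = app (ends_at G v) (A v) Y"
          by (rule app_cong) (use bv in \<open>auto simp: Z_def ends_at_def\<close>)
        then show ?thesis using True Y by simp
      next
        case False
        have "app (ends_at G w) (A w) (bval G f) = app (ends_at G w) (A w) (\<lambda>i. 0 * 0)"
          by (rule app_cong) (use bv False in \<open>auto simp: Z_def ends_at_def\<close>)
        then show ?thesis using app_scale[of "ends_at G w" "A w" 0 "\<lambda>_. 0"] by simp
      qed
      ultimately have y: "(f, g) \<in> V" unfolding form_domain_def by (auto simp: f_def g_def)
      have inner: "inner_on (ends_at G w) (bval G f) F = (if w = v then inner_on (ends_at G v) Y F else 0)" for w F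
      proof (cases "w = v")
        case True
        then show ?thesis using bv by (auto simp: Z_def ends_at_def intro!: inner_on_cong)
      next
        case False
        have "inner_on (ends_at G w) (bval G f) F = inner_on (ends_at G w) (\<lambda>_. 0) F"
          by (rule inner_on_cong) (use bv False in \<open>auto simp: Z_def ends_at_def\<close>)
        then show ?thesis using False by (simp add: inner_on_zero)
      qed
      show ?thesis using bdry[OF y] v finite_verts by (simp add: boundary_form_def inner)
    qed
    then show ?thesis using C_form[OF v] form_domain_vertex[OF p v] unfolding form_condition_def by blast
  qed
  have dom: "fst p \<in> op_domain G C"
    unfolding op_domain_def using d2 vertex form_domain_outside[OF p] by blast
  have "\<exists>g. has_L2_deriv2 (len G e) (fst p e) g \<and> (AE x in lebesgue_on {0..len G e}.
      gscale (of_real \<mu>) (fst p) e x = - g x + complex_of_real (q e x) * fst p e x)" if e: "e \<in> edges G" for e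
    using d2[OF e] by (intro exI[of _ "\<lambda>x. - h e x"]) (auto simp: h_def gscale_def)
  then show ?thesis using dom by (auto simp: eigenspace_def schroedinger_def)
qed

lemma subspace_weak_eigenspace: "pairs.subspace (weak_eigenspace \<mu>)"
proof (rule pairs.subspaceI)
  show "0 \<in> weak_eigenspace \<mu>"
    using V_closed(1) hermitian_zero_right[OF a_hermitian] hermitian_zero_right[OF ip_hermitian]
    by (simp add: weak_eigenspace_def)
next
  fix p p' assume "p \<in> weak_eigenspace \<mu>" "p' \<in> weak_eigenspace \<mu>"
  then show "p + p' \<in> weak_eigenspace \<mu>"
    using hermitian_add_right[OF a_hermitian] hermitian_add_right[OF ip_hermitian] V_closed(2)
    by (auto simp: weak_eigenspace_def distrib_left)
next
  fix c p assume "p \<in> weak_eigenspace \<mu>"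
  then show "pscale c p \<in> weak_eigenspace \<mu>"
    using hermitian_scale_right[OF a_hermitian] hermitian_scale_right[OF ip_hermitian] V_closed(4)
    by (auto simp: weak_eigenspace_def)
qed

lemma weak_eigenspace_orthogonal:
  assumes p: "p \<in> weak_eigenspace \<mu>" and p': "p' \<in> weak_eigenspace \<nu>" and ne: "\<mu> \<noteq> \<nu>"
  shows "ip p p' = 0"
proof -
  have V: "p \<in> V" "p' \<in> V" using p p' by (auto simp: weak_eigenspace_def)
  have "a p' p = of_real \<mu> * ip p' p" using p V by (simp add: weak_eigenspace_def)
  then have "a p p' = of_real \<mu> * ip p p'"
    using hermitian_swap[OF a_hermitian V(2) V(1)] hermitian_swap[OF ip_hermitian V(2) V(1)] by simp
  moreover have "a p p' = of_real \<nu> * ip p p'" using p' V by (simp add: weak_eigenspace_def)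
  ultimately show ?thesis using ne by auto
qed

text \<open>
  Eigenfunctions to several eigenvalues \<open>\<le> t\<close> span a space on which the form is bounded by \<open>t\<close>,
  because different eigenspaces are orthogonal both for the inner product and for the form.
\<close>

lemma eigenfunction_family_bound:
  assumes f: "\<And>j. j \<le> (n :: nat) \<Longrightarrow> f j \<in> eigenspace H (m j)" and m: "\<And>j. j \<le> n \<Longrightarrow> m j \<le> t"
    and indep: "\<And>c \<mu> j. (\<Sum>i\<in>{i. i \<le> n \<and> m i = \<mu>}. gscale (c i) (f i)) = 0 \<Longrightarrow> j \<le> n \<Longrightarrow> m j = \<mu> \<Longrightarrow> c j = 0"
    and u: "\<And>i. i < n \<Longrightarrow> u i \<in> V"
    and min: "\<And>y. y \<in> V \<Longrightarrow> (\<And>i. i < n \<Longrightarrow> ip (u i) y = 0) \<Longrightarrow> l * Re (ip y y) \<le> Re (a y y)"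
  shows "l \<le> t"
proof -
  have "\<forall>j\<in>{..n}. \<exists>p. p \<in> weak_eigenspace (m j) \<and> fst p = f j" using f eigenfunction_imp_weak by blast
  from bchoice[OF this] obtain w where w: "\<And>j. j \<le> n \<Longrightarrow> w j \<in> weak_eigenspace (m j)" "\<And>j. j \<le> n \<Longrightarrow> fst (w j) = f j"
    by auto
  have wV: "w j \<in> V" if "j \<le> n" for j using w(1)[OF that] by (simp add: weak_eigenspace_def)
  define M where "M = m ` {..n}"
  have M: "finite M" by (simp add: M_def)
  define part where "part c \<mu> = (\<Sum>i\<in>{i. i \<le> n \<and> m i = \<mu>}. pscale (c i) (w i))" for c \<mu>
  have part: "part c \<mu> \<in> weak_eigenspace \<mu>" for c \<mu>
    unfolding part_def using w(1) by (intro pairs.subspace_sum pairs.subspace_scale subspace_weak_eigenspace) auto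
  have partV: "part c \<mu> \<in> V" for c \<mu> using part[of c \<mu>] by (simp add: weak_eigenspace_def)
  have split: "(pairs.lincomb n c w) = (\<Sum>\<mu>\<in>M. part c \<mu>)" for c
    using sum.group[of "{..n}" M m "\<lambda>j. pscale (c j) (w j)"] M
    by (simp add: M_def part_def atMost_def)
  have ip_part: "ip (\<Sum>\<nu>\<in>M. part c \<nu>) (part c \<mu>) = ip (part c \<mu>) (part c \<mu>)" if "\<mu> \<in> M" for c \<mu>
  proof -
    have "ip (\<Sum>\<nu>\<in>M. part c \<nu>) (part c \<mu>) = (\<Sum>\<nu>\<in>M. ip (part c \<nu>) (part c \<mu>))"
      by (intro hermitian_sum_left[OF ip_hermitian] partV)
    also have "\<dots> = (\<Sum>\<nu>\<in>M. if \<nu> = \<mu> then ip (part c \<mu>) (part c \<mu>) else 0)"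
      by (rule sum.cong) (auto intro: weak_eigenspace_orthogonal part)
    also have "\<dots> = ip (part c \<mu>) (part c \<mu>)" using M that by simp
    finally show ?thesis .
  qed
  have sumV: "(\<Sum>\<mu>\<in>M. part c \<mu>) \<in> V" for c by (intro V_closed partV)
  have ip_sum: "ip (\<Sum>\<mu>\<in>M. part c \<mu>) (\<Sum>\<mu>\<in>M. part c \<mu>) = (\<Sum>\<mu>\<in>M. ip (part c \<mu>) (part c \<mu>))" for c
    using hermitian_sum_right[OF ip_hermitian sumV[of c] partV[of c], where I = M] ip_part by simp
  have a_part: "a (\<Sum>\<nu>\<in>M. part c \<nu>) (part c \<mu>) = of_real \<mu> * ip (part c \<mu>) (part c \<mu>)" if "\<mu> \<in> M" for c \<mu>
    using part[of c \<mu>] sumV[of c] ip_part[OF that, of c] by (simp add: weak_eigenspace_def)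
  have a_sum: "a (\<Sum>\<mu>\<in>M. part c \<mu>) (\<Sum>\<mu>\<in>M. part c \<mu>) = (\<Sum>\<mu>\<in>M. of_real \<mu> * ip (part c \<mu>) (part c \<mu>))" for c
    using hermitian_sum_right[OF a_hermitian sumV[of c] partV[of c], where I = M] a_part by simp
  have nonneg: "0 \<le> Re (ip (part c \<mu>) (part c \<mu>))" for c \<mu> using psd_nonneg[OF ip_psd partV] .
  show ?thesis
  proof (rule trial_space_bound[OF u min wV])
    fix c :: "nat \<Rightarrow> complex" assume c: "\<exists>j\<le>n. c j \<noteq> 0"
    have "Re (ip (\<Sum>\<mu>\<in>M. part c \<mu>) (\<Sum>\<mu>\<in>M. part c \<mu>)) \<noteq> 0"
    proof
      assume "Re (ip (\<Sum>\<mu>\<in>M. part c \<mu>) (\<Sum>\<mu>\<in>M. part c \<mu>)) = 0"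
      then have z: "\<forall>\<mu>\<in>M. Re (ip (part c \<mu>) (part c \<mu>)) = 0"
        unfolding ip_sum Re_sum
        using sum_nonneg_eq_0_iff[OF M, of "\<lambda>\<mu>. Re (ip (part c \<mu>) (part c \<mu>))"] nonneg by simp
      obtain j where j: "j \<le> n" "c j \<noteq> 0" using c by blast
      have "graph_mass G (fst (part c (m j))) = 0"
        using z j(1) by (auto simp: M_def graph_inner_self)
      then have "fst (part c (m j)) = 0" by (rule graph_mass_eq_0_imp[OF partV])
      moreover have "fst (part c (m j)) = (\<Sum>i\<in>{i. i \<le> n \<and> m i = m j}. gscale (c i) (f i))"
        unfolding part_def fst_sum by (intro sum.cong) (auto simp: pscale_def w(2))
      ultimately have "c j = 0" using indep[OF _ j(1) refl] by metis
      then show False using j(2) by simp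
    qed
    moreover have "0 \<le> Re (ip (\<Sum>\<mu>\<in>M. part c \<mu>) (\<Sum>\<mu>\<in>M. part c \<mu>))"
      unfolding ip_sum Re_sum by (rule sum_nonneg) (rule nonneg)
    ultimately show "0 < Re (ip (pairs.lincomb n c w) (pairs.lincomb n c w))"
      unfolding split by simp
  next
    fix c :: "nat \<Rightarrow> complex"
    have "Re (a (\<Sum>\<mu>\<in>M. part c \<mu>) (\<Sum>\<mu>\<in>M. part c \<mu>)) = (\<Sum>\<mu>\<in>M. \<mu> * Re (ip (part c \<mu>) (part c \<mu>)))"
      unfolding a_sum Re_sum by simp
    also have "\<dots> \<le> (\<Sum>\<mu>\<in>M. t * Re (ip (part c \<mu>) (part c \<mu>)))"
      using m nonneg by (intro sum_mono mult_right_mono) (auto simp: M_def)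
    also have "\<dots> = t * Re (ip (\<Sum>\<mu>\<in>M. part c \<mu>) (\<Sum>\<mu>\<in>M. part c \<mu>))"
      unfolding ip_sum Re_sum by (simp add: sum_distrib_left)
    finally show "Re (a (pairs.lincomb n c w) (pairs.lincomb n c w))
        \<le> t * Re (ip (pairs.lincomb n c w) (pairs.lincomb n c w))"
      unfolding split .
  qed
qed

lemma independent_family_coeff:
  assumes B: "gfun.independent Bs" and I: "finite I" "inj_on f I" "f ` I \<subseteq> Bs"
    and sum: "(\<Sum>i\<in>I. gscale (c i) (f i)) = 0" and j: "j \<in> I"
  shows "c j = 0"
proof -
  define g where "g v = c (the_inv_into I f v)" for v
  have g: "g (f i) = c i" if "i \<in> I" for i using the_inv_into_f_f[OF I(2) that] by (simp add: g_def)
  have "(\<Sum>v\<in>f ` I. gscale (g v) v) = (\<Sum>i\<in>I. gscale (c i) (f i))"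
    using g by (simp add: sum.reindex[OF I(2)])
  then have "g (f j) = 0" using gfun.independentD[OF B _ I(3), of g "f j"] I(1) sum j by auto
  then show ?thesis using g[OF j] by simp
qed

text \<open>
  Counting eigenvalues with multiplicity agrees with successive minimisation. At least \<open>n +
  1\<close> eigenvalues \<open>\<le> t\<close> give \<open>lam n \<le> t\<close> by
  \<open>eigenfunction_family_bound\<close>; conversely the first \<open>n + 1\<close> members of
  the sequence provide \<open>n + 1\<close> eigenvalues \<open>\<le> lam n\<close>. The latter
  counts correctly because a basis of an eigenspace is finite: \<open>n + 1\<close> independent
  eigenfunctions to \<open>\<mu>\<close> force \<open>lam n \<le> \<mu>\<close>, and
  \<open>lam\<close> is unbounded. For an infinite basis the dimension, and with it the
  multiplicity, would be \<open>0\<close>.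
\<close>

theorem eigenvalue_sequence:
  obtains u lam where "\<And>n::nat. u n \<in> V"
    and "\<And>m n. ip (u m) (u n) = (if m = n then 1 else 0)"
    and "\<And>n y. y \<in> V \<Longrightarrow> a (u n) y = of_real (lam n) * ip (u n) y"
    and "\<And>n y. y \<in> V \<Longrightarrow> (\<And>i. i < n \<Longrightarrow> ip (u i) y = 0) \<Longrightarrow> lam n * Re (ip y y) \<le> Re (a y y)"
    and "\<And>i n. i \<le> n \<Longrightarrow> lam i \<le> lam n"
    and "\<And>n. nth_eigenvalue H (Suc n) = lam n"
proof (rule eigensequence)
  fix u and lam :: "nat \<Rightarrow> real"
  assume u: "\<And>n. u n \<in> V"
    and orth: "\<And>m n. ip (u m) (u n) = (if m = n then 1 else 0)"
    and weak: "\<And>n y. y \<in> V \<Longrightarrow> a (u n) y = of_real (lam n) * ip (u n) y"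
    and min: "\<And>n y. y \<in> V \<Longrightarrow> (\<And>i. i < n \<Longrightarrow> ip (u i) y = 0) \<Longrightarrow> lam n * Re (ip y y) \<le> Re (a y y)"
    and unbounded: "\<And>K. \<exists>n. K < lam n"
  have mono: "lam i \<le> lam n" if "i \<le> n" for i n
    using min[of "u n" i] u orth weak[of "u n" n] that by simp
  have uW: "u n \<in> weak_eigenspace (lam n)" for n
    unfolding weak_eigenspace_def
  proof (intro CollectI conjI ballI u)
    fix y assume y: "y \<in> V"
    show "a y (u n) = of_real (lam n) * ip y (u n)"
      using weak[OF y, of n] hermitian_swap[OF a_hermitian u[of n] y] hermitian_swap[OF ip_hermitian u[of n] y] by simp
  qed
  have uE: "fst (u n) \<in> eigenspace H (lam n)" for n using weak_imp_eigenfunction[OF uW] .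
  have basis: "\<exists>Bs\<subseteq>eigenspace H \<mu>. gfun.independent Bs \<and> finite Bs \<and> eigenspace H \<mu> \<subseteq> gfun.span Bs \<and> card Bs = multiplicity H \<mu>" for \<mu>
  proof -
    obtain Bs where Bs: "Bs \<subseteq> eigenspace H \<mu>" "gfun.independent Bs" "eigenspace H \<mu> \<subseteq> gfun.span Bs"
      "card Bs = gfun.dim (eigenspace H \<mu>)" by (rule gfun.basis_exists)
    have "finite Bs"
    proof (rule ccontr)
      assume inf: "infinite Bs"
      obtain n where n: "\<mu> < lam n" using unbounded by blast
      obtain T where T: "T \<subseteq> Bs" "finite T" "card T = Suc n" using infinite_arbitrarily_large[OF inf] by blast
      obtain f where f: "bij_betw f {..n} T"
        using finite_same_card_bij[of "{..n}" T] T by auto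
      have "lam n \<le> \<mu>"
      proof (rule eigenfunction_family_bound[where f = f and m = "\<lambda>_. \<mu>" and u = u])
        show "f j \<in> eigenspace H \<mu>" if "j \<le> n" for j using bij_betwE[OF f] T(1) Bs(1) that by auto
        show "c j = 0" if "(\<Sum>i\<in>{i. i \<le> n \<and> \<mu> = \<nu>}. gscale (c i) (f i)) = 0" "j \<le> n" "\<mu> = \<nu>" for c \<nu> j
          by (rule independent_family_coeff[OF Bs(2) _ _ _ that(1)])
            (use that f T(1) in \<open>auto simp: bij_betw_def atMost_def\<close>)
      qed (use u min in auto)
      then show False using n by simp
    qed
    then show ?thesis using Bs by (auto simp: multiplicity_def)
  qed
  have count: "lam n \<le> t" if M: "finite M" "\<forall>\<mu>\<in>M. eigenvalue H \<mu> \<and> \<mu> \<le> t" "Suc n \<le> (\<Sum>\<mu>\<in>M. multiplicity H \<mu>)" for n t M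
  proof -
    obtain Bs where Bs: "\<And>\<mu>. Bs \<mu> \<subseteq> eigenspace H \<mu>" "\<And>\<mu>. gfun.independent (Bs \<mu>)" "\<And>\<mu>. finite (Bs \<mu>)"
      "\<And>\<mu>. card (Bs \<mu>) = multiplicity H \<mu>" using basis by metis
    have "card (Sigma M Bs) = (\<Sum>\<mu>\<in>M. multiplicity H \<mu>)" using M(1) Bs(3,4) by (simp add: card_SigmaI)
    then obtain T where T: "T \<subseteq> Sigma M Bs" "card T = Suc n" "finite T"
      using M(3) obtain_subset_with_card_n by metis
    obtain f where f: "bij_betw f {..n} T" using finite_same_card_bij[of "{..n}" T] T by auto
    have fT: "f j \<in> Sigma M Bs" if "j \<le> n" for j using bij_betwE[OF f] T(1) that by auto
    show ?thesis
    proof (rule eigenfunction_family_bound[where f = "\<lambda>j. snd (f j)" and m = "\<lambda>j. fst (f j)" and u = u])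
      show "snd (f j) \<in> eigenspace H (fst (f j))" "fst (f j) \<le> t" if "j \<le> n" for j
        using fT[OF that] subsetD[OF Bs(1)] M(2) by (auto simp: Sigma_def)
      show "c j = 0" if "(\<Sum>i\<in>{i. i \<le> n \<and> fst (f i) = \<mu>}. gscale (c i) (snd (f i))) = 0" "j \<le> n" "fst (f j) = \<mu>" for c \<mu> j
      proof (rule independent_family_coeff[OF Bs(2)[of \<mu>] _ _ _ that(1)])
        show "inj_on (\<lambda>i. snd (f i)) {i. i \<le> n \<and> fst (f i) = \<mu>}"
        proof (rule inj_onI)
          fix i i' assume "i \<in> {i. i \<le> n \<and> fst (f i) = \<mu>}" "i' \<in> {i. i \<le> n \<and> fst (f i) = \<mu>}" "snd (f i) = snd (f i')"
          then have "f i = f i'" "i \<le> n" "i' \<le> n" by (auto simp: prod_eq_iff)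
          then show "i = i'" using f unfolding bij_betw_def inj_on_def by auto
        qed
        show "(\<lambda>i. snd (f i)) ` {i. i \<le> n \<and> fst (f i) = \<mu>} \<subseteq> Bs \<mu>"
        proof safe
          fix i assume "i \<le> n"
          then show "snd (f i) \<in> Bs (fst (f i))" using fT[of i] by (auto simp: Sigma_def)
        qed
      qed (use that in auto)
    qed (use u min in auto)
  qed
  have attained: "\<exists>M. finite M \<and> (\<forall>\<mu>\<in>M. eigenvalue H \<mu> \<and> \<mu> \<le> lam n) \<and> Suc n \<le> (\<Sum>\<mu>\<in>M. multiplicity H \<mu>)" for n
  proof (intro exI[of _ "lam ` {..n}"] conjI ballI)
    fix \<mu> assume "\<mu> \<in> lam ` {..n}"
    then obtain j where j: "j \<le> n" "\<mu> = lam j" by auto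
    have "fst (u j) \<noteq> 0"
    proof
      assume "fst (u j) = 0"
      then have "ip (u j) (u j) = 0" by (simp add: graph_inner_def l2_inner_def)
      then show False using orth[of j j] by simp
    qed
    then show "eigenvalue H \<mu>" using uE[of j] j by (auto simp: eigenvalue_def)
    show "\<mu> \<le> lam n" using mono j by simp
  next
    have "card {j \<in> {..n}. lam j = \<mu>} \<le> multiplicity H \<mu>" for \<mu>
    proof -
      let ?I = "{j \<in> {..n}. lam j = \<mu>}"
      obtain Bs where Bs: "finite Bs" "eigenspace H \<mu> \<subseteq> gfun.span Bs" "card Bs = multiplicity H \<mu>" using basis by blast
      have coeff: "c j = 0" if z: "(\<Sum>i\<in>J. gscale (c i) (fst (u i))) = 0" and J: "finite J" "j \<in> J" for c and J :: "nat set" and j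
      proof -
        have "fst (\<Sum>i\<in>J. pscale (c i) (u i)) = 0" using z by (simp add: fst_sum pscale_def)
        then have "ip (u j) (\<Sum>i\<in>J. pscale (c i) (u i)) = 0" by (simp add: graph_inner_def l2_inner_def)
        moreover have "ip (u j) (\<Sum>i\<in>J. pscale (c i) (u i)) = (\<Sum>i\<in>J. ip (u j) (pscale (c i) (u i)))"
          by (intro hermitian_sum_right[OF ip_hermitian] V_closed u)
        moreover have "\<dots> = (\<Sum>i\<in>J. if j = i then c i else 0)"
          by (rule sum.cong) (auto simp: hermitian_scale_right[OF ip_hermitian u u] orth)
        ultimately show ?thesis using J by simp
      qed
      have inj: "inj_on (\<lambda>j. fst (u j)) ?I"
      proof (rule inj_onI, rule ccontr)
        fix i j assume eq: "fst (u i) = fst (u j)" and ne: "i \<noteq> j"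
        have "ip (u i) (u j) = ip (u i) (u i)" by (simp add: graph_inner_def eq)
        then show False using orth ne by simp
      qed
      have "gfun.independent ((\<lambda>j. fst (u j)) ` ?I)"
        unfolding gfun.independent_explicit_finite_subsets
      proof (intro allI impI ballI)
        fix S g v assume S: "S \<subseteq> (\<lambda>j. fst (u j)) ` ?I" "finite S" "(\<Sum>v\<in>S. gscale (g v) v) = 0" "v \<in> S"
        define J where "J = {j \<in> ?I. fst (u j) \<in> S}"
        have J: "S = (\<lambda>j. fst (u j)) ` J" "finite J" "inj_on (\<lambda>j. fst (u j)) J"
          using S(1) inj by (auto simp: J_def intro: inj_on_subset)
        have "(\<Sum>i\<in>J. gscale (g (fst (u i))) (fst (u i))) = 0"
          using S(3) unfolding J(1) sum.reindex[OF J(3)] by (simp add: o_def)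
        then show "g v = 0" using coeff[of "\<lambda>i. g (fst (u i))" J] J S(4) by auto
      qed
      moreover have "(\<lambda>j. fst (u j)) ` ?I \<subseteq> gfun.span Bs" using uE Bs(2) by auto
      ultimately have "card ((\<lambda>j. fst (u j)) ` ?I) \<le> card Bs"
        using gfun.independent_span_bound[OF Bs(1)] by blast
      then show ?thesis using card_image[OF inj] Bs(3) by simp
    qed
    then have "(\<Sum>\<mu>\<in>lam ` {..n}. card {j \<in> {..n}. lam j = \<mu>}) \<le> (\<Sum>\<mu>\<in>lam ` {..n}. multiplicity H \<mu>)"
      by (intro sum_mono)
    moreover have "(\<Sum>\<mu>\<in>lam ` {..n}. card {j \<in> {..n}. lam j = \<mu>}) = Suc n"
      using sum.group[of "{..n}" "lam ` {..n}" lam "\<lambda>_. 1::nat"] by simp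
    ultimately show "Suc n \<le> (\<Sum>\<mu>\<in>lam ` {..n}. multiplicity H \<mu>)" by simp
  qed simp
  have nth: "nth_eigenvalue H (Suc n) = lam n" for n
    unfolding nth_eigenvalue_def
  proof (rule cInf_eq_minimum)
    show "lam n \<in> {t. \<exists>M. finite M \<and> (\<forall>\<mu>\<in>M. eigenvalue H \<mu> \<and> \<mu> \<le> t) \<and> Suc n \<le> (\<Sum>\<mu>\<in>M. multiplicity H \<mu>)}"
      using attained by blast
  qed (use count in blast)
  show ?thesis by (rule that[OF u orth weak min mono nth])
qed

end

section \<open>Comparison under insertion of a graph\<close>

context schroedinger_graph
begin

theorem nth_eigenvalue_le:
  assumes w: "\<And>j. j \<le> n \<Longrightarrow> w j \<in> V"
    and pos: "\<And>c. \<exists>j\<le>n. c j \<noteq> 0 \<Longrightarrow> 0 < Re (ip (pairs.lincomb n c w) (pairs.lincomb n c w))"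
    and le: "\<And>c. Re (a (pairs.lincomb n c w) (pairs.lincomb n c w))
                \<le> t * Re (ip (pairs.lincomb n c w) (pairs.lincomb n c w))"
  shows "nth_eigenvalue H (Suc n) \<le> t"
proof (rule eigenvalue_sequence)
  fix u and lam :: "nat \<Rightarrow> real"
  assume u: "\<And>n. u n \<in> V" and "\<And>n. nth_eigenvalue H (Suc n) = lam n"
    and min: "\<And>n y. y \<in> V \<Longrightarrow> (\<And>i. i < n \<Longrightarrow> ip (u i) y = 0) \<Longrightarrow> lam n * Re (ip y y) \<le> Re (a y y)"
  moreover have "lam n \<le> t" by (rule trial_space_bound[OF u min w pos le])
  ultimately show ?thesis by simp
qed

text \<open>
  The first \<open>n + 1\<close> eigenvectors span an optimal trial space for
  \<open>nth_eigenvalue_le\<close>.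
\<close>

theorem nth_eigenvalue_trial_space:
  "\<exists>w. (\<forall>j\<le>n. w j \<in> V) \<and>
     (\<forall>c. (\<exists>j\<le>n. c j \<noteq> 0) \<longrightarrow> 0 < Re (ip (pairs.lincomb n c w) (pairs.lincomb n c w))) \<and>
     (\<forall>c. Re (a (pairs.lincomb n c w) (pairs.lincomb n c w))
        \<le> nth_eigenvalue H (Suc n) * Re (ip (pairs.lincomb n c w) (pairs.lincomb n c w)))"
proof (rule eigenvalue_sequence)
  fix u and lam :: "nat \<Rightarrow> real"
  assume u: "\<And>n. u n \<in> V" and nth: "\<And>n. nth_eigenvalue H (Suc n) = lam n"
    and orth: "\<And>m n. ip (u m) (u n) = (if m = n then 1 else 0)"
    and weak: "\<And>n y. y \<in> V \<Longrightarrow> a (u n) y = of_real (lam n) * ip (u n) y"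
    and mono: "\<And>i n. i \<le> n \<Longrightarrow> lam i \<le> lam n"
  define y where "y c = (\<Sum>j\<le>n. pscale (c j) (u j))" for c
  have yV: "y c \<in> V" for c unfolding y_def by (intro V_closed u)
  have uy: "ip (u i) (y c) = c i" if "i \<le> n" for i c
  proof -
    have "ip (u i) (y c) = (\<Sum>j\<le>n. ip (u i) (pscale (c j) (u j)))"
      unfolding y_def by (intro hermitian_sum_right[OF ip_hermitian] V_closed u)
    also have "\<dots> = (\<Sum>j\<le>n. if i = j then c j else 0)"
      by (rule sum.cong) (auto simp: hermitian_scale_right[OF ip_hermitian u u] orth)
    finally show ?thesis using that by simp
  qed
  have sq: "c * cnj c = of_real ((cmod c)\<^sup>2)" for c by (rule complex_norm_square[symmetric])
  have expand: "p (y c) (y c) = (\<Sum>j\<le>n. c j * cnj (p (u j) (y c)))" if p: "pairs.hermitian_on V p" for p c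
  proof -
    have "p (y c) (y c) = (\<Sum>j\<le>n. p (y c) (pscale (c j) (u j)))"
      by (subst (2) y_def, rule hermitian_sum_right[OF p]) (auto intro!: V_closed u yV)
    also have "\<dots> = (\<Sum>j\<le>n. c j * cnj (p (u j) (y c)))"
      using hermitian_scale_right[OF p yV u] hermitian_swap[OF p u yV] by (intro sum.cong) auto
    finally show ?thesis .
  qed
  have ipy: "Re (ip (y c) (y c)) = (\<Sum>j\<le>n. (cmod (c j))\<^sup>2)" for c
    using expand[OF ip_hermitian, of c] uy[of _ c] by (simp add: sq)
  have ay: "Re (a (y c) (y c)) = (\<Sum>j\<le>n. lam j * (cmod (c j))\<^sup>2)" for c
  proof -
    have "a (y c) (y c) = (\<Sum>j\<le>n. c j * cnj (a (u j) (y c)))" by (rule expand[OF a_hermitian])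
    also have "\<dots> = (\<Sum>j\<le>n. of_real (lam j) * (c j * cnj (c j)))"
      using uy[of _ c] weak[OF yV] by (intro sum.cong) auto
    finally show ?thesis by (simp add: sq del: complex_mult_cnj)
  qed
  have pos: "0 < Re (ip (y c) (y c))" if c: "\<exists>j\<le>n. c j \<noteq> 0" for c
  proof -
    obtain j where "j \<le> n" "c j \<noteq> 0" using c by blast
    then show ?thesis unfolding ipy by (intro sum_pos2[of _ j]) auto
  qed
  have le: "Re (a (y c) (y c)) \<le> nth_eigenvalue H (Suc n) * Re (ip (y c) (y c))" for c
    unfolding ay ipy nth sum_distrib_left using mono by (intro sum_mono mult_right_mono) auto
  show ?thesis using u pos le unfolding y_def by blast
qed

end

text \<open>
  The Cauchy-Schwarz inequality \<open>|\<Sum> s|\<^sup>2 \<le> (\<Sum> |b|) (\<Sum> |s|\<^sup>2 /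
  |b|)\<close>; the negative signs of the strengths turn it around.
\<close>

lemma sum_inverse_strength_le:
  fixes s :: "'v \<Rightarrow> complex"
  assumes fin: "finite R" and neg: "\<And>v. v \<in> R \<Longrightarrow> b v < 0"
  shows "(\<Sum>v\<in>R. 1 / b v * (cmod (s v))\<^sup>2) \<le> 1 / (\<Sum>v\<in>R. b v) * (cmod (\<Sum>v\<in>R. s v))\<^sup>2"
proof (cases "R = {}")
  case False
  let ?T = "\<Sum>v\<in>R. (cmod (s v))\<^sup>2 / - b v" and ?S = "\<Sum>v\<in>R. - b v"
  have S: "0 < ?S" using fin False neg by (intro sum_pos) auto
  have "(cmod (\<Sum>v\<in>R. s v))\<^sup>2 \<le> (\<Sum>v\<in>R. cmod (s v))\<^sup>2" by (intro power_mono norm_sum) auto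
  also have "(\<Sum>v\<in>R. cmod (s v)) = (\<Sum>v\<in>R. sqrt (- b v) * (cmod (s v) / sqrt (- b v)))"
  proof (rule sum.cong[OF refl])
    fix v assume "v \<in> R"
    then have "sqrt (- b v) \<noteq> 0" using neg[of v] by simp
    then show "cmod (s v) = sqrt (- b v) * (cmod (s v) / sqrt (- b v))" by simp
  qed
  also have "\<dots>\<^sup>2 \<le> (\<Sum>v\<in>R. (sqrt (- b v))\<^sup>2) * (\<Sum>v\<in>R. (cmod (s v) / sqrt (- b v))\<^sup>2)"
    by (rule Cauchy_Schwarz_ineq_sum)
  also have "(\<Sum>v\<in>R. (sqrt (- b v))\<^sup>2) = ?S" using neg by (intro sum.cong) (auto simp: less_imp_le)
  also have "(\<Sum>v\<in>R. (cmod (s v) / sqrt (- b v))\<^sup>2) = ?T"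
    using neg by (intro sum.cong) (auto simp: power_divide less_imp_le)
  finally have "(cmod (\<Sum>v\<in>R. s v))\<^sup>2 / ?S \<le> ?T" using S by (simp add: pos_divide_le_eq mult.commute)
  moreover have "?T = - (\<Sum>v\<in>R. 1 / b v * (cmod (s v))\<^sup>2)"
    unfolding sum_negf[symmetric] by (rule sum.cong) auto
  moreover have "?S = - (\<Sum>v\<in>R. b v)" by (rule sum_negf)
  ultimately show ?thesis by simp
qed simp

lemma AE_eq_schroedinger:
  assumes "\<And>e. e \<in> edges G \<Longrightarrow> AE x in lebesgue_on {0..len G e}. q e x = q' e x"
  shows "schroedinger G q C \<subseteq> schroedinger G q' C"
proof
  fix z assume "z \<in> schroedinger G q C"
  then obtain f h where z: "z = (f, h)" and f: "f \<in> op_domain G C"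
    and g: "\<forall>e\<in>edges G. \<exists>g. has_L2_deriv2 (len G e) (f e) g \<and>
      (AE x in lebesgue_on {0..len G e}. h e x = - g x + complex_of_real (q e x) * f e x)"
    unfolding schroedinger_def by blast
  have "\<exists>g. has_L2_deriv2 (len G e) (f e) g \<and>
      (AE x in lebesgue_on {0..len G e}. h e x = - g x + complex_of_real (q' e x) * f e x)" if e: "e \<in> edges G" for e
  proof -
    obtain g where "has_L2_deriv2 (len G e) (f e) g"
      and h: "AE x in lebesgue_on {0..len G e}. h e x = - g x + complex_of_real (q e x) * f e x" using g e by blast
    moreover have "AE x in lebesgue_on {0..len G e}. h e x = - g x + complex_of_real (q' e x) * f e x"
      using h assms[OF e] by eventually_elim simp
    ultimately show ?thesis by blast
  qed
  then show "z \<in> schroedinger G q' C" using z f unfolding schroedinger_def by blast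
qed

lemma insertingD:
  assumes "inserting G v0 G' Gt"
  shows "v0 \<in> verts G" "(verts G - {v0}) \<inter> verts G' = {}" "edges G \<inter> edges G' = {}"
    "verts Gt = (verts G - {v0}) \<union> verts G'" "edges Gt = edges G \<union> edges G'"
    "e \<in> edges G \<Longrightarrow> len Gt e = len G e"
    "e' \<in> edges G' \<Longrightarrow> len Gt e' = len G' e'" "e' \<in> edges G' \<Longrightarrow> att Gt (e', b) = att G' (e', b)"
    "e \<in> edges G \<Longrightarrow> att G (e, b) = v0 \<Longrightarrow> att Gt (e, b) \<in> verts G'"
    "e \<in> edges G \<Longrightarrow> att G (e, b) \<noteq> v0 \<Longrightarrow> att Gt (e, b) = att G (e, b)"
proof -
  note ins = assms[unfolded inserting_def]
  show "v0 \<in> verts G" "(verts G - {v0}) \<inter> verts G' = {}" "edges G \<inter> edges G' = {}"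
    "verts Gt = (verts G - {v0}) \<union> verts G'" "edges Gt = edges G \<union> edges G'"
    "e \<in> edges G \<Longrightarrow> len Gt e = len G e"
    "e' \<in> edges G' \<Longrightarrow> len Gt e' = len G' e'" "e' \<in> edges G' \<Longrightarrow> att Gt (e', b) = att G' (e', b)"
    using ins by blast+
  have att: "\<forall>e\<in>edges G. \<forall>b. if att G (e, b) = v0 then att Gt (e, b) \<in> verts G' else att Gt (e, b) = att G (e, b)"
    using ins by blast
  show "e \<in> edges G \<Longrightarrow> att G (e, b) = v0 \<Longrightarrow> att Gt (e, b) \<in> verts G'"
    using att by simp
  show "e \<in> edges G \<Longrightarrow> att G (e, b) \<noteq> v0 \<Longrightarrow> att Gt (e, b) = att G (e, b)"
    using att by simp
qed

lemma compact_metric_graphD: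
  assumes "compact_metric_graph G"
  shows "finite (verts G)" "finite (edges G)" "e \<in> edges G \<Longrightarrow> 0 < len G e" "e \<in> edges G \<Longrightarrow> att G (e, b) \<in> verts G"
  using assms by (simp_all add: compact_metric_graph_def)

lemma mem_ends_at: "(e, b) \<in> ends_at G v \<longleftrightarrow> e \<in> edges G \<and> att G (e, b) = v"
  by (simp add: ends_at_def)

lemma inserting_ends_outside:
  assumes G': "compact_metric_graph G'" and ins: "inserting G v0 G' Gt" and v: "v \<in> verts G - {v0}"
  shows "ends_at Gt v = ends_at G v"
proof -
  note I = insertingD[OF ins]
  have v': "v \<notin> verts G'" "v \<noteq> v0" using I(2) v by blast+
  have "(e, b) \<in> ends_at Gt v \<longleftrightarrow> (e, b) \<in> ends_at G v" for e b
  proof (cases "e \<in> edges G")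
    case True
    show ?thesis
    proof (cases "att G (e, b) = v0")
      case v0: True
      then have "att Gt (e, b) \<noteq> v" using I(9)[OF True v0] v'(1) by blast
      then show ?thesis using v0 v'(2) by (simp add: mem_ends_at)
    next
      case False
      then show ?thesis using I(5) I(10)[OF True False] True by (simp add: mem_ends_at)
    qed
  next
    case False
    have "att Gt (e, b) \<in> verts G'" if "e \<in> edges G'"
      using I(8)[OF that] compact_metric_graphD(4)[OF G' that] by simp
    then show ?thesis using False I(5) v'(1) by (auto simp: mem_ends_at)
  qed
  then show ?thesis by (intro set_eqI) (simp only: split_paired_all)
qed

text \<open>
  The old edge ends at an inserted vertex are exactly the ends of \<open>v0\<close> that are
  attached to it.
\<close>

lemma inserting_ends_inside:
  assumes G: "compact_metric_graph G" and ins: "inserting G v0 G' Gt" and v: "v \<in> verts G'"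
  shows "{i \<in> ends_at Gt v. fst i \<in> edges G} = {i \<in> ends_at G v0. att Gt i = v}"
proof -
  note I = insertingD[OF ins]
  have "(e, b) \<in> ends_at Gt v \<and> e \<in> edges G \<longleftrightarrow> (e, b) \<in> ends_at G v0 \<and> att Gt (e, b) = v" for e b
  proof (cases "e \<in> edges G \<and> att G (e, b) \<noteq> v0")
    case True
    then have "att Gt (e, b) \<in> verts G - {v0}"
      using I(10)[of e b] compact_metric_graphD(4)[OF G, of e b] by simp
    then show ?thesis using True v I(2) by (auto simp: mem_ends_at)
  next
    case False
    then show ?thesis using I(5) by (auto simp: mem_ends_at)
  qed
  then show ?thesis by (intro set_eqI) (simp only: mem_Collect_eq split_paired_all fst_conv)
qed

lemma inserting_compact:
  assumes G: "compact_metric_graph G" and G': "compact_metric_graph G'" and ins: "inserting G v0 G' Gt"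
  shows "compact_metric_graph Gt"
proof -
  note I = insertingD[OF ins]
  have "0 < len Gt e \<and> att Gt (e, b) \<in> verts Gt" if "e \<in> edges Gt" for e b
  proof (cases "e \<in> edges G")
    case True
    then show ?thesis
      using I(4) I(6)[OF True] I(9)[OF True, of b] I(10)[OF True, of b] compact_metric_graphD(3)[OF G True] compact_metric_graphD(4)[OF G True, of b]
      by (cases "att G (e, b) = v0") auto
  next
    case False
    then have e: "e \<in> edges G'" using that I(5) by blast
    then show ?thesis using I(4) I(7)[OF e] I(8)[OF e, of b] compact_metric_graphD(3)[OF G' e] compact_metric_graphD(4)[OF G' e, of b] by auto
  qed
  moreover have "finite (verts Gt)" "finite (edges Gt)"
    using I(4,5) compact_metric_graphD(1,2)[OF G] compact_metric_graphD(1,2)[OF G'] by auto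
  ultimately show ?thesis unfolding compact_metric_graph_def by blast
qed

lemma form_condition_hermitian:
  "form_condition S C A B \<Longrightarrow> inner_on S y (app S B x) = cnj (inner_on S x (app S B y))"
  unfolding form_condition_def by blast

text \<open>
  The two operators with their forms. The potential is common to both; the vertices other than
  \<open>v0\<close> keep their matrices, and the matrices at \<open>v0\<close> and at the receiving
  vertices are those of \<open>\<delta>'\<close> conditions. Extension by zero is invisible below,
  because functions of the form domain vanish off the edges of their graph anyway.
\<close>

locale vertex_insertion =
  old: schroedinger_graph G q A B C + new: schroedinger_graph Gt q At Bt Ct
  for G Gt :: "('v, 'e) mgraph" and q A B C At Bt Ct +
  fixes G' :: "('v, 'e) mgraph" and v0 :: 'v and \<beta> :: real and \<beta>v :: "'v \<Rightarrow> real"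
  assumes graph': "compact_metric_graph G'"
    and ins: "inserting G v0 G' Gt"
    and A_eq: "\<And>v. v \<in> verts G - {v0} \<Longrightarrow> At v = A v" and B_eq: "\<And>v. v \<in> verts G - {v0} \<Longrightarrow> Bt v = B v"
    and B_v0: "B v0 = (\<lambda>_ _. complex_of_real (1 / \<beta>))"
    and At_rec: "\<And>v. v \<in> receiving_verts G v0 G' Gt \<Longrightarrow> At v = (\<lambda>_ _. 0)"
    and Bt_rec: "\<And>v. v \<in> receiving_verts G v0 G' Gt \<Longrightarrow> Bt v = (\<lambda>_ _. complex_of_real (1 / \<beta>v v))"
    and \<beta>v_neg: "\<And>v. v \<in> receiving_verts G v0 G' Gt \<Longrightarrow> \<beta>v v < 0"
    and \<beta>v_sum: "(\<Sum>v\<in>receiving_verts G v0 G' Gt. \<beta>v v) = \<beta>"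
begin

lemmas inserted = insertingD[OF ins]

abbreviation "R \<equiv> receiving_verts G v0 G' Gt"

lemma receiving_subset: "R \<subseteq> verts G'"
  by (auto simp: receiving_verts_def)

lemma finite_receiving: "finite R"
  using receiving_subset compact_metric_graphD(1)[OF graph'] finite_subset by blast

lemma zero_new_edge: "p \<in> old.V \<Longrightarrow> e \<notin> edges G \<Longrightarrow> fst p e = (\<lambda>_. 0) \<and> snd p e = (\<lambda>_. 0)"
  using old.form_domain_outside by (auto simp: fun_eq_iff)

lemma bval_new: 
  assumes p: "p \<in> old.V"
  shows "bval Gt (fst p) = bval G (fst p)"
proof
  fix i :: "'e \<times> bool"
  show "bval Gt (fst p) i = bval G (fst p) i"
    using inserted(6)[of "fst i"] zero_new_edge[OF p, of "fst i"]
    by (cases i; cases "fst i \<in> edges G") (auto simp: bval_def)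
qed

lemma bval_zero: "p \<in> old.V \<Longrightarrow> fst i \<notin> edges G \<Longrightarrow> bval G (fst p) i = 0"
  using zero_new_edge[of p "fst i"] by (cases i) (auto simp: bval_def)

lemma ends_not_receiving:
  assumes "v \<in> verts G' - R" "i \<in> ends_at Gt v"
  shows "fst i \<notin> edges G"
proof
  assume "fst i \<in> edges G"
  then have "i \<in> ends_at G v0 \<and> att Gt i = v"
    using inserting_ends_inside[OF old.graph ins, of v] assms by blast
  then show False using assms(1) by (auto simp: receiving_verts_def)
qed

lemma extend_form_domain:
  assumes p: "p \<in> old.V"
  shows "p \<in> new.V"
proof -
  have d: "has_L2_deriv (len Gt e) (fst p e) (snd p e)" for e
    using old.form_domain_deriv[OF p, of e] inserted(6)[of e] zero_new_edge[OF p, of e] has_L2_deriv_zero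
    by (cases "e \<in> edges G") auto
  have out: "fst p e x = 0 \<and> snd p e x = 0" if "e \<notin> edges Gt \<or> x \<notin> {0..len Gt e}" for e x
    using that inserted(5) inserted(6)[of e] zero_new_edge[OF p, of e] old.form_domain_outside[OF p, of e x]
    by (cases "e \<in> edges G") auto
  have vert: "app (ends_at Gt v) (At v) (bval Gt (fst p)) = (\<lambda>_. 0)" if v: "v \<in> verts Gt" for v
  proof -
    consider "v \<in> verts G - {v0}" | "v \<in> R" | "v \<in> verts G' - R" using v inserted(4) by blast
    then show ?thesis
    proof cases
      case 1
      then show ?thesis
        using old.form_domain_vertex[OF p, of v] A_eq inserting_ends_outside[OF graph' ins 1]
        by (simp add: bval_new[OF p])
    next
      case 2
      then show ?thesis using At_rec by (simp add: app_zero_matrix)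
    next
      case 3
      have "app (ends_at Gt v) (At v) (bval Gt (fst p)) = app (ends_at Gt v) (At v) (\<lambda>i. 0 * 0)"
        by (rule app_cong) (use ends_not_receiving[OF 3] bval_zero[OF p] bval_new[OF p] in auto)
      then show ?thesis using app_scale[of "ends_at Gt v" "At v" 0 "\<lambda>_. 0"] by simp
    qed
  qed
  have "(fst p, snd p) \<in> new.V"
    unfolding form_domain_def mem_Collect_eq split using d out vert by blast
  then show ?thesis by simp
qed

lemma sum_new_edges:
  assumes "\<And>e. e \<in> edges G' \<Longrightarrow> h e = 0"
  shows "sum h (edges Gt) = sum h (edges G)"
proof -
  have "sum h (edges Gt) = sum h (edges G) + sum h (edges G')"
    unfolding inserted(5) using inserted(3) old.finite_edges compact_metric_graphD(2)[OF graph'] by (intro sum.union_disjoint) auto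
  then show ?thesis using assms by simp
qed

lemma extend_inner:
  assumes p: "p \<in> old.V" and p': "p' \<in> old.V"
  shows "graph_inner Gt p p' = graph_inner G p p'"
proof -
  have "graph_inner Gt p p' = (\<Sum>e\<in>edges G. l2_inner (len Gt e) (fst p e) (fst p' e))"
    unfolding graph_inner_def
  proof (rule sum_new_edges)
    fix e assume "e \<in> edges G'"
    then have "e \<notin> edges G" using inserted(3) by blast
    then show "l2_inner (len Gt e) (fst p e) (fst p' e) = 0"
      using zero_new_edge[OF p, of e] by (simp add: l2_inner_def)
  qed
  then show ?thesis unfolding graph_inner_def using inserted(6) by simp
qed

text \<open>
  The extension vanishes at all ends of inserted edges. So the boundary term of a receiving vertex
  \<open>v\<close> involves only the sum \<open>s v\<close> of the values that it takes over from
  \<open>v0\<close>, and these sums add up to the sum of all boundary values at \<open>v0\<close>.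
\<close>

lemma extend_boundary_form:
  assumes p: "p \<in> old.V"
  shows "Re (boundary_form Gt Bt (bval Gt (fst p)) (bval Gt (fst p)))
       \<le> Re (boundary_form G B (bval G (fst p)) (bval G (fst p)))"
proof -
  define F where "F = bval G (fst p)"
  have F0: "F i = 0" if "fst i \<notin> edges G" for i using bval_zero[OF p that] by (simp add: F_def)
  define s where "s v = (\<Sum>i\<in>{i \<in> ends_at G v0. att Gt i = v}. F i)" for v
  define T where "T v = inner_on (ends_at Gt v) F (app (ends_at Gt v) (Bt v) F)" for v
  have finv: "finite (verts G - {v0})" "finite (verts G')"
    using old.finite_verts compact_metric_graphD(1)[OF graph'] by auto
  have fine: "finite (ends_at Gt v)" "finite (ends_at G v)" for v
    by (rule finite_ends_at[OF new.finite_edges], rule finite_ends_at[OF old.finite_edges])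
  have T_old: "T v = inner_on (ends_at G v) F (app (ends_at G v) (B v) F)" if "v \<in> verts G - {v0}" for v
    unfolding T_def using that B_eq inserting_ends_outside[OF graph' ins that] by simp
  have T_other: "T v = 0" if "v \<in> verts G' - R" for v
    unfolding T_def inner_on_def using ends_not_receiving[OF that] F0 by (intro sum.neutral) auto
  have delta: "Re (complex_of_real r * cnj z * z) = r * (cmod z)\<^sup>2" for r z
    by (simp add: cmod_power2 algebra_simps power2_eq_square[of "Re z"] power2_eq_square[of "Im z"])
  have T_rec: "Re (T v) = 1 / \<beta>v v * (cmod (s v))\<^sup>2" if v: "v \<in> R" for v
  proof -
    have "(\<Sum>i\<in>ends_at Gt v. F i) = (\<Sum>i\<in>{i \<in> ends_at Gt v. fst i \<in> edges G}. F i)"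
      using fine F0 by (intro sum.mono_neutral_right) auto
    also have "\<dots> = s v"
      unfolding s_def using inserting_ends_inside[OF old.graph ins, of v] v receiving_subset by auto
    finally show ?thesis
      unfolding T_def Bt_rec[OF v] inner_on_delta_prime_form by (simp only: delta)
  qed
  have s_sum: "(\<Sum>v\<in>R. s v) = (\<Sum>i\<in>ends_at G v0. F i)"
    unfolding s_def
  proof (rule sum.group[OF fine(2) finite_receiving])
    show "att Gt ` ends_at G v0 \<subseteq> R"
      using inserted(9) by (auto simp: receiving_verts_def ends_at_def)
  qed
  have "boundary_form Gt Bt F F = sum T (verts Gt)"
    by (simp add: boundary_form_def T_def)
  also have "\<dots> = sum T (verts G - {v0}) + sum T (verts G')"
    unfolding inserted(4) using inserted(2) finv by (intro sum.union_disjoint) auto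
  also have "sum T (verts G') = sum T R"
    using finv receiving_subset T_other by (intro sum.mono_neutral_right) auto
  finally have "Re (boundary_form Gt Bt F F) = Re (sum T (verts G - {v0})) + (\<Sum>v\<in>R. Re (T v))" by simp
  also have "(\<Sum>v\<in>R. Re (T v)) = (\<Sum>v\<in>R. 1 / \<beta>v v * (cmod (s v))\<^sup>2)" using T_rec by (intro sum.cong) auto
  also have "\<dots> \<le> 1 / (\<Sum>v\<in>R. \<beta>v v) * (cmod (\<Sum>v\<in>R. s v))\<^sup>2"
    by (rule sum_inverse_strength_le[OF finite_receiving \<beta>v_neg])
  also have "\<dots> = Re (inner_on (ends_at G v0) F (app (ends_at G v0) (B v0) F))"
    unfolding B_v0 inner_on_delta_prime_form delta \<beta>v_sum s_sum ..
  also have "Re (sum T (verts G - {v0})) + \<dots> = Re (boundary_form G B F F)"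
  proof -
    have "boundary_form G B F F = inner_on (ends_at G v0) F (app (ends_at G v0) (B v0) F) +
        (\<Sum>v\<in>verts G - {v0}. inner_on (ends_at G v) F (app (ends_at G v) (B v) F))"
      unfolding boundary_form_def using old.finite_verts inserted(1) by (rule sum.remove)
    also have "(\<Sum>v\<in>verts G - {v0}. inner_on (ends_at G v) F (app (ends_at G v) (B v) F)) = sum T (verts G - {v0})"
      using T_old by (intro sum.cong) auto
    finally show ?thesis by simp
  qed
  finally show ?thesis by (simp add: F_def bval_new[OF p])
qed

lemma extend_form:
  assumes p: "p \<in> old.V"
  shows "Re (graph_form Gt q Bt p p) \<le> Re (graph_form G q B p p)"
proof -
  have zero: "fst p e = (\<lambda>_. 0) \<and> snd p e = (\<lambda>_. 0)" if "e \<in> edges G'" for e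
    using zero_new_edge[OF p, of e] inserted(3) that by blast
  have "(\<Sum>e\<in>edges Gt. l2_inner (len Gt e) (snd p e) (snd p e)) = (\<Sum>e\<in>edges G. l2_inner (len Gt e) (snd p e) (snd p e))"
    by (rule sum_new_edges) (simp add: zero l2_inner_def)
  moreover have "(\<Sum>e\<in>edges Gt. l2_inner (len Gt e) (fst p e) (\<lambda>x. complex_of_real (q e x) * fst p e x)) =
      (\<Sum>e\<in>edges G. l2_inner (len Gt e) (fst p e) (\<lambda>x. complex_of_real (q e x) * fst p e x))"
    by (rule sum_new_edges) (simp add: zero l2_inner_def)
  ultimately show ?thesis
    unfolding graph_form_def using extend_boundary_form[OF p] inserted(6) by simp
qed

theorem nth_eigenvalue_insertion_le:
  "nth_eigenvalue (schroedinger Gt q Ct) (Suc n) \<le> nth_eigenvalue (schroedinger G q C) (Suc n)"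
proof -
  obtain w where w: "\<And>j. j \<le> n \<Longrightarrow> w j \<in> old.V"
    and pos: "\<And>c. \<exists>j\<le>n. c j \<noteq> 0 \<Longrightarrow> 0 < Re (graph_inner G (pairs.lincomb n c w) (pairs.lincomb n c w))"
    and le: "\<And>c. Re (graph_form G q B (pairs.lincomb n c w) (pairs.lincomb n c w))
        \<le> nth_eigenvalue (schroedinger G q C) (Suc n) * Re (graph_inner G (pairs.lincomb n c w) (pairs.lincomb n c w))"
    using old.nth_eigenvalue_trial_space[of n] by blast
  have V: "(pairs.lincomb n c w) \<in> old.V" for c by (intro old.V_closed w) auto
  show ?thesis
  proof (rule new.nth_eigenvalue_le)
    show "w j \<in> new.V" if "j \<le> n" for j by (rule extend_form_domain[OF w[OF that]])
    show "0 < Re (graph_inner Gt (pairs.lincomb n c w) (pairs.lincomb n c w))"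
      if "\<exists>j\<le>n. c j \<noteq> 0" for c
      unfolding extend_inner[OF V V] by (rule pos[OF that])
    show "Re (graph_form Gt q Bt (pairs.lincomb n c w) (pairs.lincomb n c w))
        \<le> nth_eigenvalue (schroedinger G q C) (Suc n) * Re (graph_inner Gt (pairs.lincomb n c w) (pairs.lincomb n c w))" for c
      unfolding extend_inner[OF V V] by (rule order_trans[OF extend_form[OF V] le])
  qed
qed

end

theorem theorem4p13:
  fixes G G' Gt :: "('v, 'e) mgraph"
    and v0 :: 'v
    and q qt :: "'e \<Rightarrow> real \<Rightarrow> real"
    and C Ct :: "'v \<Rightarrow> ('e \<times> bool) vcond"
    and \<beta> :: real
    and \<beta>v :: "'v \<Rightarrow> real"
    and k :: nat
  assumes "compact_metric_graph G"
    and "compact_metric_graph G'"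
    and "inserting G v0 G' Gt"
    and "\<And>e. e \<in> edges G \<Longrightarrow> Linf (len G e) (q e)"
    and "\<And>v. v \<in> verts G - {v0} \<Longrightarrow> local_self_adjoint (ends_at G v) (C v)"
    and "\<beta> < 0"
    and "C v0 = delta_prime (ends_at G v0) \<beta>"
    and "\<And>v. v \<in> verts G - {v0} \<Longrightarrow> Ct v = C v"
    and "\<And>e. e \<in> edges G \<Longrightarrow> (AE x in lebesgue_on {0..len G e}. qt e x = q e x)"
    and "\<And>e. e \<in> edges G' \<Longrightarrow> Linf (len G' e) (qt e)"
    and "\<And>v. v \<in> receiving_verts G v0 G' Gt \<Longrightarrow>
           \<beta>v v < 0 \<and> Ct v = delta_prime (ends_at Gt v) (\<beta>v v)"
    and "(\<Sum>v\<in>receiving_verts G v0 G' Gt. \<beta>v v) = \<beta>"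
    and "\<And>v. v \<in> verts G' - receiving_verts G v0 G' Gt \<Longrightarrow>
           local_self_adjoint (ends_at Gt v) (Ct v)"
    and "k \<ge> 1"
  shows "nth_eigenvalue (schroedinger Gt qt Ct) k \<le> nth_eigenvalue (schroedinger G q C) k"
proof -
  note graph = assms(1) and graph' = assms(2) and ins = assms(3)
  note I = insertingD[OF ins]
  let ?R = "receiving_verts G v0 G' Gt"
  have graph_t: "compact_metric_graph Gt" by (rule inserting_compact[OF graph graph' ins])
  have fin: "finite (ends_at G v)" "finite (ends_at Gt v)" for v
    by (rule finite_ends_at[OF compact_metric_graphD(2)[OF graph]],
        rule finite_ends_at[OF compact_metric_graphD(2)[OF graph_t]])
  \<comment> \<open>A negative total strength forces some edge end at \<open>v0\<close>, so both graphs have edges.\<close>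
  have "?R \<noteq> {}" using assms(6,12) by auto
  then have ne: "edges G \<noteq> {}" by (auto simp: receiving_verts_def ends_at_def)
  define r where "r e = (if e \<in> edges G then q e else qt e)" for e
  have r_old: "r e = q e" if "e \<in> edges G" for e using that by (simp add: r_def)
  have r_new: "r e = qt e" if "e \<in> edges G'" for e using that I(3) by (auto simp: r_def)
  have ae: "AE x in lebesgue_on {0..len Gt e}. qt e x = r e x" if "e \<in> edges Gt" for e
  proof (cases "e \<in> edges G")
    case True
    show ?thesis unfolding I(6)[OF True] r_old[OF True] by (rule assms(9)[OF True])
  qed (simp add: r_def)
  have ae': "AE x in lebesgue_on {0..len Gt e}. r e x = qt e x" if "e \<in> edges Gt" for e
    using ae[OF that] by eventually_elim simp
  have eq_t: "schroedinger Gt qt Ct = schroedinger Gt r Ct"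
    using AE_eq_schroedinger[OF ae] AE_eq_schroedinger[OF ae'] by blast
  have eq: "schroedinger G q C = schroedinger G r C"
    using AE_eq_schroedinger[of G q r C] AE_eq_schroedinger[of G r q C] r_old by auto
  have "\<exists>AB. form_condition (ends_at Gt v) (Ct v) (fst AB) (snd AB) \<and>
      (v \<in> ?R \<longrightarrow> fst AB = (\<lambda>_ _. 0) \<and> snd AB = (\<lambda>_ _. complex_of_real (1 / \<beta>v v)))"
    if v: "v \<in> verts Gt" for v
  proof (cases "v \<in> ?R")
    case True
    then show ?thesis
      using form_condition_delta_prime[OF fin(2), of "\<beta>v v" v] assms(11)[OF True]
      by (intro exI[of _ "(\<lambda>_ _. 0, \<lambda>_ _. complex_of_real (1 / \<beta>v v))"]) auto
  next
    case False
    then consider "v \<in> verts G - {v0}" | "v \<in> verts G' - ?R" using v I(4) by blast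
    then have "local_self_adjoint (ends_at Gt v) (Ct v)"
      using assms(5,8,13) inserting_ends_outside[OF graph' ins, of v] by cases simp_all
    then show ?thesis using form_condition_local_self_adjoint[OF fin(2)] False by fastforce
  qed
  then have "\<forall>v\<in>verts Gt. \<exists>AB. form_condition (ends_at Gt v) (Ct v) (fst AB) (snd AB) \<and>
      (v \<in> ?R \<longrightarrow> fst AB = (\<lambda>_ _. 0) \<and> snd AB = (\<lambda>_ _. complex_of_real (1 / \<beta>v v)))" by blast
  from bchoice[OF this] obtain AB where AB: "\<And>v. v \<in> verts Gt \<Longrightarrow> form_condition (ends_at Gt v) (Ct v) (fst (AB v)) (snd (AB v))"
    "\<And>v. v \<in> verts Gt \<Longrightarrow> v \<in> ?R \<Longrightarrow> fst (AB v) = (\<lambda>_ _. 0) \<and> snd (AB v) = (\<lambda>_ _. complex_of_real (1 / \<beta>v v))"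
    by blast
  define A where "A v = (if v = v0 then (\<lambda>_ _. 0) else fst (AB v))" for v
  define B where "B v = (if v = v0 then (\<lambda>_ _. complex_of_real (1 / \<beta>)) else snd (AB v))" for v
  have C: "form_condition (ends_at G v) (C v) (A v) (B v)" if v: "v \<in> verts G" for v
  proof (cases "v = v0")
    case True
    then show ?thesis using form_condition_delta_prime[OF fin(1), of \<beta> v0] assms(6,7) by (simp add: A_def B_def)
  next
    case False
    then have v': "v \<in> verts G - {v0}" "v \<in> verts Gt" using v I(4) by auto
    then show ?thesis
      using AB(1)[OF v'(2)] assms(8)[OF v'(1)] inserting_ends_outside[OF graph' ins v'(1)] False
      by (simp add: A_def B_def)
  qed
  have rec: "v \<in> verts Gt" if "v \<in> ?R" for v using that I(4) by (auto simp: receiving_verts_def)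
  interpret vertex_insertion G Gt r A B C "\<lambda>v. fst (AB v)" "\<lambda>v. snd (AB v)" Ct G' v0 \<beta> \<beta>v
  proof
    show "Linf (len G e) (r e)" if "e \<in> edges G" for e using assms(4)[OF that] r_old[OF that] by simp
    show "Linf (len Gt e) (r e)" if "e \<in> edges Gt" for e
    proof (cases "e \<in> edges G")
      case True
      then show ?thesis using assms(4)[OF True] r_old[OF True] I(6)[OF True] by simp
    next
      case False
      then have e: "e \<in> edges G'" using that I(5) by blast
      then show ?thesis using assms(10)[OF e] r_new[OF e] I(7)[OF e] by simp
    qed
    show "edges Gt \<noteq> {}" using ne I(5) by blast
    show "form_condition (ends_at G v) (C v) (A v) (B v)"
      and "inner_on (ends_at G v) y (app (ends_at G v) (B v) x) = cnj (inner_on (ends_at G v) x (app (ends_at G v) (B v) y))"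
      if "v \<in> verts G" for v x y
      by (fact C[OF that], fact form_condition_hermitian[OF C[OF that]])
    show "form_condition (ends_at Gt v) (Ct v) (fst (AB v)) (snd (AB v))"
      and "inner_on (ends_at Gt v) y (app (ends_at Gt v) (snd (AB v)) x) =
        cnj (inner_on (ends_at Gt v) x (app (ends_at Gt v) (snd (AB v)) y))"
      if "v \<in> verts Gt" for v x y
      by (fact AB(1)[OF that], fact form_condition_hermitian[OF AB(1)[OF that]])
    show "fst (AB v) = (\<lambda>_ _. 0)" "snd (AB v) = (\<lambda>_ _. complex_of_real (1 / \<beta>v v))" if "v \<in> ?R" for v
      using AB(2)[OF rec[OF that] that] by auto
    show "\<beta>v v < 0" if "v \<in> ?R" for v using assms(11)[OF that] by blast
  qed (fact graph graph' graph_t ins ne assms(12) | simp add: A_def B_def)+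
  obtain n where "k = Suc n" using assms(14) by (cases k) auto
  then show ?thesis using nth_eigenvalue_insertion_le[of n] by (simp add: eq eq_t)
qed

end
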